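(* Let $f$, $\beta\in(0,1/2)$, and all objects $k_m$, $G_m$, $H_n$, $\gamma$, $\hat T$, $\mathbf g^{(1)},\mathbf g^{(2)}$, $F,Q,P^{\pm},R^{\pm}$ be as in the context, with $\varepsilon>0$ and $\mu>0$ sufficiently small (so that $(1-\varepsilon\hat T)^{-1}$ exists). Assume $\mu-\varepsilon\gamma(\mu,\beta)F(\varepsilon,\mu,\beta)\neq 0$. Put $$C=\frac{2\varepsilon\mu\gamma Q}{\mu-\varepsilon\gamma F},\qquad \mathbf g=\mathbf g^{(1)}+\frac{C}{2\mu}\mathbf g^{(2)},\qquad \mathbf A=2\varepsilon\gamma(1-\varepsilon\hat T)^{-1}\mathbf g,$$ $\Psi_0=e^{ik_0x}+G_0\ast A_0$, $\Psi_m=G_m\ast A_m$ for $m\neq0$, and $\Psi(x,y)=e^{i\beta y}\sum_{n\in\mathbb Z}\Psi_n(x)e^{iny}$. Then $\Psi$ solves the scattering problem (in the sense of the context) with $$\mathcal R=\frac{i\varepsilon\gamma}{k_0}\,\frac{1}{\mu-\varepsilon\gamma F}\Big\{(\mu-\varepsilon\gamma F)P^{+}+\varepsilon\gamma QR^{+}\Big\},\qquad \mathcal T=1+\frac{i\varepsilon\gamma}{k_0}\,\frac{1}{\mu-\varepsilon\gamma F}\Big\{(\mu-\varepsilon\gamma F)P^{-}+\varepsilon\gamma QR^{-}\Big\},$$ where all functions are evaluated at $(\varepsilon,\mu,\beta)$ (resp. $(\mu,\beta)$ for $\gamma$).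
   Context: Let $f:\mathbb R^2\to\mathbb R$ be smooth, $2\pi$-periodic in $y$, and vanishing for $|x|>R$ for some fixed $R>0$. Let $\Pi=\mathbb R\times(0,2\pi)$, $0<\beta<1/2$, $\varepsilon>0$, and $\omega^2=(1-\beta)^2-\mu^2$ with $\mu>0$ small. Problem (P): $-\nabla^2\Psi=\omega^2(1+\varepsilon f(x,y))\Psi$ in $\Pi$ with $\Psi(x,2\pi)=e^{2\pi i\beta}\Psi(x,0)$, $\Psi_y(x,2\pi)=e^{2\pi i\beta}\Psi_y(x,0)$, understood weakly: $\int_\Pi\nabla\Psi\cdot\nabla\overline\Phi=\omega^2\int_\Pi(1+\varepsilon f)\Psi\overline\Phi$ for all smooth $\Phi$ satisfying the same boundary conditions and vanishing for large $|x|$. $H_1^\beta(\Pi)$ is the completion of smooth functions satisfying the boundary conditions and vanishing for large $|x|$ in the norm $\|\Psi\|_{L^2(\Pi)}+\|\nabla\Psi\|_{L^2(\Pi)}$. Let $k_0=(1-2\beta-\mu^2)^{1/2}>0$. The scattering problem: find $\Psi$ solving (P) and complex numbers $\mathcal R,\mathcal T$ with $\Psi-\chi(x)\mathcal Te^{i\beta y+ik_0x}-\chi(-x)(e^{i\beta y+ik_0x}+\mathcal Re^{i\beta y-ik_0x})\in H_1^\beta(\Pi)$, where $\chi$ is a smooth cut-off equal to $1$ for $x>1$ and $0$ for $x<0$. Notation: $f_j(x)=\int_0^{2\pi}e^{-ijy}f(x,y)\,dy$, $\tilde f_j(\xi)=\int_{\mathbb R}e^{-i\xi x}f_j(x)\,dx$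 ($j\in\mathbb Z$). For $m\neq0,-1$, $k_m=((\beta+m)^2-(1-\beta)^2+\mu^2)^{1/2}>0$. Green functions: $G_0(x)=\frac{i}{2k_0}e^{ik_0|x|}$, $G_{-1}(x)=\frac1{2\mu}e^{-\mu|x|}$, $G_m(x)=\frac1{2k_m}e^{-k_m|x|}$ ($m\neq0,-1$); $H_n=G_n$ for $n\neq-1$, $H_{-1}(x)=\frac1{2\mu}(e^{-\mu|x|}-1)$. Convolution $(H\ast A)(x)=\int H(x-\xi)A(\xi)\,d\xi$. $\gamma(\mu,\beta)=\frac{1}{4\pi}((1-\beta)^2-\mu^2)$. $\mathcal A$ is the Banach space of sequences $\mathbf A=(A_j)_{j\in\mathbb Z}$ of functions in $C[-R,R]$ (extended by zero outside) with norm $\sum_j(\sup_{[-R,R]}|A_j|)^2$; $\hat T:\mathcal A\to\mathcal A$, $(\hat T\mathbf A)_m=2\gamma\sum_{n\in\mathbb Z}(H_n\ast A_n)f_{m-n}$, which is bounded uniformly for small $\mu$, so $(1-\varepsilon\hat T)^{-1}$ exists for small $\varepsilon$. $(\mathbf g^{(1)})_m=e^{ik_0x}f_m$, $(\mathbf g^{(2)})_m=f_{m+1}$. $\langle h\rangle=\int_{\mathbb R}h(x)\,dx$. $F=\langle((1-\varepsilon\hat T)^{-1}\mathbf g^{(2)})_{-1}\rangle$, $Q=\langle((1-\varepsilon\hat T)^{-1}\mathbf g^{(1)})_{-1}\rangle$, $P^{\pm}=\langle((1-\varepsilon\hat T)^{-1}\mathbf g^{(1)})_0e^{\pm ik_0x}\rangle$,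 $R^{\pm}=\langle((1-\varepsilon\hat T)^{-1}\mathbf g^{(2)})_0e^{\pm ik_0x}\rangle$; these are functions of $(\varepsilon,\mu,\beta)$. *)

theory Defs
  imports "HOL-Analysis.Analysis"
begin

definition smooth1 :: "(real \<Rightarrow> real) \<Rightarrow> bool" where
  "smooth1 u \<longleftrightarrow> (\<exists>D::nat \<Rightarrow> real \<Rightarrow> real. D 0 = u \<and>
      (\<forall>k x. (D k has_real_derivative D (Suc k) x) (at x)))"

definition smooth2 :: "(real \<times> real \<Rightarrow> 'a::real_normed_vector) \<Rightarrow> bool" where
  "smooth2 u \<longleftrightarrow> (\<exists>D::nat \<Rightarrow> nat \<Rightarrow> real \<times> real \<Rightarrow> 'a. D 0 0 = u \<and>
      (\<forall>i j. continuous_on UNIV (D i j) \<and>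
        (\<forall>x y. ((\<lambda>t. D i j (t, y)) has_vector_derivative D (Suc i) j (x, y)) (at x) \<and>
               ((\<lambda>t. D i j (x, t)) has_vector_derivative D i (Suc j) (x, y)) (at y))))"

definition px :: "(real \<times> real \<Rightarrow> complex) \<Rightarrow> real \<times> real \<Rightarrow> complex" where
  "px u p = vector_derivative (\<lambda>t. u (t, snd p)) (at (fst p))"

definition py :: "(real \<times> real \<Rightarrow> complex) \<Rightarrow> real \<times> real \<Rightarrow> complex" where
  "py u p = vector_derivative (\<lambda>t. u (fst p, t)) (at (snd p))"

definition strip :: "(real \<times> real) set" where
  "strip = UNIV \<times> {0<..<2*pi}"

definition loc_int_strip :: "(real \<times> real \<Rightarrow> complex) \<Rightarrow> bool" where
  "loc_int_strip u \<longleftrightarrow> (\<forall>L. u absolutely_integrable_on ({-L..L} \<times> {0<..<2*pi}))"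

definition test_beta :: "real \<Rightarrow> (real \<times> real \<Rightarrow> complex) \<Rightarrow> bool" where
  "test_beta \<beta> \<Phi> \<longleftrightarrow> smooth2 \<Phi> \<and>
     (\<forall>x. \<Phi> (x, 2*pi) = cis (2*pi*\<beta>) * \<Phi> (x, 0) \<and>
          py \<Phi> (x, 2*pi) = cis (2*pi*\<beta>) * py \<Phi> (x, 0)) \<and>
     (\<exists>L. \<forall>x y. \<bar>x\<bar> > L \<longrightarrow> 0 \<le> y \<longrightarrow> y \<le> 2*pi \<longrightarrow> \<Phi> (x, y) = 0)"

definition weak_grad :: "(real \<times> real \<Rightarrow> complex) \<Rightarrow> (real \<times> real \<Rightarrow> complex)
    \<Rightarrow> (real \<times> real \<Rightarrow> complex) \<Rightarrow> bool" where
  "weak_grad u g1 g2 \<longleftrightarrow> loc_int_strip u \<and> loc_int_strip g1 \<and> loc_int_strip g2 \<and>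
     (\<forall>\<phi>. smooth2 \<phi> \<and> compact (closure {p. \<phi> p \<noteq> 0}) \<and> closure {p. \<phi> p \<noteq> 0} \<subseteq> strip \<longrightarrow>
        integral strip (\<lambda>p. u p * px \<phi> p) = - integral strip (\<lambda>p. g1 p * \<phi> p) \<and>
        integral strip (\<lambda>p. u p * py \<phi> p) = - integral strip (\<lambda>p. g2 p * \<phi> p))"

definition weak_sol_P :: "real \<Rightarrow> real \<Rightarrow> (real \<times> real \<Rightarrow> real) \<Rightarrow> real
    \<Rightarrow> (real \<times> real \<Rightarrow> complex) \<Rightarrow> bool" where
  "weak_sol_P \<omega>2 \<epsilon> f \<beta> \<Psi> \<longleftrightarrow> (\<exists>g1 g2. weak_grad \<Psi> g1 g2 \<and>
     (\<forall>\<Phi>. test_beta \<beta> \<Phi> \<longrightarrow>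
        integral strip (\<lambda>p. g1 p * cnj (px \<Phi> p) + g2 p * cnj (py \<Phi> p)) =
        of_real \<omega>2 * integral strip (\<lambda>p. of_real (1 + \<epsilon> * f p) * \<Psi> p * cnj (\<Phi> p))))"

definition H1beta :: "real \<Rightarrow> (real \<times> real \<Rightarrow> complex) \<Rightarrow> bool" where
  "H1beta \<beta> u \<longleftrightarrow> (\<exists>(\<Phi>::nat \<Rightarrow> real \<times> real \<Rightarrow> complex) g1 g2.
     (\<forall>k. test_beta \<beta> (\<Phi> k)) \<and>
     (\<forall>k. (\<lambda>p. (cmod (\<Phi> k p - u p))\<^sup>2) integrable_on strip \<and>
          (\<lambda>p. (cmod (px (\<Phi> k) p - g1 p))\<^sup>2) integrable_on strip \<and>
          (\<lambda>p. (cmod (py (\<Phi> k) p - g2 p))\<^sup>2) integrable_on strip) \<and>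
     (\<lambda>k. integral strip (\<lambda>p. (cmod (\<Phi> k p - u p))\<^sup>2)) \<longlonglongrightarrow> 0 \<and>
     (\<lambda>k. integral strip (\<lambda>p. (cmod (px (\<Phi> k) p - g1 p))\<^sup>2)) \<longlonglongrightarrow> 0 \<and>
     (\<lambda>k. integral strip (\<lambda>p. (cmod (py (\<Phi> k) p - g2 p))\<^sup>2)) \<longlonglongrightarrow> 0)"

definition cutoff :: "(real \<Rightarrow> real) \<Rightarrow> bool" where
  "cutoff chi \<longleftrightarrow> smooth1 chi \<and> (\<forall>x>1. chi x = 1) \<and> (\<forall>x<0. chi x = 0)"

definition fcoef :: "(real \<times> real \<Rightarrow> real) \<Rightarrow> int \<Rightarrow> real \<Rightarrow> complex" where
  "fcoef f j x = integral {0..2*pi} (\<lambda>y. cis (- (of_int j * y)) * of_real (f (x, y)))"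

definition k0 :: "real \<Rightarrow> real \<Rightarrow> real" where
  "k0 \<beta> \<mu> = sqrt (1 - 2*\<beta> - \<mu>\<^sup>2)"

definition km :: "real \<Rightarrow> real \<Rightarrow> int \<Rightarrow> real" where
  "km \<beta> \<mu> m = sqrt ((\<beta> + of_int m)\<^sup>2 - (1 - \<beta>)\<^sup>2 + \<mu>\<^sup>2)"

definition Gr :: "real \<Rightarrow> real \<Rightarrow> int \<Rightarrow> real \<Rightarrow> complex" where
  "Gr \<beta> \<mu> m x =
    (if m = 0 then \<i> / (2 * of_real (k0 \<beta> \<mu>)) * cis (k0 \<beta> \<mu> * \<bar>x\<bar>)
     else if m = -1 then of_real (exp (- \<mu> * \<bar>x\<bar>) / (2*\<mu>))
     else of_real (exp (- km \<beta> \<mu> m * \<bar>x\<bar>) / (2 * km \<beta> \<mu> m)))"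

definition Hr :: "real \<Rightarrow> real \<Rightarrow> int \<Rightarrow> real \<Rightarrow> complex" where
  "Hr \<beta> \<mu> n x = (if n = -1 then of_real ((exp (- \<mu> * \<bar>x\<bar>) - 1) / (2*\<mu>)) else Gr \<beta> \<mu> n x)"

definition conv :: "(real \<Rightarrow> complex) \<Rightarrow> (real \<Rightarrow> complex) \<Rightarrow> real \<Rightarrow> complex" where
  "conv H A x = integral UNIV (\<lambda>\<xi>. H (x - \<xi>) * A \<xi>)"

definition gam :: "real \<Rightarrow> real \<Rightarrow> real" where
  "gam \<mu> \<beta> = ((1 - \<beta>)\<^sup>2 - \<mu>\<^sup>2) / (4*pi)"

definition mean :: "(real \<Rightarrow> complex) \<Rightarrow> complex" where
  "mean h = integral UNIV h"

definition Aspace :: "real \<Rightarrow> (int \<Rightarrow> real \<Rightarrow> complex) set" where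
  "Aspace R = {A. (\<forall>j. continuous_on {-R..R} (A j) \<and> (\<forall>x. x \<notin> {-R..R} \<longrightarrow> A j x = 0)) \<and>
                  (\<lambda>j. (SUP x\<in>{-R..R}. cmod (A j x))\<^sup>2) summable_on UNIV}"

definition Top :: "(real \<times> real \<Rightarrow> real) \<Rightarrow> real \<Rightarrow> real
    \<Rightarrow> (int \<Rightarrow> real \<Rightarrow> complex) \<Rightarrow> int \<Rightarrow> real \<Rightarrow> complex" where
  "Top f \<beta> \<mu> A m x = 2 * of_real (gam \<mu> \<beta>) *
     infsum (\<lambda>n. conv (Hr \<beta> \<mu> n) (A n) x * fcoef f (m - n) x) UNIV"

definition resolv :: "(real \<times> real \<Rightarrow> real) \<Rightarrow> real \<Rightarrow> real \<Rightarrow> real \<Rightarrow> real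
    \<Rightarrow> (int \<Rightarrow> real \<Rightarrow> complex) \<Rightarrow> int \<Rightarrow> real \<Rightarrow> complex" where
  "resolv f R \<beta> \<epsilon> \<mu> g = (THE A. A \<in> Aspace R \<and>
      A = (\<lambda>m x. g m x + of_real \<epsilon> * Top f \<beta> \<mu> A m x))"

definition g1 :: "(real \<times> real \<Rightarrow> real) \<Rightarrow> real \<Rightarrow> real \<Rightarrow> int \<Rightarrow> real \<Rightarrow> complex" where
  "g1 f \<beta> \<mu> m x = cis (k0 \<beta> \<mu> * x) * fcoef f m x"

definition g2 :: "(real \<times> real \<Rightarrow> real) \<Rightarrow> int \<Rightarrow> real \<Rightarrow> complex" where
  "g2 f m x = fcoef f (m + 1) x"

definition FF where "FF f R \<beta> \<epsilon> \<mu> = mean (resolv f R \<beta> \<epsilon> \<mu> (g2 f) (-1))"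
definition QQ where "QQ f R \<beta> \<epsilon> \<mu> = mean (resolv f R \<beta> \<epsilon> \<mu> (g1 f \<beta> \<mu>) (-1))"
definition Pp where "Pp f R \<beta> \<epsilon> \<mu> = mean (\<lambda>x. resolv f R \<beta> \<epsilon> \<mu> (g1 f \<beta> \<mu>) 0 x * cis (k0 \<beta> \<mu> * x))"
definition Pm where "Pm f R \<beta> \<epsilon> \<mu> = mean (\<lambda>x. resolv f R \<beta> \<epsilon> \<mu> (g1 f \<beta> \<mu>) 0 x * cis (- k0 \<beta> \<mu> * x))"
definition Rp where "Rp f R \<beta> \<epsilon> \<mu> = mean (\<lambda>x. resolv f R \<beta> \<epsilon> \<mu> (g2 f) 0 x * cis (k0 \<beta> \<mu> * x))"
definition Rm where "Rm f R \<beta> \<epsilon> \<mu> = mean (\<lambda>x. resolv f R \<beta> \<epsilon> \<mu> (g2 f) 0 x * cis (- k0 \<beta> \<mu> * x))"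

end

theory Submission
  imports Defs
begin

text \<open>
  Mode by mode, problem (P) reads \<open>- \<Psi>\<^sub>m'' + \<kappa>\<^sub>m\<^sup>2 \<Psi>\<^sub>m = A\<^sub>m\<close> with \<open>\<kappa>\<^sub>m = k\<^sub>m\<close> (and
  \<open>\<kappa>\<^sub>0 = - i k\<^sub>0\<close>), where \<open>A\<^sub>m = 2\<epsilon>\<gamma> \<Sum>\<^sub>n f\<^bsub>m-n\<^esub> \<Psi>\<^sub>n\<close>. Convolving with the Green functions and splitting
  the constant \<open>1/(2\<mu>)\<close> off \<open>G\<^bsub>-1\<^esub>\<close>, which is what blows up as \<open>\<mu>\<close> tends to \<open>0\<close>, turns this into
  \<open>A = 2\<epsilon>\<gamma> (g\<^sup>1 + \<langle>A\<^bsub>-1\<^esub>\<rangle>/(2\<mu>) g\<^sup>2) + \<epsilon> T A\<close>; the mean of the component of index \<open>-1\<close> is a scalar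
  equation for \<open>\<langle>A\<^bsub>-1\<^esub>\<rangle>\<close>, with solution \<open>C\<close>. As \<open>f\<close> is smooth, \<open>\<epsilon> T\<close> is a contraction, uniformly in
  \<open>\<mu>\<close>, for the sup norm weighted by \<open>(1 + |m|)\<^sup>3\<close>. The resulting decay in \<open>m\<close> allows the weak equation
  to be verified mode by mode and summed. The modes of index \<open>m \<noteq> 0\<close> also decay exponentially in \<open>x\<close>,
  and outside the support of \<open>f\<close> the mode of index \<open>0\<close> is exactly a combination of plane waves with
  coefficients \<open>\<T>\<close> and \<open>\<R>\<close>; what remains after subtracting the plane waves is therefore a rapidly
  convergent sum of decaying \<open>C\<^sup>1\<close> modes, which lies in the energy space.
\<close>

text \<open>\<open>resolv\<close> is a definite description over \<open>Aspace\<close>, where only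
  square summability in the index is guaranteed, while the expansion of \<open>\<Psi>\<close> has to
  be differentiated once in each variable. The fixed point is therefore sought in a smaller weighted
  class and uniqueness is shown among all bounded sequences, so that \<open>resolv\<close> itself
  inherits the decay. Summing first derivatives takes a weight of order 3, and bounding the operator
  for that weight takes Fourier coefficients of order 5, hence five derivatives of \<open>f\<close>
  in \<open>y\<close>. Second derivatives in \<open>y\<close> are not controlled by this weight;
  every integration by parts is therefore done in a single mode, and only its result is summed. The
  weak equation contains the product of \<open>f\<close> and \<open>\<Psi>\<close>, whereas the
  modes know only a convolution of coefficients, so pointwise Fourier inversion is required.
  Membership in the energy space asks for smooth approximants, while the continuity of
  \<open>A\<close> yields modes that are just twice differentiable in \<open>x\<close>; they are
  replaced by polynomials cut off by a bump.\<close>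

section \<open>Integrals and convolutions with compact support\<close>

lemma integral_eq_supported:
  fixes h :: "'a::euclidean_space \<Rightarrow> 'b::banach"
  assumes "\<And>x. x \<in> S \<Longrightarrow> x \<notin> T \<Longrightarrow> h x = 0" "\<And>x. x \<in> T \<Longrightarrow> x \<notin> S \<Longrightarrow> h x = 0"
  shows "integral S h = integral T h"
proof -
  have "(\<lambda>x. if x \<in> S then h x else 0) = (\<lambda>x. if x \<in> T then h x else 0)"
    using assms by auto
  then have "integral UNIV (\<lambda>x. if x \<in> S then h x else 0) = integral UNIV (\<lambda>x. if x \<in> T then h x else 0)"
    by simp
  then show ?thesis
    by (simp only: integral_restrict_UNIV)
qed

lemma conv_supported:
  assumes "\<And>x. x \<notin> {-R..R} \<Longrightarrow> A x = 0"
  shows "conv H A x = integral {-R..R} (\<lambda>\<xi>. H (x - \<xi>) * A \<xi>)"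
  unfolding conv_def by (rule integral_eq_supported) (use assms in auto)

lemma conv_cmult: "conv H (\<lambda>x. c * A x) x = c * conv H A x"
proof -
  have "conv H (\<lambda>x. c * A x) x = integral UNIV (\<lambda>\<xi>. c * (H (x - \<xi>) * A \<xi>))"
    by (simp add: conv_def mult_ac)
  then show ?thesis by (simp add: conv_def)
qed

text \<open>The bound is asked only at the displacements \<open>x - \<xi>\<close> that occur. For
  \<open>x\<close> in the support these stay within \<open>2 * R\<close>, and the kernel
  \<open>Hr\<close> of index -1 has no bound on the whole line that is uniform in
  \<open>\<mu>\<close>.\<close>

lemma conv_bound:
  assumes A: "continuous_on {-R..R} A" and H: "continuous_on UNIV H"
    and supp: "\<And>x. x \<notin> {-R..R} \<Longrightarrow> A x = 0" and R: "0 \<le> R"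
    and bd: "\<And>\<xi>. \<xi> \<in> {-R..R} \<Longrightarrow> norm (H (x - \<xi>) * A \<xi>) \<le> B"
  shows "norm (conv H A x) \<le> 2 * R * B"
proof -
  have "continuous_on {-R..R} (\<lambda>\<xi>. H (x - \<xi>) * A \<xi>)"
    by (intro continuous_intros continuous_on_compose2[OF H] A) auto
  then have "norm (integral {-R..R} (\<lambda>\<xi>. H (x - \<xi>) * A \<xi>)) \<le> B * (R - (-R))"
    by (rule integral_bound[rotated]) (use R bd in auto)
  then show ?thesis
    using conv_supported[OF supp, of R] by (simp add: mult_ac)
qed

lemma conv_integrable:
  fixes H A :: "real \<Rightarrow> complex"
  assumes A: "continuous_on {-R..R} A" and H: "continuous_on UNIV H"
  shows "(\<lambda>\<xi>. H (x - \<xi>) * A \<xi>) integrable_on {-R..R}"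
  by (rule integrable_continuous_real) (intro continuous_intros continuous_on_compose2[OF H] A; auto)

lemma conv_continuous:
  assumes A: "continuous_on {-R..R} A" and H: "continuous_on UNIV H"
    and supp: "\<And>x. x \<notin> {-R..R} \<Longrightarrow> A x = 0"
  shows "continuous_on UNIV (conv H A)"
proof -
  have *: "conv H A = (\<lambda>x. integral (cbox (-R) R) (\<lambda>\<xi>. H (x - \<xi>) * A \<xi>))"
    using conv_supported[OF supp] by auto
  have "continuous_on (UNIV \<times> cbox (-R) R) (\<lambda>(x, \<xi>). H (x - \<xi>) * A \<xi>)"
    unfolding case_prod_unfold
    by (intro continuous_intros continuous_on_compose2[OF H] continuous_on_compose2[OF A]) auto
  then show ?thesis
    unfolding * by (rule integral_continuous_on_param)
qed

lemma conv_add: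
  assumes "continuous_on {-R..R} A" "continuous_on {-R..R} B" and H: "continuous_on UNIV H"
    and "\<And>x. x \<notin> {-R..R} \<Longrightarrow> A x = 0" "\<And>x. x \<notin> {-R..R} \<Longrightarrow> B x = 0"
  shows "conv H (\<lambda>x. A x + B x) x = conv H A x + conv H B x"
proof -
  have "conv H (\<lambda>x. A x + B x) x = integral {-R..R} (\<lambda>\<xi>. H (x - \<xi>) * A \<xi> + H (x - \<xi>) * B \<xi>)"
    by (subst conv_supported[of R]) (use assms in \<open>auto simp: algebra_simps\<close>)
  also have "\<dots> = integral {-R..R} (\<lambda>\<xi>. H (x - \<xi>) * A \<xi>) + integral {-R..R} (\<lambda>\<xi>. H (x - \<xi>) * B \<xi>)"
    by (intro Henstock_Kurzweil_Integration.integral_add conv_integrable assms)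
  finally show ?thesis
    using conv_supported[of R A H x] conv_supported[of R B H x] assms by auto
qed

subsection \<open>The one-dimensional Green function\<close>

text \<open>Fundamental solution of minus the second derivative plus
  \<open>\<kappa>\<^sup>2\<close>. A complex exponent covers the propagating mode, where
  \<open>\<kappa>\<close> is imaginary, together with the evanescent ones.\<close>

definition gk :: "complex \<Rightarrow> real \<Rightarrow> complex" where
  "gk \<kappa> x = exp (- \<kappa> * of_real \<bar>x\<bar>) / (2 * \<kappa>)"

text \<open>Contribution of the sources to the left of \<open>x\<close>, without the factor
  \<open>1 / (2 * \<kappa>)\<close>. It solves a first-order equation, so the kink of the kernel on
  the diagonal never has to be differentiated.\<close>

definition left_pot :: "complex \<Rightarrow> (real \<Rightarrow> complex) \<Rightarrow> real \<Rightarrow> complex" where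
  "left_pot \<kappa> A x = integral {..x} (\<lambda>\<xi>. exp (- \<kappa> * of_real (x - \<xi>)) * A \<xi>)"

text \<open>A reflection rather than an integral over the right half-line: derivative and decay then
  follow from those of \<open>left_pot\<close>.\<close>

definition right_pot :: "complex \<Rightarrow> (real \<Rightarrow> complex) \<Rightarrow> real \<Rightarrow> complex" where
  "right_pot \<kappa> A x = left_pot \<kappa> (\<lambda>\<xi>. A (- \<xi>)) (- x)"

definition dgk_conv :: "complex \<Rightarrow> (real \<Rightarrow> complex) \<Rightarrow> real \<Rightarrow> complex" where
  "dgk_conv \<kappa> A x = (right_pot \<kappa> A x - left_pot \<kappa> A x) / 2"

lemma continuous_gk: "continuous_on UNIV (gk \<kappa>)"
  unfolding gk_def divide_inverse by (intro continuous_intros)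

text \<open>Taking the exponential in \<open>x\<close> out of the integral leaves \<open>x\<close>
  only in the upper limit, ready for the fundamental theorem. The lower end \<open>-L\<close> is
  free beyond the support, so it can be placed below any given point.\<close>

lemma left_pot_supported:
  assumes supp: "\<And>x. x \<notin> {-R..R} \<Longrightarrow> A x = 0" and "R \<le> L"
  shows "left_pot \<kappa> A x = exp (- \<kappa> * of_real x) * integral {-L..x} (\<lambda>\<xi>. exp (\<kappa> * of_real \<xi>) * A \<xi>)"
proof -
  have "left_pot \<kappa> A x = integral {-L..x} (\<lambda>\<xi>. exp (- \<kappa> * of_real (x - \<xi>)) * A \<xi>)"
    unfolding left_pot_def by (rule integral_eq_supported) (use assms in auto)
  also have "\<dots> = integral {-L..x} (\<lambda>\<xi>. exp (- \<kappa> * of_real x) * (exp (\<kappa> * of_real \<xi>) * A \<xi>))"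
    by (simp add: algebra_simps exp_diff exp_minus divide_inverse)
  finally show ?thesis by simp
qed

lemma left_pot_deriv:
  assumes A: "continuous_on UNIV A" and supp: "\<And>x. x \<notin> {-R..R} \<Longrightarrow> A x = 0"
  shows "(left_pot \<kappa> A has_vector_derivative A x - \<kappa> * left_pot \<kappa> A x) (at x)"
proof -
  \<comment> \<open>The \<open>+ 1\<close> makes \<open>x\<close> an interior point of the interval,
    also when \<open>x\<close> lies outside the support, so that the derivative within the interval
    is a two-sided one.\<close>
  define L where "L = max R \<bar>x\<bar> + 1"
  have L: "R \<le> L" "x \<in> {-L<..<L}" by (auto simp: L_def)
  let ?h = "\<lambda>\<xi>. exp (\<kappa> * of_real \<xi>) * A \<xi>"
  have h: "continuous_on {-L..L} ?h"
    by (intro continuous_intros continuous_on_subset[OF A]) auto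
  have "((\<lambda>u. integral {-L..u} ?h) has_vector_derivative ?h x) (at x within {-L..L})"
    using L by (intro integral_has_vector_derivative h) auto
  then have d: "((\<lambda>u. integral {-L..u} ?h) has_vector_derivative ?h x) (at x)"
    by (metis L(2) at_within_Icc_at greaterThanLessThan_iff)
  have e: "((\<lambda>u. exp (- \<kappa> * of_real u)) has_vector_derivative - \<kappa> * exp (- \<kappa> * of_real x)) (at x)"
  proof -
    have "((\<lambda>z. exp (- \<kappa> * z)) has_field_derivative - \<kappa> * exp (- \<kappa> * of_real x)) (at (of_real x))"
      by (auto intro!: derivative_eq_intros)
    then show ?thesis using has_vector_derivative_real_field by blast
  qed
  have eq: "left_pot \<kappa> A = (\<lambda>u. exp (- \<kappa> * of_real u) * integral {-L..u} ?h)"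
    by (rule ext, rule left_pot_supported[OF supp L(1)])
  have D: "((\<lambda>u. exp (- \<kappa> * of_real u) * integral {-L..u} ?h) has_vector_derivative
      exp (- \<kappa> * of_real x) * ?h x + (- \<kappa> * exp (- \<kappa> * of_real x)) * integral {-L..x} ?h) (at x)"
    by (rule has_vector_derivative_mult[OF e d])
  have "exp (- \<kappa> * of_real x) * ?h x = A x"
    by (simp add: exp_minus field_simps)
  then have "exp (- \<kappa> * of_real x) * ?h x + (- \<kappa> * exp (- \<kappa> * of_real x)) * integral {-L..x} ?h
      = A x - \<kappa> * (exp (- \<kappa> * of_real x) * integral {-L..x} ?h)"
    by (simp only: mult_minus_left mult.assoc diff_conv_add_uminus[symmetric] uminus_add_conv_diff add_uminus_conv_diff)
  then show ?thesis
    unfolding eq by (rule has_vector_derivative_eq_rhs[OF D])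
qed

lemma left_pot_bound:
  assumes A: "continuous_on UNIV A" and supp: "\<And>x. x \<notin> {-R..R} \<Longrightarrow> A x = 0" and R: "0 \<le> R"
    and bd: "\<And>x. norm (A x) \<le> a" and \<mu>: "0 \<le> \<mu>" "\<mu> \<le> Re \<kappa>"
  shows "norm (left_pot \<kappa> A x) \<le> 2 * R * exp (\<mu> * R) * a * exp (- \<mu> * \<bar>x\<bar>)"
proof -
  have a: "0 \<le> a" using bd[of 0] norm_ge_zero order_trans by blast
  show ?thesis
  proof (cases "x < -R")
    case True
    have "left_pot \<kappa> A x = integral {} (\<lambda>\<xi>. exp (- \<kappa> * of_real (x - \<xi>)) * A \<xi>)"
      unfolding left_pot_def by (rule integral_eq_supported) (use True supp in auto)
    then show ?thesis using a R by simp
  next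
    case False
    let ?c = "min x R"
    have eq: "left_pot \<kappa> A x = integral {-R..?c} (\<lambda>\<xi>. exp (- \<kappa> * of_real (x - \<xi>)) * A \<xi>)"
      unfolding left_pot_def by (rule integral_eq_supported) (use supp in auto)
    have "norm (integral {-R..?c} (\<lambda>\<xi>. exp (- \<kappa> * of_real (x - \<xi>)) * A \<xi>))
       \<le> (exp (\<mu> * R) * exp (- \<mu> * \<bar>x\<bar>) * a) * (?c - (-R))"
    proof (rule integral_bound)
      show "- R \<le> min x R" using False R by auto
      show "continuous_on {- R..min x R} (\<lambda>\<xi>. exp (- \<kappa> * of_real (x - \<xi>)) * A \<xi>)"
        by (intro continuous_intros continuous_on_subset[OF A]) auto
      fix \<xi> assume \<xi>: "\<xi> \<in> {-R..?c}"
      have "norm (exp (- \<kappa> * of_real (x - \<xi>))) = exp (- (Re \<kappa> * (x - \<xi>)))" by (simp add: norm_exp_eq_Re)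
      also have "\<dots> \<le> exp (- (\<mu> * (x - \<xi>)))" using \<xi> \<mu> by (simp add: mult_right_mono)
      also have "\<dots> \<le> exp (\<mu> * R + - \<mu> * \<bar>x\<bar>)"
      proof -
        have "\<bar>x\<bar> \<le> R + (x - \<xi>)" using \<xi> by auto
        then have "\<mu> * \<bar>x\<bar> \<le> \<mu> * (R + (x - \<xi>))" using \<mu> mult_left_mono by blast
        then have "- (\<mu> * (x - \<xi>)) \<le> \<mu> * R + - \<mu> * \<bar>x\<bar>" by (simp add: algebra_simps)
        then show ?thesis unfolding exp_le_cancel_iff .
      qed
      finally have "norm (exp (- \<kappa> * of_real (x - \<xi>))) \<le> exp (\<mu> * R) * exp (- \<mu> * \<bar>x\<bar>)"
        by (simp only: exp_add)
      then show "norm (exp (- \<kappa> * of_real (x - \<xi>)) * A \<xi>) \<le> exp (\<mu> * R) * exp (- \<mu> * \<bar>x\<bar>) * a"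
        unfolding norm_mult by (intro mult_mono bd) auto
    qed
    also have "\<dots> \<le> (exp (\<mu> * R) * exp (- \<mu> * \<bar>x\<bar>) * a) * (2 * R)"
      using a by (intro mult_left_mono) auto
    finally show ?thesis unfolding eq by (simp add: mult_ac)
  qed
qed

lemma right_pot_deriv:
  assumes A: "continuous_on UNIV A" and supp: "\<And>x. x \<notin> {-R..R} \<Longrightarrow> A x = 0"
  shows "(right_pot \<kappa> A has_vector_derivative \<kappa> * right_pot \<kappa> A x - A x) (at x)"
proof -
  have "(left_pot \<kappa> (\<lambda>\<xi>. A (- \<xi>)) has_vector_derivative A (- (-x)) - \<kappa> * left_pot \<kappa> (\<lambda>\<xi>. A (- \<xi>)) (-x)) (at (-x))"
    by (rule left_pot_deriv[of _ R]) (use supp in \<open>auto intro!: continuous_on_compose2[OF A] continuous_intros\<close>)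
  then have "((left_pot \<kappa> (\<lambda>\<xi>. A (- \<xi>)) \<circ> uminus) has_vector_derivative
      (-1) *\<^sub>R (A x - \<kappa> * left_pot \<kappa> (\<lambda>\<xi>. A (- \<xi>)) (-x))) (at x)"
    by (intro vector_diff_chain_at) (auto intro!: derivative_eq_intros)
  then show ?thesis by (simp add: right_pot_def[abs_def] o_def)
qed

lemma conv_gk:
  assumes A: "continuous_on UNIV A" and supp: "\<And>x. x \<notin> {-R..R} \<Longrightarrow> A x = 0"
  shows "conv (gk \<kappa>) A x = (left_pot \<kappa> A x + right_pot \<kappa> A x) / (2 * \<kappa>)"
proof -
  define L where "L = max R \<bar>x\<bar>"
  have L: "R \<le> L" "-L \<le> x" "x \<le> L" by (auto simp: L_def)
  have supp': "A x = 0" if "x \<notin> {-L..L}" for x using supp that L by auto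
  have i: "(\<lambda>\<xi>. gk \<kappa> (x - \<xi>) * A \<xi>) integrable_on {-L..L}"
    by (rule conv_integrable[OF continuous_on_subset[OF A] continuous_gk]) auto
  have "conv (gk \<kappa>) A x = integral {-L..L} (\<lambda>\<xi>. gk \<kappa> (x - \<xi>) * A \<xi>)"
    by (rule conv_supported[OF supp'])
  also have "\<dots> = integral {-L..x} (\<lambda>\<xi>. gk \<kappa> (x - \<xi>) * A \<xi>) + integral {x..L} (\<lambda>\<xi>. gk \<kappa> (x - \<xi>) * A \<xi>)"
    using Henstock_Kurzweil_Integration.integral_combine[OF L(2,3) i] by simp
  also have "integral {-L..x} (\<lambda>\<xi>. gk \<kappa> (x - \<xi>) * A \<xi>) =
     integral {-L..x} (\<lambda>\<xi>. exp (- \<kappa> * of_real (x - \<xi>)) * A \<xi> / (2 * \<kappa>))"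
    by (rule integral_cong) (auto simp: gk_def)
  also have "\<dots> = left_pot \<kappa> A x / (2 * \<kappa>)"
    unfolding left_pot_def integral_divide
    by (rule arg_cong[where f = "\<lambda>z. z / (2 * \<kappa>)"], rule integral_eq_supported) (simp_all add: supp')
  also have "integral {x..L} (\<lambda>\<xi>. gk \<kappa> (x - \<xi>) * A \<xi>) = integral {-L..-x} (\<lambda>\<xi>. gk \<kappa> (x + \<xi>) * A (- \<xi>))"
    using Henstock_Kurzweil_Integration.integral_reflect_real[of L x "\<lambda>\<xi>. gk \<kappa> (x - \<xi>) * A \<xi>"] by simp
  also have "\<dots> = integral {-L..-x} (\<lambda>\<xi>. exp (- \<kappa> * of_real (-x - \<xi>)) * A (- \<xi>) / (2 * \<kappa>))"
  proof (rule integral_cong)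
    fix \<xi> assume "\<xi> \<in> {-L..-x}"
    then have "\<bar>x + \<xi>\<bar> = - x - \<xi>" by auto
    then show "gk \<kappa> (x + \<xi>) * A (- \<xi>) = exp (- \<kappa> * of_real (-x - \<xi>)) * A (- \<xi>) / (2 * \<kappa>)"
      unfolding gk_def by simp
  qed
  also have "\<dots> = right_pot \<kappa> A x / (2 * \<kappa>)"
    unfolding right_pot_def left_pot_def integral_divide
    by (rule arg_cong[where f = "\<lambda>z. z / (2 * \<kappa>)"], rule integral_eq_supported) (simp_all add: supp')
  finally show ?thesis by (simp add: add_divide_distrib)
qed

text \<open>The source enters the derivatives of the two half potentials with opposite signs. It
  cancels in their sum, which is why the convolution is continuously differentiable, and doubles in
  their difference, which yields the inhomogeneity \<open>- A x\<close>.\<close>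

lemma conv_gk_deriv:
  assumes A: "continuous_on UNIV A" and supp: "\<And>x. x \<notin> {-R..R} \<Longrightarrow> A x = 0" and \<kappa>: "\<kappa> \<noteq> 0"
  shows "(conv (gk \<kappa>) A has_vector_derivative dgk_conv \<kappa> A x) (at x)"
    and "(dgk_conv \<kappa> A has_vector_derivative \<kappa>\<^sup>2 * conv (gk \<kappa>) A x - A x) (at x)"
proof -
  note dl = left_pot_deriv[OF A supp, of R \<kappa> x] and dr = right_pot_deriv[OF A supp, of R \<kappa> x]
  have eq: "conv (gk \<kappa>) A = (\<lambda>x. (left_pot \<kappa> A x + right_pot \<kappa> A x) / (2 * \<kappa>))"
    using conv_gk[OF A supp] by auto
  have "((\<lambda>x. (left_pot \<kappa> A x + right_pot \<kappa> A x) / (2 * \<kappa>)) has_vector_derivative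
     ((A x - \<kappa> * left_pot \<kappa> A x) + (\<kappa> * right_pot \<kappa> A x - A x)) / (2 * \<kappa>)) (at x)"
    by (intro has_vector_derivative_divide has_vector_derivative_add dl dr)
  then show "(conv (gk \<kappa>) A has_vector_derivative dgk_conv \<kappa> A x) (at x)"
    unfolding eq dgk_conv_def using \<kappa> by (simp flip: right_diff_distrib)
  have "((\<lambda>x. (right_pot \<kappa> A x - left_pot \<kappa> A x) / 2) has_vector_derivative
     ((\<kappa> * right_pot \<kappa> A x - A x) - (A x - \<kappa> * left_pot \<kappa> A x)) / 2) (at x)"
    by (intro has_vector_derivative_divide has_vector_derivative_diff dl dr)
  moreover have "((\<kappa> * right_pot \<kappa> A x - A x) - (A x - \<kappa> * left_pot \<kappa> A x)) / 2
    = \<kappa>\<^sup>2 * ((left_pot \<kappa> A x + right_pot \<kappa> A x) / (2 * \<kappa>)) - A x"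
    using \<kappa> by (simp add: power2_eq_square field_simps)
  ultimately have "((\<lambda>x. (right_pot \<kappa> A x - left_pot \<kappa> A x) / 2) has_vector_derivative
     \<kappa>\<^sup>2 * ((left_pot \<kappa> A x + right_pot \<kappa> A x) / (2 * \<kappa>)) - A x) (at x)"
    by (rule has_vector_derivative_eq_rhs)
  then show "(dgk_conv \<kappa> A has_vector_derivative \<kappa>\<^sup>2 * conv (gk \<kappa>) A x - A x) (at x)"
    unfolding eq dgk_conv_def[abs_def] .
qed

lemma gk_bounds:
  assumes A: "continuous_on UNIV A" and supp: "\<And>x. x \<notin> {-R..R} \<Longrightarrow> A x = 0" and R: "0 \<le> R"
    and bd: "\<And>x. norm (A x) \<le> a" and \<mu>: "0 \<le> \<mu>" "\<mu> \<le> Re \<kappa>"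
  shows "norm (conv (gk \<kappa>) A x) \<le> 2 * R * exp (\<mu> * R) / norm \<kappa> * a * exp (- \<mu> * \<bar>x\<bar>)"
    and "norm (dgk_conv \<kappa> A x) \<le> 2 * R * exp (\<mu> * R) * a * exp (- \<mu> * \<bar>x\<bar>)"
proof -
  define B where "B = 2 * R * exp (\<mu> * R) * a * exp (- \<mu> * \<bar>x\<bar>)"
  have l: "norm (left_pot \<kappa> A x) \<le> B"
    unfolding B_def by (rule left_pot_bound[OF A supp R bd \<mu>])
  have "norm (left_pot \<kappa> (\<lambda>\<xi>. A (- \<xi>)) (- x)) \<le> 2 * R * exp (\<mu> * R) * a * exp (- \<mu> * \<bar>- x\<bar>)"
  proof (rule left_pot_bound[OF _ _ R _ \<mu>])
    show "continuous_on UNIV (\<lambda>\<xi>. A (- \<xi>))"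
      by (rule continuous_on_compose2[OF A]) (auto intro!: continuous_intros)
    show "A (- y) = 0" if "y \<notin> {-R..R}" for y
      by (rule supp) (use that in auto)
  qed (rule bd)
  then have r: "norm (right_pot \<kappa> A x) \<le> B" by (simp add: right_pot_def B_def)
  have "norm (left_pot \<kappa> A x + right_pot \<kappa> A x) \<le> B + B"
    by (rule norm_triangle_mono[OF l r])
  then have le: "norm (left_pot \<kappa> A x + right_pot \<kappa> A x) / (2 * norm \<kappa>) \<le> (B + B) / (2 * norm \<kappa>)"
    by (rule divide_right_mono) simp
  have *: "norm (conv (gk \<kappa>) A x) \<le> B / norm \<kappa>"
  proof -
    have "conv (gk \<kappa>) A x = (left_pot \<kappa> A x + right_pot \<kappa> A x) / (2 * \<kappa>)"
      by (rule conv_gk[OF A supp])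
    with le show ?thesis by (simp add: norm_divide norm_mult)
  qed
  also have "B / norm \<kappa> = 2 * R * exp (\<mu> * R) / norm \<kappa> * a * exp (- \<mu> * \<bar>x\<bar>)"
    by (simp add: B_def)
  finally show "norm (conv (gk \<kappa>) A x) \<le> 2 * R * exp (\<mu> * R) / norm \<kappa> * a * exp (- \<mu> * \<bar>x\<bar>)" .
  have "norm (right_pot \<kappa> A x - left_pot \<kappa> A x) \<le> B + B"
    by (rule order_trans[OF norm_triangle_ineq4 add_mono[OF r l]])
  then show "norm (dgk_conv \<kappa> A x) \<le> 2 * R * exp (\<mu> * R) * a * exp (- \<mu> * \<bar>x\<bar>)"
    unfolding B_def[symmetric] dgk_conv_def norm_divide by simp
qed

subsection \<open>Approximation by smooth compactly supported functions\<close>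

text \<open>All derivatives are carried as one sequence, as in \<open>smooth2\<close>, whose witness
  for a product with a mode can then be read off.\<close>

definition smoothc :: "(real \<Rightarrow> complex) \<Rightarrow> bool" where
  "smoothc u \<longleftrightarrow> (\<exists>D::nat \<Rightarrow> real \<Rightarrow> complex. D 0 = u \<and>
      (\<forall>k x. (D k has_vector_derivative D (Suc k) x) (at x)))"

text \<open>The sequence arises by iterating a choice function on a class closed under
  differentiation; no formula for higher derivatives enters.\<close>

lemma smoothc_closed:
  assumes "u \<in> S" "\<And>v. v \<in> S \<Longrightarrow> \<exists>v'\<in>S. \<forall>x. (v has_vector_derivative v' x) (at x)"
  shows "smoothc u"
proof -
  obtain d where d: "\<And>v. v \<in> S \<Longrightarrow> d v \<in> S \<and> (\<forall>x. (v has_vector_derivative d v x) (at x))"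
    using assms(2) by metis
  define D where "D k = (d ^^ k) u" for k
  have "D k \<in> S" for k by (induction k) (use assms d in \<open>auto simp: D_def\<close>)
  then show ?thesis
    unfolding smoothc_def by (intro exI[of _ D]) (use d in \<open>auto simp: D_def\<close>)
qed

text \<open>Applied to all derivatives of two factors, this is a class closed under differentiation
  by the product rule alone. It replaces the Leibniz formula in \<open>smoothc_mult\<close>.\<close>

inductive_set fun_alg :: "(real \<Rightarrow> complex) set \<Rightarrow> (real \<Rightarrow> complex) set" for B where
  base: "u \<in> B \<Longrightarrow> u \<in> fun_alg B"
| add: "u \<in> fun_alg B \<Longrightarrow> v \<in> fun_alg B \<Longrightarrow> (\<lambda>x. u x + v x) \<in> fun_alg B"
| mult: "u \<in> fun_alg B \<Longrightarrow> v \<in> fun_alg B \<Longrightarrow> (\<lambda>x. u x * v x) \<in> fun_alg B"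

lemma smoothc_mult:
  assumes "smoothc u" "smoothc v" shows "smoothc (\<lambda>x. u x * v x)"
proof -
  obtain D E where D: "D 0 = u" "\<And>k x. (D k has_vector_derivative D (Suc k) x) (at x)"
    and E: "E 0 = v" "\<And>k x. (E k has_vector_derivative E (Suc k) x) (at x)"
    using assms unfolding smoothc_def by metis
  let ?B = "range D \<union> range E"
  show ?thesis
  proof (rule smoothc_closed[of _ "fun_alg ?B"])
    show "(\<lambda>x. u x * v x) \<in> fun_alg ?B"
      by (intro fun_alg.mult fun_alg.base) (use D(1) E(1) in auto)
    fix w assume "w \<in> fun_alg ?B"
    then show "\<exists>w'\<in>fun_alg ?B. \<forall>x. (w has_vector_derivative w' x) (at x)"
    proof induction
      case (base w)
      then consider k where "w = D k" | k where "w = E k" by auto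
      then show ?case
      proof cases
        case 1
        then show ?thesis using D(2) by (intro bexI[of _ "D (Suc k)"]) (auto intro!: fun_alg.base)
      next
        case 2
        then show ?thesis using E(2) by (intro bexI[of _ "E (Suc k)"]) (auto intro!: fun_alg.base)
      qed
    next
      case (add w z)
      then obtain w' z' where *: "w' \<in> fun_alg ?B" "z' \<in> fun_alg ?B"
        "\<And>x. (w has_vector_derivative w' x) (at x)" "\<And>x. (z has_vector_derivative z' x) (at x)" by blast
      show ?case
        by (rule bexI[of _ "\<lambda>x. w' x + z' x"]) (intro allI fun_alg.add has_vector_derivative_add *)+
    next
      case (mult w z)
      then obtain w' z' where *: "w' \<in> fun_alg ?B" "z' \<in> fun_alg ?B"
        "\<And>x. (w has_vector_derivative w' x) (at x)" "\<And>x. (z has_vector_derivative z' x) (at x)" by blast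
      show ?case
        by (rule bexI[of _ "\<lambda>x. w x * z' x + w' x * z x"])
           (intro allI fun_alg.add fun_alg.mult has_vector_derivative_mult mult.hyps *)+
    qed
  qed
qed

lemma smoothc_polynomial: "polynomial_function p \<Longrightarrow> smoothc p"
  by (rule smoothc_closed[of _ "{p. polynomial_function p}"])
     (auto dest: has_vector_derivative_polynomial_function)

lemma smoothc_antideriv:
  assumes "smoothc p" "\<And>x. (P has_vector_derivative p x) (at x)" shows "smoothc P"
proof -
  obtain D where D: "D 0 = p" "\<And>k x. (D k has_vector_derivative D (Suc k) x) (at x)"
    using assms unfolding smoothc_def by metis
  have "((case k of 0 \<Rightarrow> P | Suc i \<Rightarrow> D i) has_vector_derivative D k x) (at x)" for k x
    using assms(2) D by (cases k) auto
  then show ?thesis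
    unfolding smoothc_def by (intro exI[of _ "\<lambda>k. case k of 0 \<Rightarrow> P | Suc i \<Rightarrow> D i"]) auto
qed

text \<open>Outside \<open>{0..1}\<close> the cut-off is locally constant, so the bounds come from
  compactness of that interval. Its values inside are not prescribed, hence \<open>c\<close> may
  exceed 1.\<close>

lemma cutoff_derivative:
  assumes "cutoff chi"
  obtains c chi' where "1 \<le> c" "\<And>x. (chi has_real_derivative chi' x) (at x)" "continuous_on UNIV chi'"
    "\<And>x. \<bar>chi x\<bar> \<le> c" "\<And>x. \<bar>chi' x\<bar> \<le> c" "\<And>x. x > 1 \<or> x < 0 \<Longrightarrow> chi' x = 0"
proof -
  obtain D where D: "D 0 = chi" "\<And>k x. (D k has_real_derivative D (Suc k) x) (at x)"
    using assms unfolding cutoff_def smooth1_def by metis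
  have d: "(chi has_real_derivative D 1 x) (at x)" for x using D(2)[of 0] D(1) by simp
  have cont: "continuous_on UNIV (D k)" for k
    using D(2) by (meson DERIV_isCont continuous_at_imp_continuous_on)
  have z: "D 1 x = 0" if "x > 1 \<or> x < 0" for x
  proof -
    obtain k where "eventually (\<lambda>y. chi y = k) (nhds x)"
    proof (cases "x > 1")
      case True
      have "eventually (\<lambda>y. y \<in> {1<..}) (nhds x)" by (rule eventually_nhds_in_open) (use True in auto)
      then have "eventually (\<lambda>y. chi y = 1) (nhds x)"
        by eventually_elim (use assms in \<open>auto simp: cutoff_def\<close>)
      then show ?thesis using that by blast
    next
      case False
      have "eventually (\<lambda>y. y \<in> {..<0}) (nhds x)" by (rule eventually_nhds_in_open) (use that False \<open>x > 1 \<or> x < 0\<close> in auto)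
      then have "eventually (\<lambda>y. chi y = 0) (nhds x)"
        by eventually_elim (use assms in \<open>auto simp: cutoff_def\<close>)
      then show ?thesis using that by blast
    qed
    then have "((\<lambda>_. k) has_real_derivative D 1 x) (at x)"
      using d[of x] DERIV_cong_ev[OF refl _ refl, of chi "\<lambda>_. k" x "D 1 x"] by blast
    from DERIV_unique[OF this DERIV_const] show ?thesis .
  qed
  have "\<exists>b. \<forall>x\<in>{0..1}. \<bar>D k x\<bar> \<le> b" for k
    using compact_imp_bounded[OF compact_continuous_image[OF continuous_on_subset[OF cont[of k] subset_UNIV] compact_Icc[of 0 1]]]
    unfolding bounded_iff by auto
  then obtain b where b: "\<And>k x. x \<in> {0..1} \<Longrightarrow> \<bar>D k x\<bar> \<le> b k" by metis
  define c where "c = max 1 (max (b 0) (b 1))"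
  have b0: "\<bar>chi x\<bar> \<le> b 0" "\<bar>D 1 x\<bar> \<le> b 1" if "x \<in> {0..1}" for x using b[OF that, of 0] b[OF that, of 1] D by auto
  have out: "\<bar>chi x\<bar> \<le> 1 \<and> D 1 x = 0" if "x \<notin> {0..1}" for x
    using that z[of x] assms by (auto simp: cutoff_def not_le)
  have "\<bar>chi x\<bar> \<le> c" "\<bar>D 1 x\<bar> \<le> c" for x
    using b0[of x] out[of x] by (cases "x \<in> {0..1}"; force simp: c_def)+
  moreover have "1 \<le> c" by (simp add: c_def)
  ultimately show thesis
    using that[of c "D 1"] d cont z by blast
qed

lemma smoothc_cutoff:
  assumes "cutoff chi" shows "smoothc (\<lambda>x. of_real (chi (a + s * x)))"
proof -
  obtain D where D: "D 0 = chi" "\<And>k x. (D k has_real_derivative D (Suc k) x) (at x)"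
    using assms unfolding cutoff_def smooth1_def by metis
  have "((\<lambda>x. s ^ k * D k (a + s * x)) has_real_derivative s ^ Suc k * D (Suc k) (a + s * x)) (at x)" for k x
  proof -
    have "((\<lambda>x. D k (a + s * x)) has_real_derivative D (Suc k) (a + s * x) * s) (at x)"
      by (rule DERIV_chain2[OF D(2)]) (auto intro!: derivative_eq_intros)
    from DERIV_cmult[OF this, of "s ^ k"] show ?thesis by (simp add: mult_ac)
  qed
  then have "((\<lambda>x. of_real (s ^ k * D k (a + s * x)) :: complex) has_vector_derivative of_real (s ^ Suc k * D (Suc k) (a + s * x))) (at x)" for k x
    by (intro has_vector_derivative_of_real) (simp add: has_real_derivative_iff_has_vector_derivative)
  then show ?thesis
    unfolding smoothc_def by (intro exI[of _ "\<lambda>k x. of_real (s ^ k * D k (a + s * x))"]) (auto simp: D(1))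
qed

lemma cutoff_affine_deriv:
  assumes "\<And>x. (chi has_real_derivative chi' x) (at x)"
  shows "((\<lambda>x. of_real (chi (a + s * x)) :: complex) has_vector_derivative of_real (s * chi' (a + s * x))) (at x)"
proof -
  have "((\<lambda>x. chi (a + s * x)) has_real_derivative chi' (a + s * x) * s) (at x)"
    by (rule DERIV_chain2[OF assms]) (auto intro!: derivative_eq_intros)
  then show ?thesis
    by (intro has_vector_derivative_of_real) (simp add: has_real_derivative_iff_has_vector_derivative mult.commute)
qed

text \<open>The smooth bump is cut from the cut-off function that the radiation condition provides.\<close>

lemma bump_exists:
  assumes "cutoff chi"
  obtains c where "1 \<le> c" "\<And>L. \<exists>\<eta> \<eta>'. smoothc \<eta> \<and> (\<forall>x. (\<eta> has_vector_derivative \<eta>' x) (at x)) \<and>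
    (\<forall>x. \<bar>x\<bar> < L \<longrightarrow> \<eta> x = 1 \<and> \<eta>' x = 0) \<and> (\<forall>x. \<bar>x\<bar> > L + 1 \<longrightarrow> \<eta> x = 0 \<and> \<eta>' x = 0) \<and>
    (\<forall>x. norm (\<eta> x) \<le> c \<and> norm (\<eta>' x) \<le> c)"
proof -
  obtain c chi' where c: "1 \<le> c" and d: "\<And>x. (chi has_real_derivative chi' x) (at x)"
    and "continuous_on UNIV chi'"
    and b: "\<And>x. \<bar>chi x\<bar> \<le> c" "\<And>x. \<bar>chi' x\<bar> \<le> c" "\<And>x. x > 1 \<or> x < 0 \<Longrightarrow> chi' x = 0"
    by (rule cutoff_derivative[OF assms]) (rule that)
  have v: "x > 1 \<Longrightarrow> chi x = 1" "x < 0 \<Longrightarrow> chi x = 0" for x using assms by (auto simp: cutoff_def)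
  \<comment> \<open>The product rule will give two terms, each at most \<open>c^2\<close>.\<close>
  show thesis
  proof (rule that[of "2 * c^2"])
    show "1 \<le> 2 * c^2" using c one_le_power[of c 2] by linarith
    fix L :: real
    \<comment> \<open>A descending and an ascending copy of \<open>chi\<close>: for
      \<open>|x| < L\<close> both arguments exceed 1, and for \<open>|x| > L + 1\<close> one of them
      is negative. Shifting does not change the bounds, so the constant is independent of
      \<open>L\<close>.\<close>
    define u v' where "u = (\<lambda>x. of_real (chi (L + 1 + (-1) * x)) :: complex)" and "v' = (\<lambda>x. of_real (chi (L + 1 + 1 * x)) :: complex)"
    define du dv where "du = (\<lambda>x. of_real ((-1) * chi' (L + 1 + (-1) * x)) :: complex)" and "dv = (\<lambda>x. of_real (1 * chi' (L + 1 + 1 * x)) :: complex)"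
    have du: "(u has_vector_derivative du x) (at x)" "(v' has_vector_derivative dv x) (at x)" for x
      unfolding u_def v'_def du_def dv_def by (rule cutoff_affine_deriv[OF d])+
    have nb: "norm (u x) \<le> c" "norm (v' x) \<le> c" "norm (du x) \<le> c" "norm (dv x) \<le> c" for x
      unfolding u_def v'_def du_def dv_def using b by auto
    have cc: "norm (a * b) \<le> c^2" if "norm a \<le> c" "norm b \<le> c" for a b :: complex
      using mult_mono[OF that] c by (simp add: norm_mult power2_eq_square)
    have "smoothc (\<lambda>x. u x * v' x)"
      unfolding u_def v'_def by (intro smoothc_mult smoothc_cutoff assms)
    moreover have "((\<lambda>x. u x * v' x) has_vector_derivative u x * dv x + du x * v' x) (at x)" for x
      by (rule has_vector_derivative_mult[OF du])
    moreover have "u x * v' x = 1 \<and> u x * dv x + du x * v' x = 0" if "\<bar>x\<bar> < L" for x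
    proof -
      from that have "x < L" "0 < L + x" by auto
      then show ?thesis
        unfolding u_def v'_def du_def dv_def using b(3)[of "L+1-x"] b(3)[of "L+1+x"] v[of "L+1-x"] v[of "L+1+x"] by auto
    qed
    moreover have "u x * v' x = 0 \<and> u x * dv x + du x * v' x = 0" if "\<bar>x\<bar> > L + 1" for x
    proof -
      have "L + 1 - x < 0 \<or> L + 1 + x < 0" using that by linarith
      then show ?thesis
        unfolding u_def v'_def du_def dv_def using b(3)[of "L+1-x"] b(3)[of "L+1+x"] v(2)[of "L+1-x"] v(2)[of "L+1+x"]
        by auto
    qed
    moreover have "norm (u x * v' x) \<le> 2 * c^2 \<and> norm (u x * dv x + du x * v' x) \<le> 2 * c^2" for x
      using cc[OF nb(1,2), of x x] norm_triangle_ineq[of "u x * dv x" "du x * v' x"] cc[OF nb(1,4), of x x] cc[OF nb(3,2), of x x]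
        zero_le_power2[of c] by linarith
    ultimately show "\<exists>\<eta> \<eta>'. smoothc \<eta> \<and> (\<forall>x. (\<eta> has_vector_derivative \<eta>' x) (at x)) \<and>
    (\<forall>x. \<bar>x\<bar> < L \<longrightarrow> \<eta> x = 1 \<and> \<eta>' x = 0) \<and> (\<forall>x. \<bar>x\<bar> > L + 1 \<longrightarrow> \<eta> x = 0 \<and> \<eta>' x = 0) \<and>
    (\<forall>x. norm (\<eta> x) \<le> 2 * c^2 \<and> norm (\<eta>' x) \<le> 2 * c^2)"
      by (intro exI[of _ "\<lambda>x. u x * v' x"] exI[of _ "\<lambda>x. u x * dv x + du x * v' x"]) simp
  qed
qed

lemma polynomial_antideriv:
  fixes p :: "real \<Rightarrow> real"
  assumes "real_polynomial_function p"
  shows "\<exists>P. \<forall>x. (P has_real_derivative p x) (at x)"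
proof -
  obtain a n where p: "p = (\<lambda>x. \<Sum>i\<le>n. a i * x^i)"
    using assms real_polynomial_function_iff_sum by blast
  have "((\<lambda>x. \<Sum>i\<le>n. a i * x^(Suc i) / real (Suc i)) has_real_derivative (\<Sum>i\<le>n. a i * x^i)) (at x)" for x
  proof (rule DERIV_sum)
    fix i
    have "((\<lambda>x. a i * x^(Suc i) / real (Suc i)) has_real_derivative a i * (real (Suc i) * x ^ i) / real (Suc i)) (at x)"
      using DERIV_pow[of "Suc i" x UNIV] by (intro DERIV_cdivide DERIV_cmult) simp
    then show "((\<lambda>x. a i * x^(Suc i) / real (Suc i)) has_real_derivative a i * x ^ i) (at x)"
      by simp
  qed
  then show ?thesis unfolding p by blast
qed

text \<open>The derivative is approximated and then integrated, since a uniform approximation of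
  \<open>u\<close> alone would say nothing about \<open>u'\<close>. The constant of integration
  makes both functions agree at 0.\<close>

lemma C1_polynomial_approx:
  fixes u u' :: "real \<Rightarrow> complex"
  assumes d: "\<And>x. (u has_vector_derivative u' x) (at x)" and c: "continuous_on UNIV u'" and "0 < \<delta>" and K: "0 \<le> K"
  obtains P p where "smoothc P" "\<And>x. (P has_vector_derivative p x) (at x)"
    "\<And>x. \<bar>x\<bar> \<le> K \<Longrightarrow> norm (u x - P x) \<le> \<delta>" "\<And>x. \<bar>x\<bar> \<le> K \<Longrightarrow> norm (u' x - p x) \<le> \<delta>"
proof -
  \<comment> \<open>By the mean value inequality an error \<open>\<epsilon>\<close> in the
    derivative grows to at most \<open>\<epsilon> * K\<close> in the function. The
    \<open>1 +\<close> gives \<open>\<epsilon> \<le> \<delta>\<close> as well and covers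
    \<open>K = 0\<close>.\<close>
  define \<epsilon> where "\<epsilon> = \<delta> / (1 + K)"
  have \<epsilon>: "0 < \<epsilon>" "\<epsilon> \<le> \<delta>" "\<epsilon> * K \<le> \<delta>" using assms by (auto simp: \<epsilon>_def field_simps)
  obtain p where p: "polynomial_function p" "\<And>x. x \<in> {-K..K} \<Longrightarrow> norm (u' x - p x) < \<epsilon>"
    using Stone_Weierstrass_polynomial_function[OF compact_Icc continuous_on_subset[OF c subset_UNIV] \<epsilon>(1), of "-K" K] by blast
  have "real_polynomial_function (Re \<circ> p)" "real_polynomial_function (Im \<circ> p)"
    using p(1) bounded_linear_Re bounded_linear_Im unfolding polynomial_function_def by auto
  then obtain A B where "\<And>x. (A has_real_derivative Re (p x)) (at x)" "\<And>x. (B has_real_derivative Im (p x)) (at x)"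
    using polynomial_antideriv[of "Re \<circ> p"] polynomial_antideriv[of "Im \<circ> p"] by auto
  then have AB: "((\<lambda>x. Complex (A x) (B x)) has_vector_derivative Complex (Re (p x)) (Im (p x))) (at x)" for x
    unfolding has_real_derivative_iff_has_vector_derivative has_vector_derivative_complex_iff by simp
  define P where "P x = u 0 - Complex (A 0) (B 0) + Complex (A x) (B x)" for x
  have P: "(P has_vector_derivative p x) (at x)" for x
    unfolding P_def[abs_def] using AB[of x] by (auto intro!: derivative_eq_intros)
  have D: "((\<lambda>x. u x - P x) has_vector_derivative u' x - p x) (at x)" for x
    by (intro has_vector_derivative_diff d P)
  have lip: "norm ((u x - P x) - (u 0 - P 0)) \<le> \<epsilon> * norm (x - 0)" if "x \<in> {-K..K}" for x
  proof (rule differentiable_bound)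
    show "((\<lambda>x. u x - P x) has_derivative (\<lambda>h. h *\<^sub>R (u' y - p y))) (at y within {-K..K})" for y
      using D[of y] unfolding has_vector_derivative_def by (rule has_derivative_at_withinI)
    show "onorm (\<lambda>h. h *\<^sub>R (u' y - p y)) \<le> \<epsilon>" if "y \<in> {-K..K}" for y
    proof (rule onorm_le)
      fix h :: real
      show "norm (h *\<^sub>R (u' y - p y)) \<le> \<epsilon> * norm h"
        using mult_left_mono[OF less_imp_le[OF p(2)[OF that]], of "\<bar>h\<bar>"] by (simp add: mult.commute)
    qed
  qed (use that K in auto)
  have "P 0 = u 0" by (simp add: P_def)
  then have "norm (u x - P x) \<le> \<delta>" if "\<bar>x\<bar> \<le> K" for x
  proof -
    have "norm (u x - P x) \<le> \<epsilon> * \<bar>x\<bar>" using \<open>P 0 = u 0\<close> lip[of x] that by (simp add: abs_le_iff)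
    also have "\<dots> \<le> \<epsilon> * K" using \<epsilon> that by (intro mult_left_mono) auto
    finally show ?thesis using \<epsilon> by simp
  qed
  moreover have "norm (u' x - p x) \<le> \<delta>" if "\<bar>x\<bar> \<le> K" for x
    using p(2)[of x] \<epsilon>(2) that by (auto simp: abs_le_iff)
  ultimately show thesis using that[of P p] P smoothc_antideriv[OF smoothc_polynomial[OF p(1)] P] by blast
qed

text \<open>With a bump \<open>\<eta>\<close> and a polynomial \<open>P\<close> the error is
  \<open>(1 - \<eta>) u + \<eta> (u - P)\<close>: the tail of \<open>u\<close> and an error on a
  compact interval. Half of the decay rate is spent on making the tail small; the other half
  survives in the estimate.\<close>

lemma smooth_compact_approx:
  fixes u u' :: "real \<Rightarrow> complex"
  assumes chi: "cutoff chi" and d: "\<And>x. (u has_vector_derivative u' x) (at x)" and c: "continuous_on UNIV u'"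
    and bd: "\<And>x. norm (u x) \<le> M * exp (- \<mu> * \<bar>x\<bar>)" "\<And>x. norm (u' x) \<le> M * exp (- \<mu> * \<bar>x\<bar>)"
    and \<mu>: "0 < \<mu>" and \<delta>: "0 < \<delta>"
  shows "\<exists>\<phi> \<phi>' L. smoothc \<phi> \<and> (\<forall>x. (\<phi> has_vector_derivative \<phi>' x) (at x)) \<and> (\<forall>x. \<bar>x\<bar> > L \<longrightarrow> \<phi> x = 0) \<and>
     (\<forall>x. norm (u x - \<phi> x) \<le> \<delta> * exp (- (\<mu> / 2) * \<bar>x\<bar>) \<and> norm (u' x - \<phi>' x) \<le> \<delta> * exp (- (\<mu> / 2) * \<bar>x\<bar>))"
proof -
  obtain b where b: "1 \<le> b" and bump: "\<And>L. \<exists>\<eta> \<eta>'. smoothc \<eta> \<and> (\<forall>x. (\<eta> has_vector_derivative \<eta>' x) (at x)) \<and>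
    (\<forall>x. \<bar>x\<bar> < L \<longrightarrow> \<eta> x = 1 \<and> \<eta>' x = 0) \<and> (\<forall>x. \<bar>x\<bar> > L + 1 \<longrightarrow> \<eta> x = 0 \<and> \<eta>' x = 0) \<and>
    (\<forall>x. norm (\<eta> x) \<le> b \<and> norm (\<eta>' x) \<le> b)" using bump_exists[OF chi] by blast
  have M: "0 \<le> M" using bd(1)[of 0] norm_ge_zero[of "u 0"] by (simp del: norm_ge_zero)
  \<comment> \<open>\<open>1 + 2 * b\<close> collects the coefficients in the derivative of
    \<open>(1 - \<eta>) u\<close>, namely \<open>1 + b\<close> for \<open>1 - \<eta>\<close> and
    \<open>b\<close> for \<open>\<eta>'\<close>. Half of \<open>\<delta>\<close> is reserved for the
    tail, and \<open>M + 1\<close> avoids a division by 0.\<close>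
  define q where "q = \<delta> / (2 * (1 + 2 * b) * (M + 1))"
  have q: "0 < q" using b M \<delta> by (simp add: q_def)
  have q': "(1 + 2 * b) * M * q \<le> \<delta> / 2"
  proof -
    have "N * M * (\<delta> / (2 * N * (M + 1))) = (\<delta> / 2) * (M / (M + 1))" if "N \<noteq> 0" for N
      using that by simp
    from this[of "1 + 2 * b"] have "(1 + 2 * b) * M * q = (\<delta> / 2) * (M / (M + 1))"
      using b unfolding q_def by linarith
    also have "\<dots> \<le> (\<delta> / 2) * 1" using M \<delta> by (intro mult_left_mono) auto
    finally show ?thesis by simp
  qed
  \<comment> \<open>Beyond \<open>L\<close> the spare factor
    \<open>exp (- (\<mu> / 2) * |x|)\<close> is at most \<open>q\<close>; the maximum keeps
    \<open>L\<close> nonnegative when \<open>q\<close> exceeds 1.\<close>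
  define L where "L = max 0 (- (2 / \<mu>) * ln q)"
  have L: "0 \<le> L" "exp (- (\<mu> / 2) * L) \<le> q"
  proof -
    have "- (2 / \<mu>) * ln q \<le> L" by (simp add: L_def)
    then have "(\<mu> / 2) * (- (2 / \<mu>) * ln q) \<le> (\<mu> / 2) * L" using \<mu> by (intro mult_left_mono) auto
    then have "- (\<mu> / 2) * L \<le> ln q" using \<mu> by simp
    then show "exp (- (\<mu> / 2) * L) \<le> q" using q by (metis exp_le_cancel_iff exp_ln)
  qed (simp add: L_def)
  define E where "E x = exp (- (\<mu> / 2) * \<bar>x\<bar>)" for x
  have E: "0 < E x" for x by (simp add: E_def)
  \<comment> \<open>The polynomial error is uniform, so it is measured against the smallest value of
    the weight on the support of the bump, taken at \<open>L + 1\<close>. The factor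
    \<open>2 * b\<close> accounts for the two terms of the product rule.\<close>
  define e where "e = \<delta> / 2 / (2 * b) * E (L + 1)"
  have e: "0 < e" using b \<delta> E by (simp add: e_def)
  have e': "2 * b * e \<le> \<delta> / 2 * E x" if "\<bar>x\<bar> \<le> L + 1" for x
  proof -
    have "E (L + 1) \<le> E x" using that \<mu> L unfolding E_def by (auto intro!: mult_left_mono)
    then have "\<delta> / 2 * E (L + 1) \<le> \<delta> / 2 * E x" using \<delta> by (intro mult_left_mono) auto
    then show ?thesis using b by (simp add: e_def)
  qed
  have tail: "(1 + 2 * b) * (M * exp (- \<mu> * \<bar>x\<bar>)) \<le> \<delta> / 2 * E x" if "L \<le> \<bar>x\<bar>" for x
  proof -
    have "exp (- \<mu> * \<bar>x\<bar>) = E x * E x" by (simp add: E_def flip: exp_add)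
    also have "\<dots> \<le> q * E x"
    proof (rule mult_right_mono)
      have "E x \<le> exp (- (\<mu> / 2) * L)" using that \<mu> unfolding E_def by auto
      then show "E x \<le> q" using L by simp
    qed (use E[of x] in simp)
    finally have "(1 + 2 * b) * M * exp (- \<mu> * \<bar>x\<bar>) \<le> (1 + 2 * b) * M * (q * E x)"
      using b M by (intro mult_left_mono) auto
    also have "\<dots> = ((1 + 2 * b) * M * q) * E x" by simp
    also have "\<dots> \<le> \<delta> / 2 * E x" using q' E[of x] by (intro mult_right_mono) auto
    finally show ?thesis by simp
  qed
  obtain \<eta> \<eta>' where \<eta>: "smoothc \<eta>" "\<And>x. (\<eta> has_vector_derivative \<eta>' x) (at x)"
    "\<And>x. \<bar>x\<bar> < L \<Longrightarrow> \<eta> x = 1 \<and> \<eta>' x = 0" "\<And>x. \<bar>x\<bar> > L + 1 \<Longrightarrow> \<eta> x = 0 \<and> \<eta>' x = 0"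
    "\<And>x. norm (\<eta> x) \<le> b" "\<And>x. norm (\<eta>' x) \<le> b" using bump[of L] by blast
  obtain P p where P: "smoothc P" "\<And>x. (P has_vector_derivative p x) (at x)"
    "\<And>x. \<bar>x\<bar> \<le> L + 1 \<Longrightarrow> norm (u x - P x) \<le> e" "\<And>x. \<bar>x\<bar> \<le> L + 1 \<Longrightarrow> norm (u' x - p x) \<le> e"
    using C1_polynomial_approx[OF d c e, of "L + 1"] L(1) by auto
  have near: "norm (\<eta> x * (u x - P x)) \<le> \<delta> / 2 * E x" "norm (\<eta>' x * (u x - P x) + \<eta> x * (u' x - p x)) \<le> \<delta> / 2 * E x" for x
  proof -
    have "norm (\<eta> x * (u x - P x)) \<le> \<delta> / 2 * E x \<and> norm (\<eta>' x * (u x - P x) + \<eta> x * (u' x - p x)) \<le> \<delta> / 2 * E x"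
    proof (cases "\<bar>x\<bar> \<le> L + 1")
      case True
      have 1: "norm (\<eta> x * (u x - P x)) \<le> b * e" "norm (\<eta>' x * (u x - P x)) \<le> b * e" "norm (\<eta> x * (u' x - p x)) \<le> b * e"
        unfolding norm_mult using True by (intro mult_mono \<eta> P; use b in simp)+
      have "0 \<le> b * e" using b e by simp
      then show ?thesis using 1 e'[OF True] norm_triangle_ineq[of "\<eta>' x * (u x - P x)" "\<eta> x * (u' x - p x)"] by linarith
    next
      case False
      then show ?thesis using \<eta>(4)[of x] \<delta> E[of x] by simp
    qed
    then show "norm (\<eta> x * (u x - P x)) \<le> \<delta> / 2 * E x" "norm (\<eta>' x * (u x - P x) + \<eta> x * (u' x - p x)) \<le> \<delta> / 2 * E x" by auto
  qed
  have far: "norm ((1 - \<eta> x) * u x) \<le> \<delta> / 2 * E x \<and> norm (- \<eta>' x * u x + (1 - \<eta> x) * u' x) \<le> \<delta> / 2 * E x" for x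
  proof (cases "\<bar>x\<bar> < L")
    case True
    then show ?thesis using \<eta>(3)[of x] \<delta> E[of x] by simp
  next
    case False
    let ?m = "M * exp (- \<mu> * \<bar>x\<bar>)"
    have m: "0 \<le> ?m" using M by simp
    have n1: "norm (1 - \<eta> x) \<le> 1 + b" using norm_triangle_ineq4[of 1 "\<eta> x"] \<eta>(5)[of x] by simp
    have 1: "norm ((1 - \<eta> x) * u x) \<le> (1 + b) * ?m" "norm ((1 - \<eta> x) * u' x) \<le> (1 + b) * ?m"
      unfolding norm_mult using b by (intro mult_mono bd n1; simp)+
    have 2: "norm (- \<eta>' x * u x) \<le> b * ?m"
      unfolding norm_mult norm_minus_cancel using b by (intro mult_mono bd \<eta>; simp)
    have t: "(1 + 2 * b) * ?m \<le> \<delta> / 2 * E x" using tail False by simp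
    have "(1 + 2 * b) * ?m = (1 + b) * ?m + b * ?m" by (simp add: algebra_simps)
    moreover have "0 \<le> b * ?m" using m b by simp
    ultimately show ?thesis
      using 1 2 t norm_triangle_ineq[of "- \<eta>' x * u x" "(1 - \<eta> x) * u' x"] by linarith
  qed
  have "norm (u x - \<eta> x * P x) \<le> \<delta> * E x" for x
  proof -
    have "u x - \<eta> x * P x = (1 - \<eta> x) * u x + \<eta> x * (u x - P x)" by (simp add: algebra_simps)
    then show ?thesis using norm_triangle_ineq[of "(1 - \<eta> x) * u x" "\<eta> x * (u x - P x)"] near(1)[of x] far[of x] by simp
  qed
  moreover have "norm (u' x - (\<eta> x * p x + \<eta>' x * P x)) \<le> \<delta> * E x" for x
  proof -
    have "u' x - (\<eta> x * p x + \<eta>' x * P x) = (- \<eta>' x * u x + (1 - \<eta> x) * u' x) + (\<eta>' x * (u x - P x) + \<eta> x * (u' x - p x))"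
      by (simp add: algebra_simps)
    then show ?thesis using norm_triangle_ineq[of "- \<eta>' x * u x + (1 - \<eta> x) * u' x" "\<eta>' x * (u x - P x) + \<eta> x * (u' x - p x)"]
      near(2)[of x] far[of x] by (simp only:) linarith
  qed
  moreover have "smoothc (\<lambda>x. \<eta> x * P x)" by (rule smoothc_mult[OF \<eta>(1) P(1)])
  moreover have "((\<lambda>x. \<eta> x * P x) has_vector_derivative \<eta> x * p x + \<eta>' x * P x) (at x)" for x
    by (rule has_vector_derivative_mult[OF \<eta>(2) P(2)])
  moreover have "\<eta> x * P x = 0" if "\<bar>x\<bar> > L + 1" for x using \<eta>(4)[OF that] by simp
  ultimately show ?thesis
    unfolding E_def by (intro exI[of _ "\<lambda>x. \<eta> x * P x"] exI[of _ "\<lambda>x. \<eta> x * p x + \<eta>' x * P x"] exI[of _ "L + 1"]) blast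
qed

subsection \<open>Mode expansions in the strip\<close>

definition mode :: "real \<Rightarrow> int \<Rightarrow> real \<Rightarrow> complex" where
  "mode \<beta> j y = cis ((\<beta> + of_int j) * y)"

text \<open>Shaped like the expansion in the theorem, so that the solution folds into it literally.
  Its form as a sum over \<open>mode\<close> is available through \<open>Sser_has_sum\<close> under
  a summable majorant.\<close>

definition Sser :: "real \<Rightarrow> (int \<Rightarrow> real \<Rightarrow> complex) \<Rightarrow> real \<times> real \<Rightarrow> complex" where
  "Sser \<beta> a p = cis (\<beta> * snd p) * infsum (\<lambda>j. a j (fst p) * cis (of_int j * snd p)) UNIV"

lemma norm_mode [simp]: "norm (mode \<beta> j y) = 1"
  by (simp add: mode_def)

lemma mode_split: "mode \<beta> j y = cis (\<beta> * y) * cis (of_int j * y)"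
  by (simp add: mode_def cis_mult algebra_simps)

lemma mode_deriv: "(mode \<beta> j has_vector_derivative \<i> * of_real (\<beta> + of_int j) * mode \<beta> j y) (at y)"
proof -
  have "((\<lambda>y. cis ((\<beta> + of_int j) * y)) has_derivative (\<lambda>t. ((\<beta> + of_int j) * t) *\<^sub>R (\<i> * cis ((\<beta> + of_int j) * y)))) (at y)"
    by (rule has_derivative_cis) (auto intro!: derivative_eq_intros)
  then show ?thesis
    unfolding has_vector_derivative_def mode_def[abs_def]
    by (rule has_derivative_eq_rhs) (auto simp: scaleR_conv_of_real fun_eq_iff)
qed

lemma continuous_mode: "continuous_on UNIV (mode \<beta> j)"
  unfolding mode_def[abs_def] by (intro continuous_intros)

lemma continuous_mode_snd: "continuous_on UNIV (\<lambda>p. mode \<beta> j (snd p))"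
  by (rule continuous_on_compose2[OF continuous_mode]) (auto intro: continuous_intros)

lemma norm_summable_comparison:
  fixes f :: "'a \<Rightarrow> complex"
  assumes "M summable_on A" "\<And>j. j \<in> A \<Longrightarrow> norm (f j) \<le> M j"
  shows "(\<lambda>j. norm (f j)) summable_on A" "f summable_on A"
proof -
  show "(\<lambda>j. norm (f j)) summable_on A"
    by (rule Infinite_Sum.abs_summable_on_comparison_test'[OF assms])
  then show "f summable_on A" by (rule abs_summable_summable)
qed

lemma Sser_has_sum:
  assumes "\<And>j. norm (a j (fst p)) \<le> M j" "M summable_on UNIV"
  shows "((\<lambda>j. a j (fst p) * mode \<beta> j (snd p)) has_sum Sser \<beta> a p) UNIV"
proof -
  have "(\<lambda>j. a j (fst p) * cis (of_int j * snd p)) summable_on UNIV"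
    by (rule norm_summable_comparison(2)[OF assms(2)]) (use assms(1) in \<open>simp add: norm_mult\<close>)
  then have "((\<lambda>j. cis (\<beta> * snd p) * (a j (fst p) * cis (of_int j * snd p))) has_sum Sser \<beta> a p) UNIV"
    unfolding Sser_def by (intro has_sum_cmult_right has_sum_infsum)
  then show ?thesis by (simp add: mode_split mult_ac)
qed

lemma Sser_uniform_limit:
  assumes "\<And>j x. norm (a j x) \<le> M j" "M summable_on UNIV"
  shows "uniform_limit UNIV (\<lambda>F p. \<Sum>j\<in>F. a j (fst p) * mode \<beta> j (snd p)) (Sser \<beta> a) (finite_subsets_at_top UNIV)"
  by (rule Weierstrass_m_test_general'[where M = M])
     (use assms in \<open>auto simp: norm_mult intro!: Sser_has_sum[where M = M]\<close>)

lemma Sser_continuous: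
  assumes "\<And>j x. norm (a j x) \<le> M j" "M summable_on UNIV" "\<And>j. continuous_on UNIV (a j)"
  shows "continuous_on UNIV (Sser \<beta> a)"
proof (rule uniform_limit_theorem[OF _ Sser_uniform_limit[OF assms(1,2)]])
  show "\<forall>\<^sub>F F in finite_subsets_at_top UNIV. continuous_on UNIV (\<lambda>p. \<Sum>j\<in>F. a j (fst p) * mode \<beta> j (snd p))"
    by (intro always_eventually allI continuous_intros continuous_mode_snd continuous_on_compose2[OF assms(3)]) auto
qed auto

lemma Sser_approx:
  assumes F: "finite F" and d: "\<And>j. j \<in> F \<Longrightarrow> norm (v j (fst p) - w j) \<le> d j"
    and m: "\<And>j. norm (v j (fst p)) \<le> m j" "m summable_on UNIV"
  shows "norm ((\<Sum>j\<in>F. w j * mode \<beta> j (snd p)) - Sser \<beta> v p) \<le> sum d F + infsum m (- F)"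
proof -
  let ?v = "\<lambda>j. v j (fst p) * mode \<beta> j (snd p)"
  have hs: "(?v has_sum Sser \<beta> v p) UNIV" by (rule Sser_has_sum[where M = m]) (use m in auto)
  have mF: "m summable_on (- F)" by (rule summable_on_subset_banach[OF m(2)]) auto
  have vm: "norm (?v j) \<le> m j" for j using m(1) by (simp add: norm_mult)
  have nF: "(\<lambda>j. norm (?v j)) summable_on (- F)" and vF: "?v summable_on (- F)"
    by (rule norm_summable_comparison[OF mF vm])+
  have t: "norm (infsum ?v (- F)) \<le> infsum m (- F)"
    by (rule order_trans[OF norm_infsum_bound[OF nF] infsum_mono[OF nF mF vm]])
  have "Sser \<beta> v p = infsum ?v (F \<union> - F)" using infsumI[OF hs] by simp
  also have "\<dots> = sum ?v F + infsum ?v (- F)"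
    using vF F by (subst infsum_Un_disjoint) auto
  finally have "(\<Sum>j\<in>F. w j * mode \<beta> j (snd p)) - Sser \<beta> v p = - ((\<Sum>j\<in>F. (v j (fst p) - w j) * mode \<beta> j (snd p)) + infsum ?v (- F))"
    by (simp add: sum_subtractf left_diff_distrib)
  then have "norm ((\<Sum>j\<in>F. w j * mode \<beta> j (snd p)) - Sser \<beta> v p) \<le> norm (\<Sum>j\<in>F. (v j (fst p) - w j) * mode \<beta> j (snd p)) + norm (infsum ?v (- F))"
    by (simp only: norm_minus_cancel norm_triangle_ineq)
  also have "norm (\<Sum>j\<in>F. (v j (fst p) - w j) * mode \<beta> j (snd p)) \<le> sum d F"
    by (rule sum_norm_le) (use d in \<open>simp add: norm_mult\<close>)
  finally show ?thesis using t by simp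
qed

lemma summable_tail_small:
  fixes m :: "int \<Rightarrow> real"
  assumes "m summable_on UNIV" "0 < \<delta>"
  obtains F where "finite F" "infsum m (- F) \<le> \<delta>"
proof -
  obtain F where F: "finite F" "dist (sum m F) (infsum m UNIV) \<le> \<delta>"
    using infsum_finite_approximation[OF assms] by blast
  have "m summable_on (- F)" by (rule summable_on_subset_banach[OF assms(1)]) auto
  then have "infsum m (F \<union> - F) = sum m F + infsum m (- F)"
    using F by (subst infsum_Un_disjoint) auto
  then show thesis using that F by (auto simp: dist_real_def)
qed

section \<open>Integration over the strip with exponential weights\<close>

lemma integrable_exp_abs:
  assumes "0 < (a::real)" shows "integrable lborel (\<lambda>x. exp (- a * \<bar>x\<bar>))"
proof -
  define g where "g x = indicator {0..} x *\<^sub>R exp (- a * x)" for x :: real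
  have "(\<lambda>x. exp (- a * x)) absolutely_integrable_on {0..}"
    by (rule nonnegative_absolutely_integrable_1[OF integrable_on_exp_minus_to_infinity[OF assms]]) auto
  then have "integrable (completion lborel) g"
    unfolding set_integrable_def g_def .
  moreover have gm: "g \<in> borel_measurable lborel" unfolding g_def by measurable
  ultimately have g: "integrable lborel g" using integrable_completion by blast
  then have g': "integrable lborel (\<lambda>x. g (0 + (-1) * x))" by (rule lborel_integrable_real_affine) auto
  have "integrable lborel (\<lambda>x. g x + g (0 + (-1) * x))" by (rule Bochner_Integration.integrable_add[OF g g'])
  then show ?thesis
  proof (rule Bochner_Integration.integrable_bound)
    show "AE x in lborel. norm (exp (- a * \<bar>x\<bar>)) \<le> norm (g x + g (0 + (-1) * x))"
      by (rule AE_I2) (auto simp: g_def indicator_def)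
  qed measurable
qed

lemma strip_sets [measurable]: "strip \<in> sets borel"
  unfolding strip_def by (intro borel_open open_Times) auto

lemma set_integrable_exp_strip:
  assumes a: "0 < (a::real)" shows "set_integrable lborel strip (\<lambda>p. exp (- a * \<bar>fst p\<bar>))"
proof -
  let ?f = "\<lambda>p. indicator strip p *\<^sub>R exp (- a * \<bar>fst p\<bar>)"
  have ind: "indicator strip (x, y) = indicator {0<..<2*pi} y" for x y :: real
    by (auto simp: strip_def indicator_def)
  have i: "integrable lborel (\<lambda>y. indicator {0<..<2*pi} y *\<^sub>R c)" for c :: real
    by (rule integrable_scaleR_left) (auto intro!: integrable_real_indicator)
  have "integrable (lborel \<Otimes>\<^sub>M lborel) ?f"
  proof (rule lborel_pair.Fubini_integrable)
    show "?f \<in> borel_measurable (lborel \<Otimes>\<^sub>M lborel)"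
      unfolding lborel_prod measurable_lborel2
      by (intro borel_measurable_scaleR borel_measurable_indicator borel_measurable_continuous_onI)
         (auto intro!: continuous_intros)
    have "(\<integral>y. norm (?f (x, y)) \<partial>lborel) = 2 * pi * exp (- a * \<bar>x\<bar>)" for x
    proof -
      have "(\<integral>y. norm (?f (x, y)) \<partial>lborel) = (\<integral>y. indicator {0<..<2*pi} y *\<^sub>R exp (- a * \<bar>x\<bar>) \<partial>lborel)"
        by (rule Bochner_Integration.integral_cong) (auto simp: ind)
      then show ?thesis by simp
    qed
    then show "integrable lborel (\<lambda>x. \<integral>y. norm (?f (x, y)) \<partial>lborel)"
      using integrable_exp_abs[OF a] by simp
    show "AE x in lborel. integrable lborel (\<lambda>y. ?f (x, y))"
      by (rule AE_I2) (simp only: ind fst_conv i)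
  qed
  then show ?thesis unfolding set_integrable_def lborel_prod .
qed

lemma strip_integral_bound:
  fixes h :: "real \<times> real \<Rightarrow> 'b::euclidean_space"
  assumes "continuous_on UNIV h" "0 < a" "\<And>p. norm (h p) \<le> K * exp (- a * \<bar>fst p\<bar>)"
  shows "h integrable_on strip" "norm (integral strip h) \<le> K * integral strip (\<lambda>p. exp (- a * \<bar>fst p\<bar>))"
proof -
  note e = set_integrable_exp_strip[OF assms(2)]
  have m: "h \<in> borel_measurable lborel" using assms(1) by (simp add: borel_measurable_continuous_onI)
  have K: "set_integrable lborel strip (\<lambda>p. K * exp (- a * \<bar>fst p\<bar>))"
    using e by (intro set_integrable_mult_right) auto
  have "set_integrable lborel strip h"
    unfolding set_integrable_def
  proof (rule Bochner_Integration.integrable_bound[OF K[unfolded set_integrable_def]])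
    show "(\<lambda>x. indicator strip x *\<^sub>R h x) \<in> borel_measurable lborel" using m by measurable
    have "norm (h p) \<le> \<bar>K * exp (- a * \<bar>fst p\<bar>)\<bar>" for p using assms(3)[of p] by linarith
    then show "AE p in lborel. norm (indicator strip p *\<^sub>R h p) \<le> norm (indicator strip p *\<^sub>R (K * exp (- a * \<bar>fst p\<bar>)))"
      by (intro AE_I2) (simp add: indicator_def)
  qed
  then show h: "h integrable_on strip" by (rule set_borel_integral_eq_integral)

  have "norm (integral strip h) \<le> integral strip (\<lambda>p. K * exp (- a * \<bar>fst p\<bar>))"
    by (rule Henstock_Kurzweil_Integration.integral_norm_bound_integral[OF h]) (use set_borel_integral_eq_integral(1)[OF K] assms(3) in auto)
  then show "norm (integral strip h) \<le> K * integral strip (\<lambda>p. exp (- a * \<bar>fst p\<bar>))" by simp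
qed

section \<open>Finite mode sums as test functions, and the energy space\<close>

lemma mode_sum_smooth:
  assumes F: "finite F" and \<phi>: "\<And>j. j \<in> F \<Longrightarrow> smoothc (\<phi> j)"
    "\<And>j x. j \<in> F \<Longrightarrow> (\<phi> j has_vector_derivative \<phi>' j x) (at x)"
    and \<Phi>_def: "\<Phi> = (\<lambda>p. \<Sum>j\<in>F. \<phi> j (fst p) * mode \<beta> j (snd p))"
  shows "smooth2 \<Phi>"
    and "px \<Phi> p = (\<Sum>j\<in>F. \<phi>' j (fst p) * mode \<beta> j (snd p))"
    and "py \<Phi> p = (\<Sum>j\<in>F. (\<i> * of_real (\<beta> + of_int j) * \<phi> j (fst p)) * mode \<beta> j (snd p))"
proof -
  obtain D where D: "\<And>j. j \<in> F \<Longrightarrow> D j 0 = \<phi> j \<and> (\<forall>k x. (D j k has_vector_derivative D j (Suc k) x) (at x))"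
    using \<phi>(1) unfolding smoothc_def by metis
  define E where "E i k p = (\<Sum>j\<in>F. D j i (fst p) * ((\<i> * of_real (\<beta> + of_int j)) ^ k * mode \<beta> j (snd p)))" for i k and p :: "real \<times> real"
  have Dc: "continuous_on UNIV (D j i)" if "j \<in> F" for i j
    using D[OF that] by (meson continuous_at_imp_continuous_on has_vector_derivative_continuous)
  have "continuous_on UNIV (E i k)" for i k
    unfolding E_def by (intro continuous_intros continuous_mode_snd continuous_on_compose2[OF Dc]) auto
  moreover have "((\<lambda>t. E i k (t, y)) has_vector_derivative E (Suc i) k (x, y)) (at x)" for i k x y
    unfolding E_def fst_conv snd_conv
    by (intro has_vector_derivative_sum has_vector_derivative_mult_left) (use D in auto)
  moreover have "((\<lambda>t. E i k (x, t)) has_vector_derivative E i (Suc k) (x, y)) (at y)" for i k x y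
  proof -
    have "((\<lambda>t. \<Sum>j\<in>F. D j i x * ((\<i> * of_real (\<beta> + of_int j)) ^ k * mode \<beta> j t)) has_vector_derivative
      (\<Sum>j\<in>F. D j i x * ((\<i> * of_real (\<beta> + of_int j)) ^ k * (\<i> * of_real (\<beta> + of_int j) * mode \<beta> j y)))) (at y)"
      by (intro has_vector_derivative_sum has_vector_derivative_mult_right mode_deriv)
    then show ?thesis unfolding E_def fst_conv snd_conv by (simp add: mult_ac)
  qed
  moreover have "E 0 0 = \<Phi>"
    unfolding E_def[abs_def] \<Phi>_def using D by (auto intro!: sum.cong)
  ultimately show "smooth2 \<Phi>" unfolding smooth2_def by (intro exI[of _ E]) auto
  have "((\<lambda>t. \<Phi> (t, snd p)) has_vector_derivative (\<Sum>j\<in>F. \<phi>' j (fst p) * mode \<beta> j (snd p))) (at (fst p))"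
    unfolding \<Phi>_def fst_conv snd_conv
    by (intro has_vector_derivative_sum has_vector_derivative_mult_left \<phi>)
  then show "px \<Phi> p = (\<Sum>j\<in>F. \<phi>' j (fst p) * mode \<beta> j (snd p))"
    unfolding px_def by (rule vector_derivative_at)
  have "((\<lambda>t. \<Phi> (fst p, t)) has_vector_derivative (\<Sum>j\<in>F. \<phi> j (fst p) * (\<i> * of_real (\<beta> + of_int j) * mode \<beta> j (snd p)))) (at (snd p))"
    unfolding \<Phi>_def fst_conv snd_conv
    by (intro has_vector_derivative_sum has_vector_derivative_mult_right mode_deriv)
  then have "py \<Phi> p = (\<Sum>j\<in>F. \<phi> j (fst p) * (\<i> * of_real (\<beta> + of_int j) * mode \<beta> j (snd p)))"
    unfolding py_def by (rule vector_derivative_at)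
  then show "py \<Phi> p = (\<Sum>j\<in>F. (\<i> * of_real (\<beta> + of_int j) * \<phi> j (fst p)) * mode \<beta> j (snd p))"
    by (simp add: mult_ac)
qed

lemma mode_quasiperiodic: "mode \<beta> j (2 * pi) = cis (2 * pi * \<beta>) * mode \<beta> j 0"
proof -
  have "cis (of_int j * (2 * pi)) = 1" using cis_multiple_2pi[of "of_int j"] by (simp add: mult_ac)
  then show ?thesis by (simp add: mode_split mult_ac)
qed

lemma mode_sum_test:
  assumes F: "finite F" and \<phi>: "\<And>j. j \<in> F \<Longrightarrow> smoothc (\<phi> j)"
    "\<And>j x. j \<in> F \<Longrightarrow> (\<phi> j has_vector_derivative \<phi>' j x) (at x)"
    and L: "\<And>j x. j \<in> F \<Longrightarrow> \<bar>x\<bar> > L j \<Longrightarrow> \<phi> j x = 0"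
  shows "test_beta \<beta> (\<lambda>p. \<Sum>j\<in>F. \<phi> j (fst p) * mode \<beta> j (snd p))"
  unfolding test_beta_def
proof (intro conjI allI)
  show "smooth2 (\<lambda>p. \<Sum>j\<in>F. \<phi> j (fst p) * mode \<beta> j (snd p))"
    by (rule mode_sum_smooth(1)[OF F \<phi> refl])
  have py: "py (\<lambda>p. \<Sum>j\<in>F. \<phi> j (fst p) * mode \<beta> j (snd p)) p
      = (\<Sum>j\<in>F. (\<i> * of_real (\<beta> + of_int j) * \<phi> j (fst p)) * mode \<beta> j (snd p))" for p
    by (rule mode_sum_smooth(3)[OF F \<phi> refl])
  fix x
  show "(\<Sum>j\<in>F. \<phi> j (fst (x, 2*pi)) * mode \<beta> j (snd (x, 2*pi))) = cis (2*pi*\<beta>) * (\<Sum>j\<in>F. \<phi> j (fst (x, 0)) * mode \<beta> j (snd (x, 0)))"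
    by (simp only: snd_conv fst_conv mode_quasiperiodic sum_distrib_left mult.left_commute)
  show "py (\<lambda>p. \<Sum>j\<in>F. \<phi> j (fst p) * mode \<beta> j (snd p)) (x, 2 * pi) =
         cis (2 * pi * \<beta>) * py (\<lambda>p. \<Sum>j\<in>F. \<phi> j (fst p) * mode \<beta> j (snd p)) (x, 0)"
    unfolding py
    by (simp only: snd_conv fst_conv mode_quasiperiodic sum_distrib_left mult.left_commute)
next
  show "\<exists>K. \<forall>x y. \<bar>x\<bar> > K \<longrightarrow> 0 \<le> y \<longrightarrow> y \<le> 2*pi \<longrightarrow> (\<Sum>j\<in>F. \<phi> j (fst (x, y)) * mode \<beta> j (snd (x, y))) = 0"
  proof (intro exI[of _ "Max (insert 0 (L ` F))"] allI impI)
    fix x y :: real assume "\<bar>x\<bar> > Max (insert 0 (L ` F))"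
    then have "\<phi> j x = 0" if "j \<in> F" for j using F that by (intro L) auto
    then show "(\<Sum>j\<in>F. \<phi> j (fst (x, y)) * mode \<beta> j (snd (x, y))) = 0" by simp
  qed
qed

text \<open>\<open>px\<close> and \<open>py\<close> are vector derivatives, so by uniqueness they
  coincide with the first members of the witness, which supply the continuity.\<close>

lemma smooth2_partials:
  assumes "smooth2 \<Phi>"
  shows "continuous_on UNIV \<Phi>" "continuous_on UNIV (px \<Phi>)" "continuous_on UNIV (py \<Phi>)"
    and "((\<lambda>t. \<Phi> (t, y)) has_vector_derivative px \<Phi> (x, y)) (at x)"
    and "((\<lambda>t. \<Phi> (x, t)) has_vector_derivative py \<Phi> (x, y)) (at y)"
proof -
  obtain D where D0: "D 0 0 = \<Phi>" and D: "\<forall>i j. continuous_on UNIV (D i j) \<and>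
        (\<forall>x y. ((\<lambda>t. D i j (t, y)) has_vector_derivative D (Suc i) j (x, y)) (at x) \<and>
               ((\<lambda>t. D i j (x, t)) has_vector_derivative D i (Suc j) (x, y)) (at y))"
    using assms unfolding smooth2_def by blast
  have dx: "((\<lambda>t. \<Phi> (t, y)) has_vector_derivative D 1 0 (x, y)) (at x)" for x y
    using D D0 by (metis One_nat_def)
  have dy: "((\<lambda>t. \<Phi> (x, t)) has_vector_derivative D 0 1 (x, y)) (at y)" for x y
    using D D0 by (metis One_nat_def)
  have "px \<Phi> p = D 1 0 p" "py \<Phi> p = D 0 1 p" for p
    unfolding px_def py_def using vector_derivative_at[OF dx, of "snd p" "fst p"] vector_derivative_at[OF dy, of "fst p" "snd p"]
    by simp_all
  then have eq: "px \<Phi> = D 1 0" "py \<Phi> = D 0 1" by auto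
  show "continuous_on UNIV \<Phi>" "continuous_on UNIV (px \<Phi>)" "continuous_on UNIV (py \<Phi>)"
    unfolding eq using D D0 by auto
  show "((\<lambda>t. \<Phi> (t, y)) has_vector_derivative px \<Phi> (x, y)) (at x)"
    "((\<lambda>t. \<Phi> (x, t)) has_vector_derivative py \<Phi> (x, y)) (at y)"
    unfolding eq by (rule dx dy)+
qed

text \<open>The series is cut to finitely many modes, the rest being controlled by the summable
  majorant, and each retained mode is approximated together with its derivative. The errors keep an
  exponential factor in \<open>x\<close>, since a merely uniform error is not square integrable over
  the infinite strip.\<close>

lemma H1_approx_step:
  assumes chi: "cutoff chi" and \<mu>: "0 < \<mu>"
    and d: "\<And>j x. (u j has_vector_derivative u' j x) (at x)" and c: "\<And>j. continuous_on UNIV (u' j)"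
    and bd: "\<And>j x. norm (u j x) \<le> M j * exp (- \<mu> * \<bar>x\<bar>)" "\<And>j x. norm (u' j x) \<le> M j * exp (- \<mu> * \<bar>x\<bar>)"
    and sM: "(\<lambda>j. (1 + \<bar>of_int j\<bar>) * M j) summable_on UNIV" and \<delta>: "0 < \<delta>"
  shows "\<exists>\<Phi>. test_beta \<beta> \<Phi> \<and> continuous_on UNIV \<Phi> \<and> continuous_on UNIV (px \<Phi>) \<and> continuous_on UNIV (py \<Phi>) \<and>
     (\<forall>p. norm (\<Phi> p - Sser \<beta> u p) \<le> \<delta> * exp (- (\<mu> / 2) * \<bar>fst p\<bar>) \<and>
          norm (px \<Phi> p - Sser \<beta> u' p) \<le> \<delta> * exp (- (\<mu> / 2) * \<bar>fst p\<bar>) \<and>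
          norm (py \<Phi> p - Sser \<beta> (\<lambda>j x. \<i> * of_real (\<beta> + of_int j) * u j x) p) \<le> \<delta> * exp (- (\<mu> / 2) * \<bar>fst p\<bar>))"
proof -
  define b where "b = 1 + \<bar>\<beta>\<bar>"
  have b: "1 \<le> b" by (simp add: b_def)
  define w where "w j = b * (1 + \<bar>of_int j\<bar>)" for j :: int
  have w: "1 \<le> w j" for j using b mult_mono[of 1 b 1 "1 + \<bar>real_of_int j\<bar>"] by (simp add: w_def)
  have wb: "norm (\<i> * of_real (\<beta> + of_int j) :: complex) \<le> w j" for j
  proof -
    have "\<bar>\<beta> + of_int j\<bar> \<le> \<bar>\<beta>\<bar> + \<bar>of_int j\<bar>" by (rule abs_triangle_ineq)
    also have "\<dots> \<le> w j" by (simp add: w_def b_def algebra_simps)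
    finally show ?thesis by (simp add: norm_mult del: of_real_add)
  qed
  have M: "0 \<le> M j" for j using bd(1)[of j 0] norm_ge_zero[of "u j 0"] by (simp del: norm_ge_zero)
  define m where "m j = w j * M j" for j
  have sm: "m summable_on UNIV"
    using summable_on_cmult_right[OF sM, of b] by (simp add: m_def[abs_def] w_def mult_ac)
  have Mm: "M j \<le> m j" for j using mult_right_mono[OF w M, of j] by (simp add: m_def)
  obtain F where F: "finite F" "infsum m (- F) \<le> \<delta> / 2" using summable_tail_small[OF sm, of "\<delta> / 2"] \<delta> by auto
  \<comment> \<open>The division by the number of modes lets the errors add up, and
    \<open>w j\<close> absorbs the factor \<open>\<beta> + j\<close> produced by the derivative in
    \<open>y\<close>. The 2 leaves half of \<open>\<delta>\<close> for the discarded modes.\<close>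
  define dl where "dl j = \<delta> / (2 * (real (card F) + 1) * w j)" for j
  have dl: "0 < dl j" for j using \<delta> w[of j] by (auto simp: dl_def intro!: divide_pos_pos mult_pos_pos)
  have "\<exists>\<phi> \<phi>' L. smoothc \<phi> \<and> (\<forall>x. (\<phi> has_vector_derivative \<phi>' x) (at x)) \<and> (\<forall>x. \<bar>x\<bar> > L \<longrightarrow> \<phi> x = 0) \<and>
     (\<forall>x. norm (u j x - \<phi> x) \<le> dl j * exp (- (\<mu> / 2) * \<bar>x\<bar>) \<and> norm (u' j x - \<phi>' x) \<le> dl j * exp (- (\<mu> / 2) * \<bar>x\<bar>))" for j
    by (rule smooth_compact_approx[OF chi d c bd \<mu> dl])
  then obtain \<phi> \<phi>' L where \<phi>: "\<And>j. smoothc (\<phi> j)" "\<And>j x. (\<phi> j has_vector_derivative \<phi>' j x) (at x)"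
    "\<And>j x. \<bar>x\<bar> > L j \<Longrightarrow> \<phi> j x = 0"
    "\<And>j x. norm (u j x - \<phi> j x) \<le> dl j * exp (- (\<mu> / 2) * \<bar>x\<bar>)"
    "\<And>j x. norm (u' j x - \<phi>' j x) \<le> dl j * exp (- (\<mu> / 2) * \<bar>x\<bar>)" by metis
  define \<Phi> where "\<Phi> = (\<lambda>p. \<Sum>j\<in>F. \<phi> j (fst p) * mode \<beta> j (snd p))"
  have px: "px \<Phi> p = (\<Sum>j\<in>F. \<phi>' j (fst p) * mode \<beta> j (snd p))" for p
    by (rule mode_sum_smooth(2)[OF F(1) \<phi>(1,2) \<Phi>_def])
  have py: "py \<Phi> p = (\<Sum>j\<in>F. (\<i> * of_real (\<beta> + of_int j) * \<phi> j (fst p)) * mode \<beta> j (snd p))" for p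
    by (rule mode_sum_smooth(3)[OF F(1) \<phi>(1,2) \<Phi>_def])
  have "test_beta \<beta> \<Phi>" unfolding \<Phi>_def by (rule mode_sum_test[OF F(1) \<phi>(1,2,3)])
  moreover from this have "continuous_on UNIV \<Phi>" "continuous_on UNIV (px \<Phi>)" "continuous_on UNIV (py \<Phi>)"
    by (auto intro!: smooth2_partials simp: test_beta_def)
  \<comment> \<open>One estimate serves the function and both derivatives; they differ only in the
    family that is approximated.\<close>
  moreover have key: "norm ((\<Sum>j\<in>F. \<psi> j (fst p) * mode \<beta> j (snd p)) - Sser \<beta> v p) \<le> \<delta> * exp (- (\<mu> / 2) * \<bar>fst p\<bar>)"
    if v1: "\<And>j x. norm (v j x - \<psi> j x) \<le> w j * dl j * exp (- (\<mu> / 2) * \<bar>x\<bar>)" and v2: "\<And>j x. norm (v j x) \<le> m j * exp (- \<mu> * \<bar>x\<bar>)" for v \<psi> p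
  proof -
    let ?E = "exp (- (\<mu> / 2) * \<bar>fst p\<bar>)"
    have "exp (- \<mu> * \<bar>fst p\<bar>) \<le> ?E" using \<mu> by simp
    then have v3: "norm (v j (fst p)) \<le> m j * ?E" for j
      using v2[of j "fst p"] M[of j] Mm[of j] by (meson mult_left_mono order_trans)
    have "norm ((\<Sum>j\<in>F. \<psi> j (fst p) * mode \<beta> j (snd p)) - Sser \<beta> v p) \<le> (\<Sum>j\<in>F. w j * dl j * ?E) + infsum (\<lambda>j. m j * ?E) (- F)"
      by (rule Sser_approx[where w = "\<lambda>j. \<psi> j (fst p)"]) (use F(1) v1 v3 summable_on_cmult_left[OF sm] in auto)
    also have "infsum (\<lambda>j. m j * ?E) (- F) = infsum m (- F) * ?E"
      by (rule infsum_cmult_left')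
    also have "\<dots> \<le> \<delta> / 2 * ?E" using F(2) by (intro mult_right_mono) auto
    also have "(\<Sum>j\<in>F. w j * dl j * ?E) = (real (card F) * (\<delta> / (2 * (real (card F) + 1)))) * ?E"
    proof -
      have "w j * dl j = \<delta> / (2 * (real (card F) + 1))" for j using w[of j] by (simp add: dl_def)
      then show ?thesis by simp
    qed
    also have "\<dots> \<le> \<delta> / 2 * ?E"
    proof (rule mult_right_mono)
      have "real (card F) * (\<delta> / (2 * (real (card F) + 1))) = \<delta> / 2 * (real (card F) / (real (card F) + 1))" by simp
      also have "\<dots> \<le> \<delta> / 2 * 1" using \<delta> by (intro mult_left_mono) auto
      finally show "real (card F) * (\<delta> / (2 * (real (card F) + 1))) \<le> \<delta> / 2" by simp
    qed simp
    finally show ?thesis by (simp add: field_simps)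
  qed
  moreover have "norm (\<Phi> p - Sser \<beta> u p) \<le> \<delta> * exp (- (\<mu> / 2) * \<bar>fst p\<bar>)" for p
    unfolding \<Phi>_def
  proof (rule key)
    fix j x
    have "dl j \<le> w j * dl j" using w[of j] dl[of j] by simp
    then show "norm (u j x - \<phi> j x) \<le> w j * dl j * exp (- (\<mu> / 2) * \<bar>x\<bar>)"
      using \<phi>(4)[of j x] by (meson exp_ge_zero mult_right_mono order_trans)
    show "norm (u j x) \<le> m j * exp (- \<mu> * \<bar>x\<bar>)"
      using bd(1)[of j x] Mm[of j] by (meson exp_ge_zero mult_right_mono order_trans)
  qed
  moreover have "norm (px \<Phi> p - Sser \<beta> u' p) \<le> \<delta> * exp (- (\<mu> / 2) * \<bar>fst p\<bar>)" for p
    unfolding px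
  proof (rule key)
    fix j x
    have "dl j \<le> w j * dl j" using w[of j] dl[of j] by simp
    then show "norm (u' j x - \<phi>' j x) \<le> w j * dl j * exp (- (\<mu> / 2) * \<bar>x\<bar>)"
      using \<phi>(5)[of j x] by (meson exp_ge_zero mult_right_mono order_trans)
    show "norm (u' j x) \<le> m j * exp (- \<mu> * \<bar>x\<bar>)"
      using bd(2)[of j x] Mm[of j] by (meson exp_ge_zero mult_right_mono order_trans)
  qed
  moreover have "norm (py \<Phi> p - Sser \<beta> (\<lambda>j x. \<i> * of_real (\<beta> + of_int j) * u j x) p) \<le> \<delta> * exp (- (\<mu> / 2) * \<bar>fst p\<bar>)" for p
    unfolding py
  proof (rule key)
    fix j x
    have "norm (\<i> * of_real (\<beta> + of_int j) * (u j x - \<phi> j x)) \<le> w j * (dl j * exp (- (\<mu> / 2) * \<bar>x\<bar>))"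
      unfolding norm_mult[of "\<i> * of_real (\<beta> + of_int j)"] using w[of j] by (intro mult_mono wb \<phi>(4)) auto
    then show "norm (\<i> * of_real (\<beta> + of_int j) * u j x - \<i> * of_real (\<beta> + of_int j) * \<phi> j x) \<le> w j * dl j * exp (- (\<mu> / 2) * \<bar>x\<bar>)"
      by (simp only: right_diff_distrib mult.assoc)
    have "norm (\<i> * of_real (\<beta> + of_int j) * u j x) \<le> w j * (M j * exp (- \<mu> * \<bar>x\<bar>))"
      unfolding norm_mult[of "\<i> * of_real (\<beta> + of_int j)"] using w[of j] by (intro mult_mono wb bd) auto
    then show "norm (\<i> * of_real (\<beta> + of_int j) * u j x) \<le> m j * exp (- \<mu> * \<bar>x\<bar>)"
      by (simp only: m_def mult.assoc)
  qed
  ultimately show ?thesis by blast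
qed

text \<open>The limits of the gradients are the termwise differentiated series. Errors of size
  \<open>1 / Suc k\<close> with half the decay rate have squares with the full rate
  \<open>\<mu>\<close>, whose integral over the strip is finite.\<close>

lemma H1beta_Sser:
  assumes chi: "cutoff chi" and \<mu>: "0 < \<mu>"
    and d: "\<And>j x. (u j has_vector_derivative u' j x) (at x)" and c: "\<And>j. continuous_on UNIV (u' j)"
    and bd: "\<And>j x. norm (u j x) \<le> M j * exp (- \<mu> * \<bar>x\<bar>)" "\<And>j x. norm (u' j x) \<le> M j * exp (- \<mu> * \<bar>x\<bar>)"
    and sM: "(\<lambda>j. (1 + \<bar>of_int j\<bar>) * M j) summable_on UNIV"
  shows "H1beta \<beta> (Sser \<beta> u)"
proof -
  let ?E = "\<lambda>p::real \<times> real. exp (- (\<mu> / 2) * \<bar>fst p\<bar>)"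
  let ?uy = "\<lambda>j x. \<i> * of_real (\<beta> + of_int j) * u j x"
  define good where "good k \<Phi> \<longleftrightarrow> test_beta \<beta> \<Phi> \<and> continuous_on UNIV \<Phi> \<and> continuous_on UNIV (px \<Phi>) \<and> continuous_on UNIV (py \<Phi>) \<and>
     (\<forall>p. norm (\<Phi> p - Sser \<beta> u p) \<le> 1 / real (Suc k) * ?E p \<and>
          norm (px \<Phi> p - Sser \<beta> u' p) \<le> 1 / real (Suc k) * ?E p \<and>
          norm (py \<Phi> p - Sser \<beta> ?uy p) \<le> 1 / real (Suc k) * ?E p)" for k \<Phi>
  have "\<exists>\<Phi>. good k \<Phi>" for k
    unfolding good_def by (rule H1_approx_step[OF chi \<mu> d c bd sM]) simp
  then obtain \<Phi> where "\<And>k. good k (\<Phi> k)" by metis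
  then have \<Phi>: "\<And>k. test_beta \<beta> (\<Phi> k)" "\<And>k. continuous_on UNIV (\<Phi> k)" "\<And>k. continuous_on UNIV (px (\<Phi> k))" "\<And>k. continuous_on UNIV (py (\<Phi> k))"
    "\<And>k p. norm (\<Phi> k p - Sser \<beta> u p) \<le> 1 / real (Suc k) * ?E p" "\<And>k p. norm (px (\<Phi> k) p - Sser \<beta> u' p) \<le> 1 / real (Suc k) * ?E p"
    "\<And>k p. norm (py (\<Phi> k) p - Sser \<beta> ?uy p) \<le> 1 / real (Suc k) * ?E p"
    unfolding good_def by blast+
  have M: "0 \<le> M j" for j using bd(1)[of j 0] norm_ge_zero[of "u j 0"] by (simp del: norm_ge_zero)
  have u: "continuous_on UNIV (u j)" for j
    using d by (meson continuous_at_imp_continuous_on has_vector_derivative_continuous)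
  define b where "b = 1 + \<bar>\<beta>\<bar>"
  let ?m = "\<lambda>j. b * ((1 + \<bar>of_int j\<bar>) * M j)"
  have sm: "?m summable_on UNIV" by (rule summable_on_cmult_right[OF sM])
  have wb: "\<bar>\<beta> + of_int j\<bar> \<le> b * (1 + \<bar>of_int j\<bar>)" for j :: int
  proof -
    have "\<bar>\<beta> + of_int j\<bar> \<le> \<bar>\<beta>\<bar> + \<bar>of_int j\<bar>" by (rule abs_triangle_ineq)
    also have "\<dots> \<le> b * (1 + \<bar>of_int j\<bar>)" by (simp add: b_def algebra_simps)
    finally show ?thesis .
  qed
  have Mm: "M j \<le> ?m j" for j
  proof -
    have "1 * M j \<le> (b * (1 + \<bar>of_int j\<bar>)) * M j"
      by (rule mult_right_mono[OF _ M]) (simp add: b_def algebra_simps)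
    then show ?thesis by (simp add: mult_ac)
  qed
  have e1: "M j * exp (- \<mu> * \<bar>x\<bar>) \<le> M j" for j and x :: real
    using M[of j] \<mu> by (simp add: mult_left_le)
  have n: "norm (u j x) \<le> ?m j" "norm (u' j x) \<le> ?m j" "norm (?uy j x) \<le> ?m j" for j x
  proof -
    show "norm (u j x) \<le> ?m j" "norm (u' j x) \<le> ?m j" using bd[of j x] e1[of j x] Mm[of j] by linarith+
    have "norm (?uy j x) \<le> (b * (1 + \<bar>of_int j\<bar>)) * M j"
      unfolding norm_mult[of "\<i> * of_real (\<beta> + of_int j)"]
      using wb[of j] bd(1)[of j x] e1[of j x] by (intro mult_mono) (auto simp: norm_mult b_def simp del: of_real_add)
    then show "norm (?uy j x) \<le> ?m j" by (simp add: mult_ac)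
  qed
  have Sc: "continuous_on UNIV (Sser \<beta> u)" "continuous_on UNIV (Sser \<beta> u')" "continuous_on UNIV (Sser \<beta> ?uy)"
    by (rule Sser_continuous[OF n(1) sm u], rule Sser_continuous[OF n(2) sm c], rule Sser_continuous[OF n(3) sm]) (intro continuous_intros u)
  define I where "I = integral strip (\<lambda>p. exp (- \<mu> * \<bar>fst p\<bar>))"
  have conv0: "(\<lambda>k. (1 / real (Suc k))\<^sup>2 * I) \<longlonglongrightarrow> 0"
    using tendsto_mult[OF tendsto_power[OF LIMSEQ_inverse_real_of_nat, of 2] tendsto_const[of I]]
    by (simp add: inverse_eq_divide)
  have main: "(\<forall>k. (\<lambda>p. (cmod (h k p - g p))\<^sup>2) integrable_on strip) \<and> (\<lambda>k. integral strip (\<lambda>p. (cmod (h k p - g p))\<^sup>2)) \<longlonglongrightarrow> 0"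
    if h: "\<And>k. continuous_on UNIV (h k)" and g: "continuous_on UNIV g" and hb: "\<And>k p. norm (h k p - g p) \<le> 1 / real (Suc k) * ?E p" for h g
  proof -
    have c: "continuous_on UNIV (\<lambda>p. (cmod (h k p - g p))\<^sup>2)" for k by (intro continuous_intros h g)
    have b: "norm ((cmod (h k p - g p))\<^sup>2) \<le> (1 / real (Suc k))\<^sup>2 * exp (- \<mu> * \<bar>fst p\<bar>)" for k p
    proof -
      have "(cmod (h k p - g p))\<^sup>2 \<le> (1 / real (Suc k) * ?E p)\<^sup>2" by (rule power_mono[OF hb]) simp
      also have "\<dots> = (1 / real (Suc k))\<^sup>2 * (?E p)\<^sup>2" by (rule power_mult_distrib)
      also have "(?E p)\<^sup>2 = exp (- \<mu> * \<bar>fst p\<bar>)" by (simp flip: exp_double)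
      finally show ?thesis by simp
    qed
    note * = strip_integral_bound[OF c \<mu> b]
    have "(\<lambda>k. integral strip (\<lambda>p. (cmod (h k p - g p))\<^sup>2)) \<longlonglongrightarrow> 0"
      by (rule Lim_null_comparison[OF _ conv0]) (use *(2) in \<open>auto simp: I_def\<close>)
    then show ?thesis using *(1) by blast
  qed
  show ?thesis
    unfolding H1beta_def
    using main[of \<Phi>, OF \<Phi>(2) Sc(1) \<Phi>(5)] main[of "\<lambda>k. px (\<Phi> k)", OF \<Phi>(3) Sc(2) \<Phi>(6)] main[of "\<lambda>k. py (\<Phi> k)", OF \<Phi>(4) Sc(3) \<Phi>(7)] \<Phi>(1)
    by (intro exI[of _ \<Phi>] exI[of _ "Sser \<beta> u'"] exI[of _ "Sser \<beta> ?uy"]) blast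
qed

text \<open>The majorant makes the partial sums converge uniformly on a compact box, which allows
  the integral to be taken term by term.\<close>

lemma has_sum_integral:
  fixes \<phi> :: "'i \<Rightarrow> 'a::euclidean_space \<Rightarrow> complex"
  assumes c: "\<And>j. continuous_on (cbox a b) (\<phi> j)" and M: "\<And>j x. x \<in> cbox a b \<Longrightarrow> norm (\<phi> j x) \<le> M j" "M summable_on UNIV"
    and S: "\<And>x. x \<in> cbox a b \<Longrightarrow> ((\<lambda>j. \<phi> j x) has_sum S x) UNIV"
  shows "((\<lambda>j. integral (cbox a b) (\<phi> j)) has_sum integral (cbox a b) S) UNIV"
proof -
  have u: "uniform_limit (cbox a b) (\<lambda>F x. \<Sum>j\<in>F. \<phi> j x) S (finite_subsets_at_top UNIV)"
    by (rule Weierstrass_m_test_general'[where M = M]) (use M S in auto)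
  obtain I J where I: "\<And>F. ((\<lambda>x. \<Sum>j\<in>F. \<phi> j x) has_integral I F) (cbox a b)" and J: "(S has_integral J) (cbox a b)"
    and lim: "(I \<longlongrightarrow> J) (finite_subsets_at_top UNIV)"
    by (rule uniform_limit_integral_cbox[OF u]) (auto intro!: continuous_intros c)
  \<comment> \<open>The equality is shown for all index sets at once; for an infinite one both sums
    are 0 by convention.\<close>
  have "I F = (\<Sum>j\<in>F. integral (cbox a b) (\<phi> j))" for F
  proof (cases "finite F")
    case True
    then have "integral (cbox a b) (\<lambda>x. \<Sum>j\<in>F. \<phi> j x) = (\<Sum>j\<in>F. integral (cbox a b) (\<phi> j))"
      by (intro Henstock_Kurzweil_Integration.integral_sum integrable_continuous c)
    then show ?thesis using integral_unique[OF I] by simp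
  next
    case False
    then show ?thesis using integral_unique[OF I[of F]] by simp
  qed
  then have "I = sum (\<lambda>j. integral (cbox a b) (\<phi> j))" by auto
  then show ?thesis using lim integral_unique[OF J] by (simp add: has_sum_def)
qed

subsection \<open>Fourier coefficients\<close>

lemma mode0: "mode 0 j y = cis (of_int j * y)"
  by (simp add: mode_def)

lemma integral_cis_int:
  "integral {0..2*pi} (\<lambda>y. cis (of_int j * y)) = (if j = 0 then 2 * of_real pi else 0)"
proof (cases "j = 0")
  case False
  have "((\<lambda>y. \<i> * of_int j * mode 0 j y) has_integral mode 0 j (2*pi) - mode 0 j 0) {0..2*pi}"
    by (rule fundamental_theorem_of_calculus)
       (use mode_deriv[of 0 j] in \<open>auto intro: has_vector_derivative_at_within\<close>)
  moreover have "mode 0 j (2*pi) - mode 0 j 0 = 0" using mode_quasiperiodic[of 0 j] by simp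
  ultimately have "integral {0..2*pi} (\<lambda>y. \<i> * of_int j * mode 0 j y) = 0" by (metis integral_unique)
  then show ?thesis using False by (simp add: mode0)
qed (simp add: scaleR_conv_of_real)

definition fc :: "(real \<Rightarrow> complex) \<Rightarrow> int \<Rightarrow> complex" where
  "fc h j = integral {0..2*pi} (\<lambda>y. cis (- (of_int j * y)) * h y)"

lemma fc_deriv:
  assumes d: "\<And>y. (h has_vector_derivative h' y) (at y)" and c: "continuous_on UNIV h'" and per: "h (2*pi) = h 0"
  shows "\<i> * of_int j * fc h j = fc h' j"
proof -
  have ch: "continuous_on UNIV h"
    using d by (meson continuous_at_imp_continuous_on has_vector_derivative_continuous)
  have m: "mode 0 (-j) y = cis (- (of_int j * y))" for y by (simp add: mode0)
  have c01: "continuous_on {0..2*pi} h" "continuous_on {0..2*pi} h'"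
    using continuous_on_subset[OF c] continuous_on_subset[OF ch] by auto
  have i1: "(\<lambda>y. cis (- (of_int j * y)) * h' y) integrable_on {0..2*pi}"
    by (intro integrable_continuous_real continuous_intros c01)
  have i2: "(\<lambda>y. cis (- (of_int j * y)) * h y) integrable_on {0..2*pi}"
    by (intro integrable_continuous_real continuous_intros c01)
  have "((\<lambda>y. mode 0 (-j) y * h' y + (\<i> * of_real (0 + of_int (-j)) * mode 0 (-j) y) * h y) has_integral
      mode 0 (-j) (2*pi) * h (2*pi) - mode 0 (-j) 0 * h 0) {0..2*pi}"
    by (rule fundamental_theorem_of_calculus[OF _ has_vector_derivative_at_within[OF has_vector_derivative_mult[OF mode_deriv d]]]) simp
  moreover have "mode 0 (-j) (2*pi) * h (2*pi) - mode 0 (-j) 0 * h 0 = 0"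
    using mode_quasiperiodic[of 0 "-j"] per by simp
  ultimately have "0 = integral {0..2*pi} (\<lambda>y. cis (- (of_int j * y)) * h' y - \<i> * of_int j * (cis (- (of_int j * y)) * h y))"
    by (simp add: integral_unique m algebra_simps)
  also have "\<dots> = fc h' j - \<i> * of_int j * fc h j"
    unfolding fc_def integral_mult_right[symmetric]
    by (rule Henstock_Kurzweil_Integration.integral_diff[OF i1 integrable_on_mult_right[OF i2]])
  finally show ?thesis by simp
qed

lemma fc_bound:
  assumes "continuous_on UNIV h" "\<And>y. y \<in> {0..2*pi} \<Longrightarrow> norm (h y) \<le> B"
  shows "norm (fc h j) \<le> 2 * pi * B"
proof -
  have "norm (integral {0..2*pi} (\<lambda>y. cis (- (of_int j * y)) * h y)) \<le> B * (2 * pi - 0)"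
    by (rule integral_bound) (auto simp: norm_mult assms intro!: continuous_intros continuous_on_subset[OF assms(1)])
  then show ?thesis by (simp add: fc_def mult_ac)
qed

text \<open>
  The continuous functions orthogonal to all trigonometric polynomials are stable under
  multiplication by trigonometric polynomials; by the Stone-Weierstrass theorem on the circle the
  only periodic one is \<open>0\<close>.
\<close>

definition trig_ann :: "(real \<Rightarrow> complex) set" where
  "trig_ann = {v. continuous_on {0..2*pi} v \<and> (\<forall>j::int. integral {0..2*pi} (\<lambda>y. v y * cis (of_int j * y)) = 0)}"

lemma trig_ann_integrable:
  "v \<in> trig_ann \<Longrightarrow> (\<lambda>y. v y * cis (of_int j * y)) integrable_on {0..2*pi}"
  unfolding trig_ann_def by (intro integrable_continuous_real continuous_intros) auto

lemma trig_ann_lincomb: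
  assumes "v \<in> trig_ann" "w \<in> trig_ann" shows "(\<lambda>y. a * v y + b * w y) \<in> trig_ann"
proof -
  have "integral {0..2*pi} (\<lambda>y. (a * v y + b * w y) * cis (of_int j * y)) = 0" for j :: int
  proof -
    have "integral {0..2*pi} (\<lambda>y. (a * v y + b * w y) * cis (of_int j * y))
      = integral {0..2*pi} (\<lambda>y. a * (v y * cis (of_int j * y)) + b * (w y * cis (of_int j * y)))"
      by (simp add: algebra_simps)
    also have "\<dots> = integral {0..2*pi} (\<lambda>y. a * (v y * cis (of_int j * y))) + integral {0..2*pi} (\<lambda>y. b * (w y * cis (of_int j * y)))"
      by (rule Henstock_Kurzweil_Integration.integral_add) (auto intro!: trig_ann_integrable assms integrable_on_mult_right)
    also have "\<dots> = 0" using assms by (simp add: trig_ann_def)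
    finally show ?thesis .
  qed
  then show ?thesis using assms unfolding trig_ann_def by (auto intro!: continuous_intros)
qed

lemma trig_ann_cis:
  assumes "v \<in> trig_ann" shows "(\<lambda>y. v y * cis (of_int k * y)) \<in> trig_ann"
proof -
  have "integral {0..2*pi} (\<lambda>y. v y * cis (of_int k * y) * cis (of_int j * y)) = 0" for j :: int
  proof -
    have "cis (of_int k * y) * cis (of_int j * y) = cis (of_int (k + j) * y)" for y
      by (simp add: cis_mult algebra_simps)
    then have "integral {0..2*pi} (\<lambda>y. v y * cis (of_int k * y) * cis (of_int j * y)) = integral {0..2*pi} (\<lambda>y. v y * cis (of_int (k + j) * y))"
      by (simp only: mult.assoc)
    also have "\<dots> = 0" using assms by (simp only: trig_ann_def mem_Collect_eq)
    finally show ?thesis .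
  qed
  then show ?thesis using assms unfolding trig_ann_def by (auto intro!: continuous_intros)
qed

text \<open>On the circle a real linear functional is a combination of \<open>cis y\<close> and
  \<open>cis (- y)\<close>, so the linear case reduces to two index shifts. Keeping \<open>v\<close>
  arbitrary lets the product case apply the two induction hypotheses in succession.\<close>

lemma trig_ann_poly:
  fixes p :: "complex \<Rightarrow> real"
  assumes "real_polynomial_function p" "v \<in> trig_ann"
  shows "(\<lambda>y. v y * of_real (p (cis y))) \<in> trig_ann"
  using assms
proof (induction arbitrary: v)
  case (linear p)
  have pz: "p z = Re z * p 1 + Im z * p \<i>" for z
  proof -
    interpret bounded_linear p by fact
    have "p z = p (Re z *\<^sub>R 1 + Im z *\<^sub>R \<i>)" by (rule arg_cong[of _ _ p]) (simp add: complex_eq_iff)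
    then show ?thesis by (simp only: add scaleR real_scaleR_def)
  qed
  have "v y * of_real (p (cis y)) = (p 1 / 2 - \<i> * p \<i> / 2) * (v y * cis (of_int 1 * y)) + (p 1 / 2 + \<i> * p \<i> / 2) * (v y * cis (of_int (-1) * y))" for y
  proof -
    have "of_real (p (cis y)) = (p 1 / 2 - \<i> * p \<i> / 2) * cis (of_int 1 * y) + (p 1 / 2 + \<i> * p \<i> / 2) * cis (of_int (-1) * y)"
      unfolding pz[of "cis y"] by (simp add: complex_eq_iff)
    then show ?thesis by (simp only: distrib_left mult.left_commute)
  qed
  then show ?case
    using trig_ann_lincomb[OF trig_ann_cis[OF linear(2), of 1] trig_ann_cis[OF linear(2), of "-1"]] by presburger
next
  case (const c)
  show ?case using trig_ann_lincomb[OF const const, of "of_real c" 0] by (simp add: mult.commute)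
next
  case (add f g)
  show ?case using trig_ann_lincomb[OF add.IH(1)[OF add.prems] add.IH(2)[OF add.prems], of 1 1] by (simp add: algebra_simps)
next
  case (mult f g)
  show ?case using mult.IH(2)[OF mult.IH(1)[OF mult.prems]] by (simp add: mult.assoc)
qed

lemma periodic_int:
  fixes d :: "real \<Rightarrow> complex"
  assumes "\<And>y. d (y + 2*pi) = d y" shows "d (y + 2 * pi * of_int n) = d y"
proof (induction n rule: int_induct[where k = 0])
  case (step1 i)
  then show ?case using assms[of "y + 2 * pi * of_int i"] by (simp add: algebra_simps)
next
  case (step2 i)
  then show ?case using assms[of "y + 2 * pi * of_int (i - 1)"] by (simp add: algebra_simps)
qed simp

text \<open>\<open>Arg2pi\<close> jumps on the positive real axis and \<open>Arg\<close> on the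
  negative one. By periodicity both lift \<open>d\<close> to the same function on the circle, so
  \<open>Arg\<close> can be used near the jump of \<open>Arg2pi\<close>.\<close>

lemma circle_function_continuous:
  fixes d :: "real \<Rightarrow> complex"
  assumes c: "continuous_on UNIV d" and per: "\<And>y. d (y + 2*pi) = d y"
  shows "continuous_on (sphere 0 1) (\<lambda>z. d (Arg2pi z))"
    and "d (Arg2pi (cis y)) = d y"
proof -
  have eq: "d a = d b" if "cis a = cis b" for a b
  proof -
    have "sin a = sin b \<and> cos a = cos b" using that by (simp add: complex_eq_iff)
    then obtain n :: int where "a = b + 2 * pi * n" using sin_cos_eq_iff by blast
    then show ?thesis using periodic_int[of d b n, OF per] by simp
  qed
  have A2: "cis (Arg2pi z) = z" if "norm z = 1" for z
    using Arg2pi[of z] that by (simp add: is_Arg_def cis_conv_exp)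
  show "d (Arg2pi (cis y)) = d y" by (rule eq) (simp add: A2)
  have dc: "isCont d x" for x using c by (simp add: continuous_on_eq_continuous_at)
  show "continuous_on (sphere 0 1) (\<lambda>z. d (Arg2pi z))"
    unfolding continuous_on_eq_continuous_within
  proof
    fix z :: complex assume z: "z \<in> sphere 0 1"
    show "continuous (at z within sphere 0 1) (\<lambda>z. d (Arg2pi z))"
    proof (cases "z \<in> \<real>\<^sub>\<ge>\<^sub>0")
      case False
      then have "isCont (\<lambda>z. d (Arg2pi z)) z"
        by (intro isCont_o2[OF continuous_at_Arg2pi dc])
      then show ?thesis by (rule continuous_at_imp_continuous_at_within)
    next
      case True
      then have "z \<notin> \<real>\<^sub>\<le>\<^sub>0" using z by (auto simp: complex_nonneg_Reals_iff complex_nonpos_Reals_iff complex_eq_iff cmod_def)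
      then have "isCont (\<lambda>z. d (Arg z)) z"
        by (intro isCont_o2[OF continuous_at_Arg dc])
      then have cA: "continuous (at z within sphere 0 1) (\<lambda>z. d (Arg z))" by (rule continuous_at_imp_continuous_at_within)
      have eqA: "d (Arg w) = d (Arg2pi w)" if "w \<in> sphere 0 1" for w
      proof (rule eq)
        have "w \<noteq> 0" "sgn w = w" using that by (auto simp: sgn_div_norm)
        then show "cis (Arg w) = cis (Arg2pi w)" using cis_Arg[of w] A2[of w] that by simp
      qed
      show ?thesis
        by (rule continuous_transform_within[OF cA zero_less_one z]) (rule eqA)
    qed
  qed
qed

text \<open>If a polynomial \<open>g\<close> is uniformly close to the conjugate of \<open>d\<close>
  on the circle, then \<open>d\<close> times \<open>g\<close> integrates to 0 but is close to the
  squared modulus of \<open>d\<close>. Hence the integral of that square is smaller than any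
  positive bound.\<close>

lemma trig_ann_zero:
  fixes d :: "real \<Rightarrow> complex"
  assumes c: "continuous_on UNIV d" and per: "\<And>y. d (y + 2*pi) = d y" and ann: "d \<in> trig_ann" and y: "y \<in> {0..2*pi}"
  shows "d y = 0"
proof -
  define I where "I = integral {0..2*pi} (\<lambda>y. (cmod (d y))\<^sup>2)"
  have cd: "continuous_on {0..2*pi} d" by (rule continuous_on_subset[OF c]) simp
  obtain B where B: "\<And>y. y \<in> {0..2*pi} \<Longrightarrow> norm (d y) \<le> B"
    using compact_imp_bounded[OF compact_continuous_image[OF cd compact_Icc]] unfolding bounded_iff by blast
  have B0: "0 \<le> B" using B[of 0] norm_ge_zero[of "d 0"] by (simp del: norm_ge_zero)
  have cc: "continuous_on UNIV (\<lambda>y. cnj (d y))" by (intro continuous_intros c)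
  note H = circle_function_continuous[OF cc, simplified, OF per]
  have small: "I \<le> e * (2 * pi * B)" if e: "0 < e" for e
  proof -
    obtain g where g: "polynomial_function g" "\<And>z. z \<in> sphere 0 1 \<Longrightarrow> norm (cnj (d (Arg2pi z)) - g z) < e"
      using Stone_Weierstrass_polynomial_function[OF compact_sphere H(1) e] by blast
    have "real_polynomial_function (Re \<circ> g)" "real_polynomial_function (Im \<circ> g)"
      using g(1) bounded_linear_Re bounded_linear_Im unfolding polynomial_function_def by auto
    from trig_ann_lincomb[OF this[THEN trig_ann_poly, OF ann], of 1 \<i>]
    have "(\<lambda>y. d y * g (cis y)) \<in> trig_ann"
      by (simp add: distrib_left[symmetric] mult.left_commute[of \<i>] complex_eq[symmetric])
    then have ga: "integral {0..2*pi} (\<lambda>y. d y * g (cis y)) = 0" and gi: "(\<lambda>y. d y * g (cis y)) integrable_on {0..2*pi}"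
      and gc: "continuous_on {0..2*pi} (\<lambda>y. d y * g (cis y))"
      using trig_ann_integrable[of "\<lambda>y. d y * g (cis y)" 0] unfolding trig_ann_def by (auto dest!: spec[of _ 0])
    have ci: "continuous_on {0..2*pi} (\<lambda>y. d y * cnj (d y))" by (intro continuous_intros cd)
    have "((\<lambda>y. (cmod (d y))\<^sup>2) has_integral I) {0..2*pi}"
      unfolding I_def by (intro integrable_integral integrable_continuous_real continuous_intros cd)
    from has_integral_linear[OF this bounded_linear_of_real[where ?'a = complex]]
    have "complex_of_real I = integral {0..2*pi} (\<lambda>y. of_real ((cmod (d y))\<^sup>2))"
      by (simp add: o_def integral_unique)
    also have "\<dots> = integral {0..2*pi} (\<lambda>y. d y * cnj (d y))" by (simp only: complex_norm_square)
    also have "\<dots> = integral {0..2*pi} (\<lambda>y. d y * cnj (d y) - d y * g (cis y))"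
      using integrable_continuous_real[OF ci] gi ga by (simp add: Henstock_Kurzweil_Integration.integral_diff)
    finally have "norm (complex_of_real I) = norm (integral {0..2*pi} (\<lambda>y. d y * cnj (d y) - d y * g (cis y)))" by simp
    also have "\<dots> \<le> (B * e) * (2 * pi - 0)"
    proof (rule integral_bound)
      show "continuous_on {0..2*pi} (\<lambda>y. d y * cnj (d y) - d y * g (cis y))" by (intro continuous_intros ci gc)
      fix t assume t: "t \<in> {0..2*pi}"
      have "norm (cnj (d t) - g (cis t)) \<le> e" using g(2)[of "cis t"] H(2)[of t] by simp
      then have "norm (d t * (cnj (d t) - g (cis t))) \<le> B * e"
        unfolding norm_mult using B[OF t] B0 by (intro mult_mono) auto
      then show "norm (d t * cnj (d t) - d t * g (cis t)) \<le> B * e" by (simp add: right_diff_distrib)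
    qed simp
    finally show ?thesis by (simp add: mult_ac)
  qed
  have "I \<le> 0"
  proof (rule ccontr)
    assume "\<not> I \<le> 0"
    then have I: "0 < I" by simp
    \<comment> \<open>Chosen so that \<open>small\<close> yields \<open>I \<le> I / 2\<close>; the
      \<open>+ 1\<close> covers \<open>B = 0\<close>.\<close>
    define e where "e = I / (2 * (2 * pi * B + 1))"
    have K: "0 < 2 * pi * B + 1" using B0 by (simp add: add_nonneg_pos)
    have "0 < e" using I K by (simp add: e_def)
    have "e * (2 * pi * B) \<le> e * (2 * pi * B + 1)" using \<open>0 < e\<close> by simp
    also have "\<dots> = I / 2"
    proof -
      have "I / (2 * N) * N = I / 2" if "0 < N" for N using that by simp
      from this[OF K] show ?thesis by (simp only: e_def)
    qed
    finally show False using small[OF \<open>0 < e\<close>] I by simp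
  qed
  moreover have "0 \<le> I" unfolding I_def by (rule Henstock_Kurzweil_Integration.integral_nonneg) (auto intro!: integrable_continuous_real continuous_intros cd)
  ultimately have "I = 0" by simp
  then have "\<forall>x\<in>{0..2*pi}. (cmod (d x))\<^sup>2 = 0"
    unfolding I_def by (subst (asm) integral_eq_0_iff) (auto intro!: continuous_intros cd)
  then show ?thesis using y by auto
qed

text \<open>Absolutely summable coefficients define a continuous periodic sum, and termwise
  integration shows that it has the right coefficients. Its difference from \<open>h\<close> then
  lies in \<open>trig_ann\<close> and vanishes. The factor \<open>2 * pi\<close> stems from the
  missing normalisation in \<open>fc\<close>.\<close>

lemma fourier_inversion:
  assumes c: "continuous_on UNIV h" and per: "\<And>y. h (y + 2*pi) = h y"
    and M: "\<And>j. norm (fc h j) \<le> M j" "M summable_on UNIV" and y: "y \<in> {0..2*pi}"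
  shows "((\<lambda>j. fc h j * cis (of_int j * y)) has_sum 2 * of_real pi * h y) UNIV"
proof -
  define S where "S y = Sser 0 (\<lambda>j _. fc h j) (0, y)" for y
  have hs: "((\<lambda>j. fc h j * cis (of_int j * y)) has_sum S y) UNIV" for y
    using Sser_has_sum[of "\<lambda>j _. fc h j" "(0,y)" M 0] M by (simp add: S_def mode0)
  have Sc: "continuous_on UNIV S"
    unfolding S_def by (rule continuous_on_compose2[OF Sser_continuous[where M = M]]) (use M in \<open>auto intro!: continuous_intros\<close>)
  have Sper: "S (y + 2*pi) = S y" for y
  proof -
    have "cis (of_int j * (y + 2*pi)) = cis (of_int j * y)" for j :: int
    proof -
      have "cis (of_int j * (2 * pi)) = 1" using cis_multiple_2pi[of "of_int j"] by (simp add: mult_ac)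
      then show ?thesis by (simp add: distrib_left cis_mult[symmetric])
    qed
    then show ?thesis using hs[of "y + 2*pi"] hs[of y] by (simp add: has_sum_unique)
  qed
  define d where "d y = 2 * of_real pi * h y - S y" for y
  have dc: "continuous_on UNIV d" unfolding d_def by (intro continuous_intros c Sc)
  have c01: "continuous_on {0..2*pi} h" "continuous_on {0..2*pi} S"
    using continuous_on_subset[OF c] continuous_on_subset[OF Sc] by auto
  have "integral {0..2*pi} (\<lambda>y. d y * cis (of_int k * y)) = 0" for k :: int
  proof -
    have "((\<lambda>j. integral (cbox 0 (2*pi)) (\<lambda>y. fc h j * cis (of_int j * y) * cis (of_int k * y))) has_sum
        integral (cbox 0 (2*pi)) (\<lambda>y. S y * cis (of_int k * y))) UNIV"
      by (rule has_sum_integral[where M = M])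
         (use M in \<open>auto intro!: continuous_intros has_sum_cmult_left hs simp: norm_mult\<close>)
    moreover have "integral (cbox 0 (2*pi)) (\<lambda>y. fc h j * cis (of_int j * y) * cis (of_int k * y)) = (if j = - k then 2 * of_real pi * fc h (-k) else 0)" for j
    proof -
      have "cis (of_int j * y) * cis (of_int k * y) = cis (of_int (j + k) * y)" for y
        by (simp add: cis_mult algebra_simps)
      then have "integral (cbox 0 (2*pi)) (\<lambda>y. fc h j * cis (of_int j * y) * cis (of_int k * y)) = fc h j * integral {0..2*pi} (\<lambda>y. cis (of_int (j + k) * y))"
        by (simp add: mult.assoc)
      then show ?thesis unfolding integral_cis_int by auto
    qed
    ultimately have "((\<lambda>j. if j = - k then 2 * of_real pi * fc h (-k) else 0) has_sum integral {0..2*pi} (\<lambda>y. S y * cis (of_int k * y))) UNIV"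
      by simp
    moreover have "((\<lambda>j. if j = - k then 2 * of_real pi * fc h (-k) else 0) has_sum 2 * of_real pi * fc h (-k)) UNIV"
      using has_sum_finite_neutralI[of "{-k}" UNIV "\<lambda>j. if j = - k then 2 * of_real pi * fc h (-k) else 0"] by simp
    ultimately have SI: "integral {0..2*pi} (\<lambda>y. S y * cis (of_int k * y)) = 2 * of_real pi * fc h (-k)"
      by (rule has_sum_unique)
    have "integral {0..2*pi} (\<lambda>y. d y * cis (of_int k * y)) = integral {0..2*pi} (\<lambda>y. 2 * of_real pi * (cis (- (of_int (-k) * y)) * h y) - S y * cis (of_int k * y))"
      by (simp add: d_def algebra_simps)
    also have "\<dots> = 2 * of_real pi * fc h (-k) - integral {0..2*pi} (\<lambda>y. S y * cis (of_int k * y))"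
      unfolding fc_def integral_mult_right[symmetric]
      by (intro Henstock_Kurzweil_Integration.integral_diff integrable_continuous_real continuous_intros c01)
    finally show ?thesis using SI by simp
  qed
  then have "d \<in> trig_ann" unfolding trig_ann_def using continuous_on_subset[OF dc] by auto
  then have "d y = 0" by (rule trig_ann_zero[OF dc _ _ y, rotated]) (simp add: d_def per Sper)
  then show ?thesis using hs[of y] by (simp add: d_def)
qed

section \<open>Decay of the Fourier coefficients of the potential\<close>

locale smooth_potential =
  fixes f :: "real \<times> real \<Rightarrow> real" and R :: real
  assumes f_smooth: "smooth2 f"
    and f_per: "\<And>x y. f (x, y + 2*pi) = f (x, y)"
    and R_pos: "R > 0"
    and f_supp: "\<And>x y. \<bar>x\<bar> > R \<Longrightarrow> f (x, y) = 0"
begin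

lemma f_continuous: "continuous_on UNIV f"
  using f_smooth unfolding smooth2_def by blast

lemma fcoef_fc: "fcoef f j x = fc (\<lambda>y. of_real (f (x, y))) j"
  by (simp add: fcoef_def fc_def)

lemma fcoef_supp: "\<bar>x\<bar> > R \<Longrightarrow> fcoef f j x = 0"
  using f_supp by (simp add: fcoef_def)

lemma fcoef_continuous: "continuous_on UNIV (fcoef f j)"
proof -
  have "continuous_on (UNIV \<times> cbox 0 (2*pi)) (\<lambda>(x, y). cis (- (of_int j * y)) * of_real (f (x, y)) :: complex)"
    unfolding case_prod_unfold
    by (intro continuous_intros continuous_on_compose2[OF f_continuous]) auto
  from integral_continuous_on_param[OF this] show ?thesis
    by (simp add: fcoef_def[abs_def])
qed

text \<open>Five integrations by parts in \<open>y\<close>; periodicity of the derivatives removes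
  the boundary terms. The order is 5 because the weight \<open>wt\<close> uses up three powers and
  two must remain for summability.\<close>

lemma fcoef_decay:
  obtains C where "0 \<le> C" "\<And>j x. norm (fcoef f j x) \<le> C / (1 + \<bar>of_int j\<bar>)^5"
proof -
  obtain D where D00: "D 0 0 = f" and D: "\<forall>i j. continuous_on UNIV (D i j) \<and>
        (\<forall>x y. ((\<lambda>t. D i j (t, y)) has_vector_derivative D (Suc i) j (x, y)) (at x) \<and>
               ((\<lambda>t. D i j (x, t)) has_vector_derivative D i (Suc j) (x, y)) (at y))"
    using f_smooth unfolding smooth2_def by blast
  have Dc: "\<And>i j. continuous_on UNIV (D i j)"
    and Dy: "\<And>i j x y. ((\<lambda>t. D i j (x, t)) has_vector_derivative D i (Suc j) (x, y)) (at y)"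
    using D by blast+
  \<comment> \<open>The assumptions speak of \<open>f\<close>; periodicity and support pass to each
    derivative in \<open>y\<close> by uniqueness of derivatives.\<close>
  have Dper: "D 0 k (x, y + 2*pi) = D 0 k (x, y)" for k x y
  proof (induction k arbitrary: y)
    case (Suc k)
    have "((\<lambda>t. D 0 k (x, t)) \<circ> (\<lambda>t. t + 2*pi) has_vector_derivative 1 *\<^sub>R D 0 (Suc k) (x, y + 2*pi)) (at y)"
      by (rule vector_diff_chain_at[OF _ Dy]) (auto intro!: derivative_eq_intros)
    then have "((\<lambda>t. D 0 k (x, t)) has_vector_derivative D 0 (Suc k) (x, y + 2*pi)) (at y)"
      by (simp add: o_def Suc.IH)
    then show ?case using Dy vector_derivative_unique_at by blast
  qed (simp add: D00 f_per)
  have Dsupp: "D 0 k (x, y) = 0" if "\<bar>x\<bar> > R" for k x y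
  proof (induction k arbitrary: y)
    case (Suc k)
    have "((\<lambda>t. D 0 k (x, t)) has_vector_derivative 0) (at y)"
      by (simp add: Suc.IH)
    then show ?case using Dy vector_derivative_unique_at by blast
  qed (simp add: D00 f_supp that)
  have "\<exists>B. \<forall>p \<in> {-R..R} \<times> {0..2*pi}. norm (D 0 k p) \<le> B" for k
    using compact_imp_bounded[OF compact_continuous_image[OF continuous_on_subset[OF Dc subset_UNIV] compact_Times[OF compact_Icc compact_Icc]]]
    unfolding bounded_iff by (metis image_eqI)
  then obtain B where B: "\<And>k p. p \<in> {-R..R} \<times> {0..2*pi} \<Longrightarrow> norm (D 0 k p) \<le> B k" by metis
  \<comment> \<open>Order 0 serves the coefficient \<open>j = 0\<close>, order 5 all the
    others.\<close>
  define b where "b = max (B 0) (B 5)"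
  have b0: "0 \<le> b" using B[of "(0,0)" 0] R_pos norm_ge_zero[of "D 0 0 (0,0)"] by (auto simp: b_def)
  have bd: "norm (of_real (D 0 k (x, y)) :: complex) \<le> b" if "y \<in> {0..2*pi}" "k = 0 \<or> k = 5" for k x y
  proof (cases "\<bar>x\<bar> > R")
    case True
    then show ?thesis using Dsupp b0 by simp
  next
    case False
    then have "norm (D 0 k (x, y)) \<le> B k" using that by (intro B) auto
    then show ?thesis using that(2) by (auto simp: b_def)
  qed
  have Dc1: "continuous_on UNIV (\<lambda>y. of_real (D 0 k (x, y)) :: complex)" for k x
    by (intro continuous_intros continuous_on_compose2[OF Dc]) auto
  let ?h = "\<lambda>x k y. of_real (D 0 k (x, y)) :: complex"
  have step: "\<i> * of_int j * fc (?h x k) j = fc (?h x (Suc k)) j" for j x k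
  proof (rule fc_deriv[OF _ Dc1])
    show "(?h x k has_vector_derivative ?h x (Suc k) y) (at y)" for y
      by (intro has_vector_derivative_of_real) (simp add: Dy has_real_derivative_iff_has_vector_derivative)
    show "?h x k (2*pi) = ?h x k 0" using Dper[of k x 0] by simp
  qed
  have pow: "(\<i> * of_int j) ^ k * fc (?h x 0) j = fc (?h x k) j" for j x k
    by (induction k) (simp_all add: step[symmetric] mult_ac)
  \<comment> \<open>The 32 is \<open>2^5\<close>, from \<open>1 + |j| \<le> 2 * |j|\<close> for
    nonzero \<open>j\<close>.\<close>
  have main: "norm (fcoef f j x) \<le> 2 * pi * b * 32 / (1 + \<bar>of_int j\<bar>)^5" for j x
  proof (cases "j = 0")
    case True
    have "norm (fc (?h x 0) j) \<le> 2 * pi * b" by (rule fc_bound[OF Dc1 bd]) auto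
    also have "\<dots> \<le> 2 * pi * b * 32" using b0 by simp
    finally show ?thesis using True by (simp add: fcoef_fc D00)
  next
    case False
    have j1: "1 \<le> \<bar>real_of_int j\<bar>" using False by linarith
    have "norm ((\<i> * of_int j) ^ 5 * fc (?h x 0) j) \<le> 2 * pi * b"
      unfolding pow by (rule fc_bound[OF Dc1 bd]) auto
    then have 1: "\<bar>real_of_int j\<bar>^5 * norm (fcoef f j x) \<le> 2 * pi * b"
      by (simp add: norm_mult norm_power fcoef_fc D00)
    have "(1 + \<bar>real_of_int j\<bar>)^5 \<le> (2 * \<bar>real_of_int j\<bar>)^5"
      using j1 by (intro power_mono) auto
    then have "(1 + \<bar>real_of_int j\<bar>)^5 * norm (fcoef f j x) \<le> (2 * \<bar>real_of_int j\<bar>)^5 * norm (fcoef f j x)"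
      by (rule mult_right_mono) simp
    also have "\<dots> = 32 * (\<bar>real_of_int j\<bar>^5 * norm (fcoef f j x))" by (simp add: power_mult_distrib)
    also have "\<dots> \<le> 32 * (2 * pi * b)" using 1 by (rule mult_left_mono) simp
    finally have "(1 + \<bar>real_of_int j\<bar>)^5 * norm (fcoef f j x) \<le> 2 * pi * b * 32" by (simp only: mult_ac)
    then show ?thesis by (simp add: field_simps)
  qed
  show thesis by (rule that[OF _ main]) (use b0 in simp)
qed

end

lemma summable_inverse_square_int: "(\<lambda>j::int. 1 / (1 + \<bar>of_int j\<bar>)\<^sup>2 :: real) summable_on UNIV"
proof -
  let ?g = "\<lambda>j::int. 1 / (1 + \<bar>of_int j\<bar>)\<^sup>2 :: real"
  have "summable (\<lambda>n. 1 / (real (Suc n))\<^sup>2)"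
    using inverse_power_summable[of 2] by (subst summable_Suc_iff[where f = "\<lambda>n. 1 / (real n)\<^sup>2"]) (simp add: inverse_eq_divide)
  then have s: "(\<lambda>n. 1 / (1 + real n)\<^sup>2) summable_on UNIV"
    by (intro summable_nonneg_imp_summable_on) (auto simp: add.commute)
  have 1: "?g summable_on (range int)"
    using s by (subst summable_on_reindex) (auto simp: o_def)
  have 2: "?g summable_on (range (\<lambda>n. - int n))"
    using s by (subst summable_on_reindex) (auto simp: o_def inj_on_def)
  have "UNIV = range int \<union> range (\<lambda>n. - int n)"
    by (auto simp: image_iff) (metis int_cases2)
  then show ?thesis using summable_on_union[OF 1 2] by simp
qed

subsection \<open>The resolvent\<close>

locale scattering_data = smooth_potential +
  fixes \<beta> :: real
  assumes \<beta>: "0 < \<beta>" "\<beta> < 1/2"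
begin

text \<open>The precise meaning of small \<open>\<mu>\<close>. The bounds together give
  \<open>\<mu>\<^sup>2 \<le> (1 - 2 * \<beta>) / 2\<close>, which keeps \<open>k0\<close> away from
  0 uniformly, and \<open>\<mu> < 1/2\<close> puts \<open>\<mu>\<close> below
  \<open>1 - \<beta>\<close>, so that \<open>gam\<close> is nonnegative.\<close>

definition adm :: "real \<Rightarrow> bool" where
  "adm \<mu> \<longleftrightarrow> 0 < \<mu> \<and> \<mu> < 1/2 \<and> \<mu> < (1 - 2*\<beta>) / 2"

text \<open>With this sign at \<open>n = 0\<close> the outgoing kernel \<open>G\<^sub>0\<close> is the decaying kernel at an imaginary exponent.\<close>

definition kap :: "real \<Rightarrow> int \<Rightarrow> complex" where
  "kap \<mu> n = (if n = 0 then - \<i> * of_real (k0 \<beta> \<mu>) else of_real (km \<beta> \<mu> n))"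

lemma mu_square_le: "adm \<mu> \<Longrightarrow> \<mu>\<^sup>2 \<le> (1 - 2*\<beta>) / 2"
  unfolding adm_def power2_eq_square using mult_mono[of \<mu> 1 \<mu> "(1 - 2*\<beta>) / 2"] by auto

lemma k0_square: "adm \<mu> \<Longrightarrow> (k0 \<beta> \<mu>)\<^sup>2 = 1 - 2*\<beta> - \<mu>\<^sup>2"
  using mu_square_le[of \<mu>] \<beta> unfolding k0_def by simp

lemma k0_lower: "adm \<mu> \<Longrightarrow> sqrt ((1 - 2*\<beta>) / 2) \<le> k0 \<beta> \<mu>"
  using mu_square_le[of \<mu>] unfolding k0_def by simp

lemma k0_pos: "adm \<mu> \<Longrightarrow> 0 < k0 \<beta> \<mu>"
  by (rule less_le_trans[OF _ k0_lower]) (use \<beta> in auto)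

text \<open>Equality holds at \<open>n = -1\<close>, the threshold mode, whose exponent is exactly
  \<open>\<mu>\<close>.\<close>

lemma frequency_gap:
  assumes "n \<noteq> 0" shows "(1 - \<beta>)\<^sup>2 \<le> (\<beta> + of_int n)\<^sup>2"
proof -
  have "\<bar>1 - \<beta>\<bar> \<le> \<bar>\<beta> + of_int n\<bar>"
  proof (cases "n \<ge> 1")
    case True
    then have "1 \<le> real_of_int n" by simp
    then show ?thesis using \<beta> by linarith
  next
    case False
    then have "n \<le> -1" using assms by linarith
    then have "real_of_int n \<le> -1" by linarith
    then show ?thesis using \<beta> by linarith
  qed
  then show ?thesis by (simp add: abs_le_square_iff)
qed

text \<open>The nearest competitors are \<open>n = 1\<close>, with gap exactly
  \<open>4 * \<beta>\<close>, and \<open>n = -2\<close>, with gap \<open>3 - 2 * \<beta>\<close>,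
  which is larger as \<open>\<beta> < 1/2\<close>. This keeps \<open>km\<close> away from 0
  independently of \<open>\<mu>\<close>.\<close>

lemma frequency_gap':
  assumes "n \<noteq> 0" "n \<noteq> -1" shows "4 * \<beta> \<le> (\<beta> + of_int n)\<^sup>2 - (1 - \<beta>)\<^sup>2"
proof (cases "n \<ge> 1")
  case True
  then have "\<bar>1 + \<beta>\<bar> \<le> \<bar>\<beta> + of_int n\<bar>" using \<beta> by simp
  then have "(1 + \<beta>)\<^sup>2 \<le> (\<beta> + of_int n)\<^sup>2" by (simp add: abs_le_square_iff)
  then show ?thesis by (simp add: power2_eq_square algebra_simps)
next
  case False
  then have "n \<le> -2" using assms by linarith
  then have "real_of_int n \<le> -2" by linarith
  then have "\<bar>2 - \<beta>\<bar> \<le> \<bar>\<beta> + of_int n\<bar>" using \<beta> by linarith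
  then have "(2 - \<beta>)\<^sup>2 \<le> (\<beta> + of_int n)\<^sup>2" by (simp add: abs_le_square_iff)
  then show ?thesis using \<beta> by (simp add: power2_eq_square algebra_simps)
qed

lemma km_square: "n \<noteq> 0 \<Longrightarrow> (km \<beta> \<mu> n)\<^sup>2 = (\<beta> + of_int n)\<^sup>2 - (1 - \<beta>)\<^sup>2 + \<mu>\<^sup>2"
  using frequency_gap[of n] unfolding km_def by simp

lemma km_lower: "adm \<mu> \<Longrightarrow> n \<noteq> 0 \<Longrightarrow> \<mu> \<le> km \<beta> \<mu> n"
  using frequency_gap[of n] unfolding km_def adm_def by (intro real_le_rsqrt) simp

lemma km_lower': "n \<noteq> 0 \<Longrightarrow> n \<noteq> -1 \<Longrightarrow> sqrt (4 * \<beta>) \<le> km \<beta> \<mu> n"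
  using frequency_gap'[of n] unfolding km_def by (intro real_sqrt_le_mono) (simp add: add_increasing2)

lemma km_minus1: "adm \<mu> \<Longrightarrow> km \<beta> \<mu> (-1) = \<mu>"
  unfolding km_def adm_def by (simp add: power2_commute)

lemma kap_nonzero: "adm \<mu> \<Longrightarrow> kap \<mu> n \<noteq> 0"
  using k0_pos[of \<mu>] km_lower[of \<mu> n] by (auto simp: kap_def adm_def)

lemma kap_square:
  assumes "adm \<mu>" shows "(kap \<mu> n)\<^sup>2 = of_real ((\<beta> + of_int n)\<^sup>2 - ((1 - \<beta>)\<^sup>2 - \<mu>\<^sup>2))"
proof (cases "n = 0")
  case True
  have "(kap \<mu> n)\<^sup>2 = of_real (- ((k0 \<beta> \<mu>)\<^sup>2))" using True by (simp add: kap_def power_mult_distrib)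
  also have "- ((k0 \<beta> \<mu>)\<^sup>2) = (\<beta> + of_int n)\<^sup>2 - ((1 - \<beta>)\<^sup>2 - \<mu>\<^sup>2)"
    unfolding k0_square[OF assms] using True by (simp add: power2_eq_square algebra_simps)
  finally show ?thesis .
next
  case False
  then have "(kap \<mu> n)\<^sup>2 = of_real ((km \<beta> \<mu> n)\<^sup>2)" by (simp add: kap_def)
  then show ?thesis using km_square[OF False, of \<mu>] by (simp add: algebra_simps)
qed

lemma Gr_gk:
  assumes "adm \<mu>" shows "Gr \<beta> \<mu> n = gk (kap \<mu> n)"
proof
  fix x
  have k: "k0 \<beta> \<mu> \<noteq> 0" using k0_pos[OF assms] by simp
  consider "n = 0" | "n = -1" | "n \<noteq> 0" "n \<noteq> -1" by blast
  then show "Gr \<beta> \<mu> n x = gk (kap \<mu> n) x"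
  proof cases
    case 1
    have "\<i> / (2 * of_real (k0 \<beta> \<mu>)) = 1 / (2 * (- \<i> * of_real (k0 \<beta> \<mu>)))"
      using k by (simp add: field_simps)
    then show ?thesis using 1 by (simp add: Gr_def gk_def kap_def cis_conv_exp mult.assoc)
  next
    case 2
    then show ?thesis using km_minus1[OF assms] by (simp add: Gr_def gk_def kap_def flip: exp_of_real)
  next
    case 3
    then show ?thesis by (simp add: Gr_def gk_def kap_def flip: exp_of_real)
  qed
qed

text \<open>A bound uniform in \<open>\<mu>\<close>: subtracting the constant from \<open>G\<^bsub>-1\<^esub>\<close> leaves a kernel bounded by \<open>|x|/2\<close>.\<close>

definition hb :: real where
  "hb = 1 / (2 * sqrt ((1 - 2*\<beta>) / 2)) + R + 1 / (2 * sqrt (4 * \<beta>))"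

lemma hb_nonneg: "0 \<le> hb"
  using \<beta> R_pos by (simp add: hb_def)

text \<open>Two points of the support are at most \<open>2 * R\<close> apart, so half the distance
  contributes the summand \<open>R\<close> of \<open>hb\<close>. The other two summands come from
  the lower bounds for \<open>k0\<close> and \<open>km\<close>.\<close>

lemma Hr_bound:
  assumes \<mu>: "adm \<mu>" and x: "\<bar>x\<bar> \<le> 2 * R"
  shows "norm (Hr \<beta> \<mu> n x) \<le> hb"
proof -
  have p: "0 < sqrt ((1 - 2*\<beta>) / 2)" "0 < sqrt (4 * \<beta>)" "0 < \<mu>" using \<beta> \<mu> by (auto simp: adm_def)
  have t: "0 \<le> 1 / (2 * sqrt ((1 - 2*\<beta>) / 2))" "0 \<le> 1 / (2 * sqrt (4 * \<beta>))" using p by auto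
  consider "n = 0" | "n = -1" | "n \<noteq> 0" "n \<noteq> -1" by blast
  then show ?thesis
  proof cases
    case 1
    have "norm (Hr \<beta> \<mu> n x) = 1 / (2 * k0 \<beta> \<mu>)"
      using 1 k0_pos[OF \<mu>] by (simp add: Hr_def Gr_def norm_mult norm_divide)
    also have "\<dots> \<le> 1 / (2 * sqrt ((1 - 2*\<beta>) / 2))"
      using k0_lower[OF \<mu>] p by (intro divide_left_mono mult_pos_pos k0_pos[OF \<mu>]) auto
    finally show ?thesis unfolding hb_def using t R_pos by linarith
  next
    case 2
    have "1 - \<mu> * \<bar>x\<bar> \<le> exp (- \<mu> * \<bar>x\<bar>)" using exp_ge_add_one_self[of "- \<mu> * \<bar>x\<bar>"] by simp
    moreover have "exp (- \<mu> * \<bar>x\<bar>) \<le> 1" using p by simp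
    ultimately have "\<bar>exp (- \<mu> * \<bar>x\<bar>) - 1\<bar> \<le> \<mu> * \<bar>x\<bar>" by linarith
    then have "\<bar>exp (- \<mu> * \<bar>x\<bar>) - 1\<bar> / (2 * \<mu>) \<le> \<mu> * \<bar>x\<bar> / (2 * \<mu>)" using p by (intro divide_right_mono) auto
    also have "\<dots> = \<bar>x\<bar> / 2" using p by simp
    finally have le: "\<bar>exp (- \<mu> * \<bar>x\<bar>) - 1\<bar> / (2 * \<mu>) \<le> \<bar>x\<bar> / 2" .
    have "norm (Hr \<beta> \<mu> n x) = \<bar>(exp (- \<mu> * \<bar>x\<bar>) - 1) / (2 * \<mu>)\<bar>"
      unfolding Hr_def using 2 by (simp only: if_True refl norm_of_real)
    also have "\<dots> = \<bar>exp (- \<mu> * \<bar>x\<bar>) - 1\<bar> / (2 * \<mu>)" using p by (simp add: abs_divide)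
    finally have "norm (Hr \<beta> \<mu> n x) \<le> R" using le x by linarith
    then show ?thesis unfolding hb_def using t by linarith
  next
    case 3
    have km: "sqrt (4 * \<beta>) \<le> km \<beta> \<mu> n" "0 < km \<beta> \<mu> n"       using km_lower'[OF 3, of \<mu>] less_le_trans[OF p(2) km_lower'[OF 3, of \<mu>]] by auto
    have "norm (Hr \<beta> \<mu> n x) = exp (- km \<beta> \<mu> n * \<bar>x\<bar>) / (2 * km \<beta> \<mu> n)"
      using 3 km by (simp add: Hr_def Gr_def norm_divide norm_mult)
    also have "\<dots> \<le> 1 / (2 * sqrt (4 * \<beta>))"
    proof (rule frac_le)
      show "exp (- km \<beta> \<mu> n * \<bar>x\<bar>) \<le> 1" using km(2) by simp
    qed (use km p in simp_all)
    finally show ?thesis unfolding hb_def using t R_pos by linarith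
  qed
qed

lemma Hr_continuous:
  assumes "adm \<mu>" shows "continuous_on UNIV (Hr \<beta> \<mu> n)"
proof (cases "n = -1")
  case True
  have "Hr \<beta> \<mu> n = (\<lambda>x. of_real ((exp (- \<mu> * \<bar>x\<bar>) - 1) / (2 * \<mu>)))"
    by (rule ext) (simp only: Hr_def True refl if_True)
  moreover have "continuous_on UNIV (\<lambda>x. of_real ((exp (- \<mu> * \<bar>x\<bar>) - 1) / (2 * \<mu>)) :: complex)"
    by (intro continuous_intros) (use assms in \<open>simp add: adm_def\<close>)
  ultimately show ?thesis by simp
next
  case False
  have "Hr \<beta> \<mu> n = Gr \<beta> \<mu> n" by (rule ext) (simp only: Hr_def False if_False)
  then show ?thesis by (simp only: Gr_gk[OF assms] continuous_gk)
qed

section \<open>Weighted sup norms and the bound for the operator\<close>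

text \<open>Chosen once from the potential alone, so that the operator bound built from it depends
  on neither \<open>\<epsilon>\<close> nor \<open>\<mu>\<close>.\<close>

definition Cf :: real where
  "Cf = (SOME C. 0 \<le> C \<and> (\<forall>j x. norm (fcoef f j x) \<le> C / (1 + \<bar>of_int j\<bar>)^5))"

lemma Cf: "0 \<le> Cf" "norm (fcoef f j x) \<le> Cf / (1 + \<bar>of_int j\<bar>)^5"
proof -
  have "\<exists>C. 0 \<le> C \<and> (\<forall>j x. norm (fcoef f j x) \<le> C / (1 + \<bar>of_int j\<bar>)^5)"
    using fcoef_decay by metis
  then have "0 \<le> Cf \<and> (\<forall>j x. norm (fcoef f j x) \<le> Cf / (1 + \<bar>of_int j\<bar>)^5)"
    unfolding Cf_def by (rule someI_ex)
  then show "0 \<le> Cf" "norm (fcoef f j x) \<le> Cf / (1 + \<bar>of_int j\<bar>)^5" by auto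
qed

text \<open>The exponent is the least integer for which \<open>(1 + |m|) / wt m\<close> is summable.\<close>

definition wt :: "int \<Rightarrow> real" where "wt m = (1 + \<bar>of_int m\<bar>)^3"
definition sq :: "int \<Rightarrow> real" where "sq j = 1 / (1 + \<bar>of_int j\<bar>)\<^sup>2"

lemma wt_pos: "0 < wt m" "1 \<le> wt m"
  unfolding wt_def by (auto intro!: zero_less_power add_pos_nonneg one_le_power)

text \<open>From \<open>1 + |m| \<le> (1 + |n|) * (1 + |m - n|)\<close>. Submultiplicativity is what
  lets convolution with decaying coefficients act on the weighted space.\<close>

lemma wt_submult: "wt m \<le> wt n * wt (m - n)"
proof -
  have "\<bar>real_of_int m\<bar> \<le> \<bar>real_of_int n\<bar> + \<bar>real_of_int (m - n)\<bar>" by simp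
  moreover have "0 \<le> \<bar>real_of_int n\<bar> * \<bar>real_of_int (m - n)\<bar>" by simp
  ultimately have "1 + \<bar>real_of_int m\<bar> \<le> (1 + \<bar>real_of_int n\<bar>) * (1 + \<bar>real_of_int (m - n)\<bar>)"
    unfolding distrib_left distrib_right by linarith
  then show ?thesis unfolding wt_def power_mult_distrib[symmetric] by (intro power_mono) auto
qed

text \<open>Five powers of decay minus the three of the weight leave the summable inverse
  square.\<close>

lemma wt_fcoef: "wt j * norm (fcoef f j x) \<le> Cf * sq j"
proof -
  define t where "t = 1 + \<bar>real_of_int j\<bar>"
  have t: "0 < t" by (simp add: t_def)
  have "wt j * norm (fcoef f j x) \<le> t^3 * (Cf / t^5)"
    using Cf(2)[of j x] t unfolding wt_def t_def by (intro mult_left_mono) auto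
  also have "\<dots> = Cf * sq j" using t unfolding sq_def t_def[symmetric] by (simp add: field_simps power_numeral_reduce)
  finally show ?thesis .
qed

lemma sq_nonneg: "0 \<le> sq j" by (simp add: sq_def)

lemma sq_summable: "sq summable_on UNIV"
  using summable_inverse_square_int by (simp add: sq_def[abs_def])

lemma sq_shift: "(\<lambda>n. sq (m - n)) summable_on UNIV" "infsum (\<lambda>n. sq (m - n)) UNIV = infsum sq UNIV"
proof -
  have "bij_betw (\<lambda>n. m - n) UNIV UNIV"
    by (rule bij_betwI[where g = "\<lambda>n. m - n"]) auto
  then show "(\<lambda>n. sq (m - n)) summable_on UNIV" "infsum (\<lambda>n. sq (m - n)) UNIV = infsum sq UNIV"
    using summable_on_reindex_bij_betw[of "\<lambda>n. m - n" UNIV UNIV sq] infsum_reindex_bij_betw[of "\<lambda>n. m - n" UNIV UNIV sq] sq_summable by auto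
qed

text \<open>The factor 4 is 2 from the definition of \<open>Top\<close> times 2 from the length
  \<open>2 * R\<close> of the support; \<open>gam\<close> is estimated by 1.\<close>

definition Tnorm :: real where "Tnorm = 4 * R * hb * Cf * infsum sq UNIV"

lemma Tnorm_nonneg: "0 \<le> Tnorm"
  unfolding Tnorm_def using R_pos hb_nonneg Cf(1) by (auto intro!: mult_nonneg_nonneg infsum_nonneg sq_nonneg)

lemma gam_bounds: "adm \<mu> \<Longrightarrow> 0 \<le> gam \<mu> \<beta> \<and> gam \<mu> \<beta> \<le> 1"
proof -
  assume \<mu>: "adm \<mu>"
  then have "\<mu>\<^sup>2 \<le> (1 - \<beta>)\<^sup>2" using \<beta> by (intro power_mono) (auto simp: adm_def)
  moreover have "(1 - \<beta>)\<^sup>2 - \<mu>\<^sup>2 \<le> 1" using \<beta> power_le_one[of "1 - \<beta>" 2] zero_le_power2[of \<mu>] by linarith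
  moreover have "1 \<le> 4 * pi" using pi_gt3 by simp
  ultimately show ?thesis unfolding gam_def by (simp add: divide_le_eq)
qed

definition supp_seq :: "(int \<Rightarrow> real \<Rightarrow> complex) \<Rightarrow> bool" where
  "supp_seq A \<longleftrightarrow> (\<forall>n. continuous_on {-R..R} (A n) \<and> (\<forall>x. x \<notin> {-R..R} \<longrightarrow> A n x = 0))"

lemma supp_seqD: "supp_seq A \<Longrightarrow> continuous_on {-R..R} (A n)" "supp_seq A \<Longrightarrow> x \<notin> {-R..R} \<Longrightarrow> A n x = 0"
  by (auto simp: supp_seq_def)

text \<open>Instantiated by \<open>wt\<close> for existence with decay and by the constant 1 for
  uniqueness among bounded sequences; the operator bound is the same for both.\<close>

definition weight :: "(int \<Rightarrow> real) \<Rightarrow> bool" where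
  "weight v \<longleftrightarrow> (\<forall>m n. 0 < v n \<and> v m \<le> v n * wt (m - n))"

lemma weight_wt: "weight wt" unfolding weight_def using wt_pos wt_submult by blast
lemma weight_1: "weight (\<lambda>_. 1)" unfolding weight_def using wt_pos by simp

lemma Top_term_bound:
  assumes \<mu>: "adm \<mu>" and A: "supp_seq A" and v: "weight v" and a: "0 \<le> a" "\<And>n x. norm (A n x) \<le> a / v n"
  shows "norm (conv (Hr \<beta> \<mu> n) (A n) x * fcoef f (m - n) x) \<le> 2 * R * hb * a / v m * Cf * sq (m - n)"
proof (cases "\<bar>x\<bar> > R")
  case True
  have "0 < v m" using v unfolding weight_def by blast
  then show ?thesis using fcoef_supp[OF True] R_pos hb_nonneg a Cf(1) sq_nonneg by simp
next
  case False
  have vp: "0 < v k" for k using v unfolding weight_def by blast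
  have c: "norm (conv (Hr \<beta> \<mu> n) (A n) x) \<le> 2 * R * (hb * (a / v n))"
  proof (rule conv_bound[OF supp_seqD(1)[OF A] Hr_continuous[OF \<mu>]])
    show "A n x = 0" if "x \<notin> {-R..R}" for x by (rule supp_seqD(2)[OF A that])
    fix \<xi> assume "\<xi> \<in> {-R..R}"
    then have "\<bar>x - \<xi>\<bar> \<le> 2 * R" using False by auto
    then show "norm (Hr \<beta> \<mu> n (x - \<xi>) * A n \<xi>) \<le> hb * (a / v n)"
      unfolding norm_mult by (intro mult_mono Hr_bound \<mu> a hb_nonneg) auto
  qed (use R_pos in simp)
  \<comment> \<open>The weight at \<open>n\<close> is exchanged for the weight at \<open>m\<close>;
    the price \<open>wt (m - n)\<close> is absorbed by the decay of \<open>fcoef\<close>.\<close>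
  have "v m \<le> v n * wt (m - n)" using v unfolding weight_def by blast
  then have w: "1 / v n \<le> wt (m - n) / v m" using vp[of m] vp[of n] by (simp add: field_simps)
  have "norm (conv (Hr \<beta> \<mu> n) (A n) x * fcoef f (m - n) x) \<le> 2 * R * (hb * (a / v n)) * norm (fcoef f (m - n) x)"
    unfolding norm_mult by (rule mult_right_mono[OF c]) simp
  also have "\<dots> = 2 * R * hb * a * norm (fcoef f (m - n) x) * (1 / v n)" by simp
  also have "\<dots> \<le> 2 * R * hb * a * norm (fcoef f (m - n) x) * (wt (m - n) / v m)"
    using R_pos hb_nonneg a w by (intro mult_left_mono) auto
  also have "\<dots> = 2 * R * hb * a / v m * (wt (m - n) * norm (fcoef f (m - n) x))" by simp
  also have "\<dots> \<le> 2 * R * hb * a / v m * (Cf * sq (m - n))"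
    using R_pos hb_nonneg a vp[of m] by (intro mult_left_mono wt_fcoef) auto
  finally show ?thesis by simp
qed

lemma Top_summable:
  assumes \<mu>: "adm \<mu>" and A: "supp_seq A" and v: "weight v" and a: "0 \<le> a" "\<And>n x. norm (A n x) \<le> a / v n"
  shows "(\<lambda>n. norm (conv (Hr \<beta> \<mu> n) (A n) x * fcoef f (m - n) x)) summable_on UNIV"
    "(\<lambda>n. conv (Hr \<beta> \<mu> n) (A n) x * fcoef f (m - n) x) summable_on UNIV"
  by (rule norm_summable_comparison[OF summable_on_cmult_right[OF sq_shift(1)] Top_term_bound[OF assms]])+

lemma Top_bound:
  assumes \<mu>: "adm \<mu>" and A: "supp_seq A" and v: "weight v" and a: "0 \<le> a" "\<And>n x. norm (A n x) \<le> a / v n"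
  shows "norm (Top f \<beta> \<mu> A m x) \<le> Tnorm * a / v m"
proof -
  let ?t = "\<lambda>n. conv (Hr \<beta> \<mu> n) (A n) x * fcoef f (m - n) x"
  have "norm (infsum ?t UNIV) \<le> infsum (\<lambda>n. norm (?t n)) UNIV"
    by (rule norm_infsum_bound[OF Top_summable(1)[OF assms]])
  also have "\<dots> \<le> infsum (\<lambda>n. 2 * R * hb * a / v m * Cf * sq (m - n)) UNIV"
    by (rule infsum_mono[OF Top_summable(1)[OF assms] summable_on_cmult_right[OF sq_shift(1)] Top_term_bound[OF assms]])
  also have "\<dots> = 2 * R * hb * a / v m * Cf * infsum sq UNIV"
    unfolding infsum_cmult_right' sq_shift(2) ..
  finally have 1: "norm (infsum ?t UNIV) \<le> 2 * R * hb * a / v m * Cf * infsum sq UNIV" .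
  have "norm (Top f \<beta> \<mu> A m x) = 2 * gam \<mu> \<beta> * norm (infsum ?t UNIV)"
    using gam_bounds[OF \<mu>] by (simp add: Top_def norm_mult)
  also have "\<dots> \<le> 2 * 1 * (2 * R * hb * a / v m * Cf * infsum sq UNIV)"
    using gam_bounds[OF \<mu>] 1 by (intro mult_mono) auto
  also have "\<dots> = Tnorm * a / v m" by (simp add: Tnorm_def)
  finally show ?thesis .
qed

lemma Top_supp: "x \<notin> {-R..R} \<Longrightarrow> Top f \<beta> \<mu> A m x = 0"
proof -
  assume "x \<notin> {-R..R}"
  then have "R < \<bar>x\<bar>" by auto
  then show ?thesis by (simp add: Top_def fcoef_supp)
qed

lemma Top_continuous:
  assumes \<mu>: "adm \<mu>" and A: "supp_seq A" and v: "weight v" and a: "0 \<le> a" "\<And>n x. norm (A n x) \<le> a / v n"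
  shows "continuous_on UNIV (Top f \<beta> \<mu> A m)"
proof -
  let ?t = "\<lambda>n x. conv (Hr \<beta> \<mu> n) (A n) x * fcoef f (m - n) x"
  have u: "uniform_limit UNIV (\<lambda>F x. \<Sum>n\<in>F. ?t n x) (\<lambda>x. infsum (\<lambda>n. ?t n x) UNIV) (finite_subsets_at_top UNIV)"
    by (rule Weierstrass_m_test_general[OF Top_term_bound[OF assms] summable_on_cmult_right[OF sq_shift(1)]])
  have c: "continuous_on UNIV (conv (Hr \<beta> \<mu> n) (A n))" for n
    by (rule conv_continuous[OF supp_seqD(1)[OF A] Hr_continuous[OF \<mu>] supp_seqD(2)[OF A]])
  have "continuous_on UNIV (\<lambda>x. infsum (\<lambda>n. ?t n x) UNIV)"
    by (rule uniform_limit_theorem[OF _ u]) (auto intro!: always_eventually continuous_intros c fcoef_continuous)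
  then show ?thesis unfolding Top_def[abs_def] by (intro continuous_intros)
qed

lemma supp_seq_lincomb: "supp_seq A \<Longrightarrow> supp_seq B \<Longrightarrow> supp_seq (\<lambda>n x. A n x + c * B n x)"
  unfolding supp_seq_def by (auto intro!: continuous_intros)

lemma Top_lincomb:
  assumes \<mu>: "adm \<mu>" and A: "supp_seq A" and B: "supp_seq B" and v: "weight v"
    and a: "0 \<le> a" "\<And>n x. norm (A n x) \<le> a / v n" and b: "0 \<le> b" "\<And>n x. norm (B n x) \<le> b / v n"
  shows "Top f \<beta> \<mu> (\<lambda>n x. A n x + c * B n x) m x = Top f \<beta> \<mu> A m x + c * Top f \<beta> \<mu> B m x"
proof -
  have cB: "continuous_on {-R..R} (\<lambda>x. c * B n x)" "y \<notin> {-R..R} \<Longrightarrow> c * B n y = 0" for n y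
    using supp_seqD[OF B] by (auto intro!: continuous_intros)
  have "conv (Hr \<beta> \<mu> n) (\<lambda>x. A n x + c * B n x) x = conv (Hr \<beta> \<mu> n) (A n) x + c * conv (Hr \<beta> \<mu> n) (B n) x" for n
    unfolding conv_cmult[symmetric]
    by (rule conv_add[OF supp_seqD(1)[OF A] cB(1) Hr_continuous[OF \<mu>] supp_seqD(2)[OF A] cB(2)])
  then have "infsum (\<lambda>n. conv (Hr \<beta> \<mu> n) (\<lambda>x. A n x + c * B n x) x * fcoef f (m - n) x) UNIV
    = infsum (\<lambda>n. conv (Hr \<beta> \<mu> n) (A n) x * fcoef f (m - n) x + c * (conv (Hr \<beta> \<mu> n) (B n) x * fcoef f (m - n) x)) UNIV"
    by (simp add: algebra_simps)
  also have "\<dots> = infsum (\<lambda>n. conv (Hr \<beta> \<mu> n) (A n) x * fcoef f (m - n) x) UNIV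
      + c * infsum (\<lambda>n. conv (Hr \<beta> \<mu> n) (B n) x * fcoef f (m - n) x) UNIV"
    unfolding infsum_cmult_right'[symmetric]
    by (rule infsum_add[OF Top_summable(2)[OF \<mu> A v a] summable_on_cmult_right[OF Top_summable(2)[OF \<mu> B v b]]])
  finally show ?thesis by (simp add: Top_def algebra_simps)
qed

section \<open>Existence, uniqueness and linearity of the fixed point\<close>

definition small :: "real \<Rightarrow> bool" where
  "small \<epsilon> \<longleftrightarrow> 0 < \<epsilon> \<and> \<epsilon> * Tnorm \<le> 1/2"

definition fixpoint :: "real \<Rightarrow> real \<Rightarrow> (int \<Rightarrow> real \<Rightarrow> complex) \<Rightarrow> (int \<Rightarrow> real \<Rightarrow> complex) \<Rightarrow> bool" where
  "fixpoint \<epsilon> \<mu> g A \<longleftrightarrow> A = (\<lambda>m x. g m x + of_real \<epsilon> * Top f \<beta> \<mu> A m x)"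

text \<open>
  Square summability in \<open>Aspace\<close> enters uniqueness only through boundedness, since the operator also
  contracts the unweighted sup norm.
\<close>

lemma fixpoint_unique:
  assumes \<mu>: "adm \<mu>" and \<epsilon>: "small \<epsilon>" and A: "supp_seq A" "\<And>n x. norm (A n x) \<le> a" and B: "supp_seq B" "\<And>n x. norm (B n x) \<le> b"
    and fp: "fixpoint \<epsilon> \<mu> g A" "fixpoint \<epsilon> \<mu> g B"
  shows "A = B"
proof -
  define D where "D = (\<lambda>n x. A n x + (-1) * B n x)"
  have a: "0 \<le> a" using A(2)[of 0 0] norm_ge_zero order_trans by blast
  have b: "0 \<le> b" using B(2)[of 0 0] norm_ge_zero order_trans by blast
  have sD: "supp_seq D" unfolding D_def by (rule supp_seq_lincomb[OF A(1) B(1)])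
  have TD: "Top f \<beta> \<mu> D m x = Top f \<beta> \<mu> A m x + (-1) * Top f \<beta> \<mu> B m x" for m x
    unfolding D_def by (rule Top_lincomb[OF \<mu> A(1) B(1) weight_1 a _ b]) (use A(2) B(2) in auto)
  have eqA: "A m x = g m x + of_real \<epsilon> * Top f \<beta> \<mu> A m x" for m x
    using fp(1) unfolding fixpoint_def by metis
  have eqB: "B m x = g m x + of_real \<epsilon> * Top f \<beta> \<mu> B m x" for m x
    using fp(2) unfolding fixpoint_def by metis
  have eqD: "D m x = of_real \<epsilon> * Top f \<beta> \<mu> D m x" for m x
    unfolding TD using eqA[of m x] eqB[of m x] by (simp add: D_def algebra_simps)
  \<comment> \<open>Each use of \<open>eqD\<close> together with the operator bound halves the sup
    norm of the difference.\<close>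
  have it: "norm (D m x) \<le> (a + b) * (1/2)^k" for m x k
  proof (induction k arbitrary: m x)
    case 0
    show ?case using norm_triangle_ineq4[of "A m x" "B m x"] A(2)[of m x] B(2)[of m x] by (simp add: D_def)
  next
    case (Suc k)
    have "norm (Top f \<beta> \<mu> D m x) \<le> Tnorm * ((a + b) * (1/2)^k) / 1"
      by (rule Top_bound[OF \<mu> sD weight_1]) (use Suc a b in auto)
    then have "\<epsilon> * norm (Top f \<beta> \<mu> D m x) \<le> \<epsilon> * (Tnorm * ((a + b) * (1/2)^k))"
      using \<epsilon> by (intro mult_left_mono) (auto simp: small_def)
    also have "\<dots> = (\<epsilon> * Tnorm) * ((a + b) * (1/2)^k)" by simp
    also have "\<dots> \<le> 1/2 * ((a + b) * (1/2)^k)"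
      using \<epsilon> a b by (intro mult_right_mono) (auto simp: small_def)
    finally show ?case
      using \<epsilon> by (subst eqD) (simp add: norm_mult small_def)
  qed
  have "D m x = 0" for m x
  proof -
    have "(\<lambda>k. (a + b) * (1/2)^k) \<longlonglongrightarrow> (a + b) * 0"
      by (intro tendsto_mult_left LIMSEQ_power_zero) simp
    then have "norm (D m x) \<le> 0" by (intro LIMSEQ_le_const[where X = "\<lambda>k. (a + b) * (1/2)^k"]) (use it in auto)
    then show ?thesis by simp
  qed
  then show ?thesis by (auto simp: D_def fun_eq_iff)
qed

lemma Aspace_bounded:
  assumes "A \<in> Aspace R" shows "supp_seq A" "\<exists>a. \<forall>n x. norm (A n x) \<le> a"
proof -
  show s: "supp_seq A" using assms by (auto simp: Aspace_def supp_seq_def)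
  let ?s = "\<lambda>j. SUP x\<in>{-R..R}. cmod (A j x)"
  have sm: "(\<lambda>j. (?s j)\<^sup>2) summable_on UNIV" using assms by (simp add: Aspace_def)
  have "norm (A n x) \<le> sqrt (infsum (\<lambda>j. (?s j)\<^sup>2) UNIV)" for n x
  proof (cases "x \<in> {-R..R}")
    case True
    have "continuous_on {-R..R} (\<lambda>x. cmod (A n x))" using supp_seqD(1)[OF s] by (intro continuous_intros)
    then have "bdd_above ((\<lambda>x. cmod (A n x)) ` {-R..R})"
      by (intro bounded_imp_bdd_above compact_imp_bounded compact_continuous_image) auto
    then have "norm (A n x) \<le> ?s n" using True by (intro cSUP_upper)
    then have "(norm (A n x))\<^sup>2 \<le> (?s n)\<^sup>2" by (intro power_mono) auto
    also have "\<dots> \<le> infsum (\<lambda>j. (?s j)\<^sup>2) UNIV"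
      using finite_sum_le_infsum[OF sm, of "{n}"] by simp
    finally show ?thesis by (rule real_le_rsqrt)
  next
    case False
    then show ?thesis using supp_seqD(2)[OF s] by (simp add: infsum_nonneg)
  qed
  then show "\<exists>a. \<forall>n x. norm (A n x) \<le> a" by blast
qed

text \<open>Continuity is required on the whole line, also across the ends of the support, so that
  the potentials are differentiable everywhere. It holds for the data and for values of
  \<open>Top\<close> because both carry the factor \<open>fcoef\<close>.\<close>

definition nice :: "(int \<Rightarrow> real \<Rightarrow> complex) \<Rightarrow> bool" where
  "nice A \<longleftrightarrow> (\<forall>n. continuous_on UNIV (A n)) \<and> (\<forall>n x. x \<notin> {-R..R} \<longrightarrow> A n x = 0) \<and> (\<exists>a\<ge>0. \<forall>n x. norm (A n x) \<le> a / wt n)"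

lemma niceE:
  assumes "nice A"
  obtains a where "0 \<le> a" "\<And>n x. norm (A n x) \<le> a / wt n"
  using assms unfolding nice_def by blast

lemma nice_supp_seq: "nice A \<Longrightarrow> supp_seq A"
  unfolding nice_def supp_seq_def using continuous_on_subset by blast

lemma nice_lincomb:
  assumes "nice A" "nice B" shows "nice (\<lambda>n x. A n x + c * B n x)"
proof -
  obtain a where a: "0 \<le> a" "\<And>n x. norm (A n x) \<le> a / wt n" by (rule niceE[OF assms(1)]) (rule that)
  obtain b where b: "0 \<le> b" "\<And>n x. norm (B n x) \<le> b / wt n" by (rule niceE[OF assms(2)]) (rule that)
  have "norm (A n x + c * B n x) \<le> (a + norm c * b) / wt n" for n x
  proof -
    have "norm (A n x + c * B n x) \<le> norm (A n x) + norm c * norm (B n x)"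
      using norm_triangle_ineq[of "A n x" "c * B n x"] by (simp add: norm_mult)
    also have "\<dots> \<le> a / wt n + norm c * (b / wt n)" by (intro add_mono a b mult_left_mono) auto
    finally show ?thesis by (simp add: add_divide_distrib)
  qed
  moreover have "0 \<le> a + norm c * b" using a b by simp
  ultimately show ?thesis using assms unfolding nice_def by (auto intro!: continuous_intros)
qed

lemma nice_Aspace:
  assumes "nice A" shows "A \<in> Aspace R"
proof -
  obtain a where a: "0 \<le> a" "\<And>n x. norm (A n x) \<le> a / wt n" by (rule niceE[OF assms]) (rule that)
  let ?s = "\<lambda>j. SUP x\<in>{-R..R}. cmod (A j x)"
  have ne: "{-R..R} \<noteq> {}" using R_pos by simp
  have s: "0 \<le> ?s j" "?s j \<le> a / wt j" for j
  proof -
    show "?s j \<le> a / wt j" by (rule cSUP_least[OF ne a(2)])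
    have "bdd_above ((\<lambda>x. cmod (A j x)) ` {-R..R})" using a(2)[of j] by (intro bdd_aboveI2)
    then have "cmod (A j 0) \<le> ?s j" using R_pos by (intro cSUP_upper) auto
    then show "0 \<le> ?s j" using norm_ge_zero order_trans by blast
  qed
  have "(?s j)\<^sup>2 \<le> a\<^sup>2 * sq j" for j
  proof -
    have "(?s j)\<^sup>2 \<le> (a / wt j)\<^sup>2" using s[of j] by (intro power_mono)
    also have "\<dots> = a\<^sup>2 * (1 / (wt j)\<^sup>2)" by (simp add: power_divide)
    also have "\<dots> \<le> a\<^sup>2 * sq j"
    proof (rule mult_left_mono)
      have "(1 + \<bar>real_of_int j\<bar>)^1 \<le> wt j" unfolding wt_def by (rule power_increasing) auto
      then have "(1 + \<bar>real_of_int j\<bar>)\<^sup>2 \<le> (wt j)\<^sup>2" by (intro power_mono) auto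
      then show "1 / (wt j)\<^sup>2 \<le> sq j" unfolding sq_def
        by (intro divide_left_mono mult_pos_pos zero_less_power wt_pos) auto
    qed simp
    finally show ?thesis .
  qed
  then have "(\<lambda>j. (?s j)\<^sup>2) summable_on UNIV"
    by (intro summable_on_comparison_test[OF summable_on_cmult_right[OF sq_summable, of "a\<^sup>2"]]) auto
  then show ?thesis using nice_supp_seq[OF assms] unfolding Aspace_def supp_seq_def by auto
qed

text \<open>Picard iteration from 0 in the norm weighted by \<open>wt\<close>. The limit is taken
  pointwise as a telescoping series dominated by a geometric one; that domination also gives uniform
  convergence, hence continuity, and the same weighted decay.\<close>

lemma fixpoint_exists:
  assumes \<mu>: "adm \<mu>" and \<epsilon>: "small \<epsilon>" and g: "nice g"
  obtains A where "nice A" "fixpoint \<epsilon> \<mu> g A"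
proof -
  obtain G where G: "0 \<le> G" "\<And>n x. norm (g n x) \<le> G / wt n" by (rule niceE[OF g]) (rule that)
  define \<Theta> where "\<Theta> = (\<lambda>A m x. g m x + of_real \<epsilon> * Top f \<beta> \<mu> A m x)"
  have Top_nice: "nice (Top f \<beta> \<mu> A)" if A: "nice A" for A
  proof -
    obtain a where a: "0 \<le> a" "\<And>n x. norm (A n x) \<le> a / wt n" by (rule niceE[OF A]) (rule that)
    show ?thesis unfolding nice_def
      using Top_continuous[OF \<mu> nice_supp_seq[OF A] weight_wt a] Top_supp Top_bound[OF \<mu> nice_supp_seq[OF A] weight_wt a]
        Tnorm_nonneg a(1) by (auto intro!: exI[of _ "Tnorm * a"])
  qed
  have \<Theta>_nice: "nice (\<Theta> A)" if "nice A" for A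
    unfolding \<Theta>_def by (rule nice_lincomb[OF g Top_nice[OF that]])
  \<comment> \<open>Linearity reduces the difference to \<open>Top\<close> of a difference, and
    \<open>small\<close> turns the operator bound into the factor 1/2.\<close>
  have contr: "norm (\<Theta> A m x - \<Theta> B m x) \<le> d / 2 / wt m"
    if A: "nice A" and B: "nice B" and d: "0 \<le> d" "\<And>n x. norm (A n x - B n x) \<le> d / wt n" for A B d m x
  proof -
    obtain a where a: "0 \<le> a" "\<And>n x. norm (A n x) \<le> a / wt n" by (rule niceE[OF A]) (rule that)
    obtain b where b: "0 \<le> b" "\<And>n x. norm (B n x) \<le> b / wt n" by (rule niceE[OF B]) (rule that)
    let ?D = "\<lambda>n x. A n x + (-1) * B n x"
    have TD: "Top f \<beta> \<mu> ?D m x = Top f \<beta> \<mu> A m x + (-1) * Top f \<beta> \<mu> B m x"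
      by (rule Top_lincomb[OF \<mu> nice_supp_seq[OF A] nice_supp_seq[OF B] weight_wt a b])
    have "norm (Top f \<beta> \<mu> ?D m x) \<le> Tnorm * d / wt m"
      by (rule Top_bound[OF \<mu> supp_seq_lincomb[OF nice_supp_seq[OF A] nice_supp_seq[OF B]] weight_wt d(1)]) (use d(2) in simp)
    then have "\<epsilon> * norm (Top f \<beta> \<mu> ?D m x) \<le> \<epsilon> * (Tnorm * d / wt m)"
      using \<epsilon> by (intro mult_left_mono) (auto simp: small_def)
    also have "\<dots> = (\<epsilon> * Tnorm) * (d / wt m)" by simp
    also have "\<dots> \<le> 1/2 * (d / wt m)" using \<epsilon> d(1) wt_pos[of m] by (intro mult_right_mono) (auto simp: small_def)
    finally have "norm (of_real \<epsilon> * Top f \<beta> \<mu> ?D m x) \<le> d / 2 / wt m" using \<epsilon> by (simp add: norm_mult small_def)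
    moreover have "\<Theta> A m x - \<Theta> B m x = of_real \<epsilon> * Top f \<beta> \<mu> ?D m x"
      unfolding TD by (simp add: \<Theta>_def algebra_simps)
    ultimately show ?thesis by simp
  qed
  define S where "S k = (\<Theta> ^^ k) (\<lambda>_ _. 0)" for k
  have S0: "S 0 = (\<lambda>_ _. 0)" and SS: "S (Suc k) = \<Theta> (S k)" for k by (auto simp: S_def)
  have nz: "nice (\<lambda>_ _. 0)" unfolding nice_def using wt_pos by (auto intro!: exI[of _ 0])
  have Sn: "nice (S k)" for k by (induction k) (simp_all add: S0 SS nz \<Theta>_nice)
  have inc: "norm (S (Suc k) m x - S k m x) \<le> G * (1/2)^k / wt m" for k m x
  proof (induction k arbitrary: m x)
    case 0
    have "Top f \<beta> \<mu> (\<lambda>_ _. 0) m x = 0" by (simp add: Top_def conv_def)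
    then show ?case using G(2)[of m x] by (simp add: SS S0 \<Theta>_def)
  next
    case (Suc k)
    have "norm (\<Theta> (S (Suc k)) m x - \<Theta> (S k) m x) \<le> G * (1/2)^k / 2 / wt m"
      by (rule contr[OF Sn Sn _ Suc]) (use G(1) in simp)
    then show ?case by (simp add: SS[of "Suc k"] SS[of k, symmetric])
  qed
  have geo: "summable (\<lambda>k. G * (1/2)^k / wt m)" "(\<Sum>k. G * (1/2)^k / wt m) = 2 * G / wt m" for m
  proof -
    have "(\<lambda>k. G / wt m * (1/2)^k) sums (G / wt m * (1 / (1 - 1/2)))"
      by (intro sums_mult geometric_sums) simp
    then have "(\<lambda>k. G * (1/2)^k / wt m) sums (2 * G / wt m)" by (simp add: mult.commute)
    then show "summable (\<lambda>k. G * (1/2)^k / wt m)" "(\<Sum>k. G * (1/2)^k / wt m) = 2 * G / wt m"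
      by (auto simp: sums_iff)
  qed
  define A where "A m x = (\<Sum>k. S (Suc k) m x - S k m x)" for m x
  have tele: "(\<Sum>i<k. S (Suc i) m x - S i m x) = S k m x" for k m x
    by (subst sum_lessThan_telescope) (simp add: S0)
  have tail: "norm (A m x - S k m x) \<le> 2 * G * (1/2)^k / wt m" for k m x
  proof -
    have sm: "summable (\<lambda>i. S (Suc i) m x - S i m x)"
      by (rule summable_comparison_test'[OF geo(1)[of m]]) (use inc in auto)
    have "A m x - S k m x = (\<Sum>i. S (Suc (i + k)) m x - S (i + k) m x)"
      using suminf_minus_initial_segment[OF sm, of k] tele[of m x k] by (simp add: A_def)
    also have "norm \<dots> \<le> (\<Sum>i. (1/2)^k * (G * (1/2)^i / wt m))"
    proof (rule norm_suminf_le)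
      show "norm (S (Suc (i + k)) m x - S (i + k) m x) \<le> (1/2)^k * (G * (1/2)^i / wt m)" for i
        using inc[of "i + k" m x] by (simp add: power_add mult_ac)
      show "summable (\<lambda>i. (1/2)^k * (G * (1/2)^i / wt m))" by (rule summable_mult[OF geo(1)])
    qed
    also have "\<dots> = (1/2)^k * (2 * G / wt m)" using suminf_mult[OF geo(1)[of m], of "(1/2)^k"] geo(2)[of m] by simp
    finally show ?thesis by (simp add: mult_ac)
  qed
  have lim0: "(\<lambda>k. K * (1/2)^k / wt m) \<longlonglongrightarrow> 0" for K m
  proof -
    have "(\<lambda>k. K / wt m * (1/2)^k) \<longlonglongrightarrow> K / wt m * 0" by (intro tendsto_mult_left LIMSEQ_power_zero) simp
    then show ?thesis by simp
  qed
  have An: "nice A"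
    unfolding nice_def
  proof (intro conjI allI impI)
    fix m
    have "uniform_limit UNIV (\<lambda>k. S k m) (A m) sequentially"
    proof (rule uniform_limitI)
      fix e :: real assume "0 < e"
      then have "eventually (\<lambda>k. 2 * G * (1/2)^k / wt m < e) sequentially"
        using order_tendstoD(2)[OF lim0] by blast
      then show "\<forall>\<^sub>F k in sequentially. \<forall>x\<in>UNIV. dist (S k m x) (A m x) < e"
      proof eventually_elim
        case (elim k)
        show ?case
        proof
          fix x
          have "dist (S k m x) (A m x) = norm (A m x - S k m x)" by (simp add: dist_norm norm_minus_commute)
          also have "\<dots> < e" using tail[of m x k] elim by (rule le_less_trans)
          finally show "dist (S k m x) (A m x) < e" .
        qed
      qed
    qed
    then show "continuous_on UNIV (A m)"
      by (rule uniform_limit_theorem[rotated]) (use Sn in \<open>auto simp: nice_def\<close>)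
    show "A m x = 0" if "x \<notin> {-R..R}" for x
    proof -
      have "S k m x = 0" for k using Sn[of k] that unfolding nice_def by blast
      then show ?thesis by (simp add: A_def)
    qed
    show "\<exists>a\<ge>0. \<forall>n x. norm (A n x) \<le> a / wt n"
      using tail[of _ _ 0] G(1) by (intro exI[of _ "2 * G"]) (auto simp: S0)
  qed
  have "norm (A m x - \<Theta> A m x) \<le> 4 * G * (1/2)^k / wt m" for k m x
  proof -
    have "norm (\<Theta> (S k) m x - \<Theta> A m x) \<le> 2 * G * (1/2)^k / 2 / wt m"
      by (rule contr[OF Sn An]) (use tail G(1) in \<open>auto simp: norm_minus_commute\<close>)
    moreover have "norm (A m x - S (Suc k) m x) \<le> 2 * G * (1/2)^(Suc k) / wt m" by (rule tail)
    moreover have "A m x - \<Theta> A m x = (A m x - S (Suc k) m x) + (\<Theta> (S k) m x - \<Theta> A m x)" by (simp add: SS)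
    ultimately have "norm (A m x - \<Theta> A m x) \<le> 2 * (G * (1/2)^k / wt m)"
      using norm_triangle_ineq[of "A m x - S (Suc k) m x" "\<Theta> (S k) m x - \<Theta> A m x"] by simp
    also have "\<dots> \<le> 4 * (G * (1/2)^k / wt m)" using G(1) wt_pos[of m] by (intro mult_right_mono) auto
    finally show ?thesis by simp
  qed
  then have "norm (A m x - \<Theta> A m x) \<le> 0" for m x
    by (intro LIMSEQ_le_const[OF lim0[of "4 * G" m]]) auto
  then have "A = \<Theta> A" by (auto simp: fun_eq_iff)
  then have "fixpoint \<epsilon> \<mu> g A" unfolding fixpoint_def \<Theta>_def .
  with An show thesis by (rule that)
qed

text \<open>The decaying fixed point lies in \<open>Aspace\<close>, and any competitor there is
  bounded, so the definite description picks the decaying one.\<close>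

lemma resolv_props:
  assumes \<mu>: "adm \<mu>" and \<epsilon>: "small \<epsilon>" and g: "nice g"
  shows "nice (resolv f R \<beta> \<epsilon> \<mu> g)" "fixpoint \<epsilon> \<mu> g (resolv f R \<beta> \<epsilon> \<mu> g)"
    and "nice B \<Longrightarrow> fixpoint \<epsilon> \<mu> g B \<Longrightarrow> resolv f R \<beta> \<epsilon> \<mu> g = B"
proof -
  obtain A where A: "nice A" "fixpoint \<epsilon> \<mu> g A" using fixpoint_exists[OF assms] by blast
  have u: "B = A" if B: "B \<in> Aspace R" "fixpoint \<epsilon> \<mu> g B" for B
  proof -
    obtain a where "\<And>n x. norm (A n x) \<le> a" using Aspace_bounded(2)[OF nice_Aspace[OF A(1)]] by blast
    moreover obtain b where "\<And>n x. norm (B n x) \<le> b" using Aspace_bounded(2)[OF B(1)] by blast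
    ultimately show ?thesis using fixpoint_unique[OF \<mu> \<epsilon> Aspace_bounded(1)[OF B(1)] _ nice_supp_seq[OF A(1)] _ B(2) A(2)] by blast
  qed
  have eq: "resolv f R \<beta> \<epsilon> \<mu> g = A"
    unfolding resolv_def fixpoint_def[symmetric]
    by (rule the_equality) (use A nice_Aspace u in auto)
  show "nice (resolv f R \<beta> \<epsilon> \<mu> g)" "fixpoint \<epsilon> \<mu> g (resolv f R \<beta> \<epsilon> \<mu> g)" unfolding eq by (rule A)+
  show "resolv f R \<beta> \<epsilon> \<mu> g = B" if "nice B" "fixpoint \<epsilon> \<mu> g B" unfolding eq using u[OF nice_Aspace] that by simp
qed

text \<open>Both sides are fixed points for the same datum. This separates the coefficient of
  \<open>g2\<close> from the data, so that every mean of the solution becomes affine in it.\<close>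

lemma resolv_lincomb:
  assumes \<mu>: "adm \<mu>" and \<epsilon>: "small \<epsilon>" and g: "nice g" and h: "nice h"
  shows "resolv f R \<beta> \<epsilon> \<mu> (\<lambda>j x. g j x + c * h j x) = (\<lambda>j x. resolv f R \<beta> \<epsilon> \<mu> g j x + c * resolv f R \<beta> \<epsilon> \<mu> h j x)"
proof (rule resolv_props(3)[OF \<mu> \<epsilon> nice_lincomb[OF g h]])
  let ?A = "resolv f R \<beta> \<epsilon> \<mu> g" and ?B = "resolv f R \<beta> \<epsilon> \<mu> h"
  note A = resolv_props(1,2)[OF \<mu> \<epsilon> g] and B = resolv_props(1,2)[OF \<mu> \<epsilon> h]
  show "nice (\<lambda>j x. ?A j x + c * ?B j x)" by (rule nice_lincomb[OF A(1) B(1)])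
  obtain a where a: "0 \<le> a" "\<And>n x. norm (?A n x) \<le> a / wt n" by (rule niceE[OF A(1)]) (rule that)
  obtain b where b: "0 \<le> b" "\<And>n x. norm (?B n x) \<le> b / wt n" by (rule niceE[OF B(1)]) (rule that)
  have eqA: "?A m x = g m x + of_real \<epsilon> * Top f \<beta> \<mu> ?A m x" for m x
    using A(2) unfolding fixpoint_def by (rule fun_cong[THEN fun_cong])
  have eqB: "?B m x = h m x + of_real \<epsilon> * Top f \<beta> \<mu> ?B m x" for m x
    using B(2) unfolding fixpoint_def by (rule fun_cong[THEN fun_cong])
  have T: "Top f \<beta> \<mu> (\<lambda>n x. ?A n x + c * ?B n x) m x = Top f \<beta> \<mu> ?A m x + c * Top f \<beta> \<mu> ?B m x" for m x
    by (rule Top_lincomb[OF \<mu> nice_supp_seq[OF A(1)] nice_supp_seq[OF B(1)] weight_wt a b])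
  show "fixpoint \<epsilon> \<mu> (\<lambda>j x. g j x + c * h j x) (\<lambda>j x. ?A j x + c * ?B j x)"
    unfolding fixpoint_def
  proof (intro ext)
    fix m x
    have "?A m x + c * ?B m x = (g m x + of_real \<epsilon> * Top f \<beta> \<mu> ?A m x) + c * (h m x + of_real \<epsilon> * Top f \<beta> \<mu> ?B m x)"
      by (simp only: eqA[of m x, symmetric] eqB[of m x, symmetric])
    then show "?A m x + c * ?B m x = g m x + c * h m x + of_real \<epsilon> * Top f \<beta> \<mu> (\<lambda>j x. ?A j x + c * ?B j x) m x"
      unfolding T by (simp add: algebra_simps)
  qed
qed

lemma nice_g1: "nice (g1 f \<beta> \<mu>)"
proof -
  have "norm (g1 f \<beta> \<mu> n x) \<le> Cf / wt n" for n x
  proof -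
    have "norm (fcoef f n x) * wt n \<le> Cf * sq n" using wt_fcoef[of n x] by (simp add: mult.commute)
    also have "\<dots> \<le> Cf * 1" unfolding sq_def using Cf(1) by (intro mult_left_mono) (auto intro!: divide_le_eq_1_pos[THEN iffD2] one_le_power)
    finally show ?thesis using wt_pos[of n] by (simp add: g1_def norm_mult pos_le_divide_eq)
  qed
  moreover have "continuous_on UNIV (g1 f \<beta> \<mu> n)" for n
    unfolding g1_def[abs_def] by (intro continuous_intros fcoef_continuous)
  moreover have "g1 f \<beta> \<mu> n x = 0" if "x \<notin> {-R..R}" for n x
    using fcoef_supp[of x n] that by (auto simp: g1_def)
  ultimately show ?thesis unfolding nice_def using Cf(1) by blast
qed

lemma nice_g2: "nice (g2 f)"
proof -
  have "norm (g2 f n x) \<le> wt (-1) * Cf / wt n" for n x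
  proof -
    have "norm (fcoef f (n + 1) x) * wt (n + 1) \<le> Cf * sq (n + 1)" using wt_fcoef[of "n + 1" x] by (simp add: mult.commute)
    also have "\<dots> \<le> Cf * 1" unfolding sq_def using Cf(1) by (intro mult_left_mono) (auto intro!: divide_le_eq_1_pos[THEN iffD2] one_le_power)
    finally have 1: "norm (fcoef f (n + 1) x) * wt (n + 1) \<le> Cf" by simp
    \<comment> \<open>Submultiplicativity pays for the index shift with the fixed factor
      \<open>wt (-1)\<close>.\<close>
    have "norm (fcoef f (n + 1) x) * wt n \<le> norm (fcoef f (n + 1) x) * (wt (n + 1) * wt (-1))"
      using wt_submult[of n "n + 1"] by (intro mult_left_mono) auto
    also have "\<dots> \<le> Cf * wt (-1)" using 1 wt_pos[of "-1"] by (simp add: mult.assoc[symmetric] mult_right_mono)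
    finally show ?thesis using wt_pos[of n] by (simp add: g2_def pos_le_divide_eq mult.commute)
  qed
  moreover have "continuous_on UNIV (g2 f n)" for n
    unfolding g2_def[abs_def] by (intro fcoef_continuous)
  moreover have "g2 f n x = 0" if "x \<notin> {-R..R}" for n x
    using fcoef_supp[of x "n + 1"] that by (auto simp: g2_def)
  moreover have "0 \<le> wt (-1) * Cf" using Cf(1) wt_pos[of "-1"] by simp
  ultimately show ?thesis unfolding nice_def by blast
qed

end

subsection \<open>Weak equations mode by mode\<close>

text \<open>The strip is open in \<open>y\<close> and the box closed; they differ on the support
  only by parts of the two edges, which are negligible.\<close>

lemma strip_integral_cbox:
  fixes h :: "real \<times> real \<Rightarrow> 'b::euclidean_space"
  assumes "\<And>x y. \<bar>x\<bar> > L \<Longrightarrow> 0 < y \<Longrightarrow> y < 2*pi \<Longrightarrow> h (x, y) = 0"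
  shows "integral strip h = integral (cbox (-L, 0) (L, 2*pi)) h"
proof (rule integral_spike_set)
  have e: "{p \<in> strip - cbox (-L, 0) (L, 2*pi). h p \<noteq> 0} = {}"
    using assms by (force simp: strip_def)
  show "negligible {p \<in> strip - cbox (-L, 0) (L, 2*pi). h p \<noteq> 0}" unfolding e by (rule negligible_empty)
  have b: "(0, 1) \<in> (Basis :: (real \<times> real) set)" by (simp add: Basis_prod_def)
  have "{p \<in> cbox (-L, 0) (L, 2*pi) - strip. h p \<noteq> 0} \<subseteq> {p. p \<bullet> (0, 1) = 0} \<union> {p. p \<bullet> (0, 1) = 2*pi}"
    by (auto simp: strip_def inner_prod_def)
  then show "negligible {p \<in> cbox (-L, 0) (L, 2*pi) - strip. h p \<noteq> 0}"
    by (rule negligible_subset[rotated]) (intro negligible_Un negligible_standard_hyperplane b)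
qed

lemma integral_x_derivative:
  fixes w P :: "real \<times> real \<Rightarrow> complex"
  assumes c: "continuous_on (cbox (a, c) (b, d)) w" and ab: "a \<le> b"
    and der: "\<And>x y. y \<in> {c..d} \<Longrightarrow> ((\<lambda>t. P (t, y)) has_vector_derivative w (x, y)) (at x)"
    and P: "\<And>y. y \<in> {c..d} \<Longrightarrow> P (a, y) = P (b, y)"
  shows "integral (cbox (a, c) (b, d)) w = 0"
proof -
  have "integral (cbox (a, c) (b, d)) w = integral (cbox a b) (\<lambda>x. integral (cbox c d) (\<lambda>y. w (x, y)))"
    by (rule integral_prod_continuous[OF c])
  also have "\<dots> = integral (cbox c d) (\<lambda>y. integral (cbox a b) (\<lambda>x. w (x, y)))"
    by (rule integral_swap_continuous) (use c in \<open>simp add: case_prod_unfold\<close>)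
  also have "\<dots> = integral (cbox c d) (\<lambda>y. 0)"
  proof (rule integral_cong)
    fix y assume y: "y \<in> cbox c d"
    have "((\<lambda>x. w (x, y)) has_integral P (b, y) - P (a, y)) {a..b}"
      by (rule fundamental_theorem_of_calculus[OF ab]) (rule has_vector_derivative_at_within, rule der, use y in simp)
    then show "integral (cbox a b) (\<lambda>x. w (x, y)) = 0" using P[of y] y by (simp add: integral_unique)
  qed
  finally show ?thesis by simp
qed

lemma integral_y_derivative:
  fixes w P :: "real \<times> real \<Rightarrow> complex"
  assumes c: "continuous_on (cbox (a, c) (b, d)) w" and cd: "c \<le> d"
    and der: "\<And>x y. ((\<lambda>t. P (x, t)) has_vector_derivative w (x, y)) (at y)"
    and P: "\<And>x. P (x, c) = P (x, d)"
  shows "integral (cbox (a, c) (b, d)) w = 0"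
proof -
  have "integral (cbox (a, c) (b, d)) w = integral (cbox a b) (\<lambda>x. integral (cbox c d) (\<lambda>y. w (x, y)))"
    by (rule integral_prod_continuous[OF c])
  also have "\<dots> = integral (cbox a b) (\<lambda>x. 0)"
  proof (rule integral_cong)
    fix x
    have "((\<lambda>y. w (x, y)) has_integral P (x, d) - P (x, c)) {c..d}"
      by (rule fundamental_theorem_of_calculus[OF cd]) (rule has_vector_derivative_at_within, rule der)
    then show "integral (cbox c d) (\<lambda>y. w (x, y)) = 0" using P[of x] by (simp add: integral_unique)
  qed
  finally show ?thesis by simp
qed

lemma continuous_on_fst_compose: "continuous_on UNIV a \<Longrightarrow> continuous_on UNIV (\<lambda>p. a (fst p))"
  by (rule continuous_on_compose2) (auto intro: continuous_intros)

lemma mode_ibp_x: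
  fixes \<phi> \<phi>x :: "real \<times> real \<Rightarrow> complex"
  assumes a: "\<And>x. (a has_vector_derivative a' x) (at x)" "continuous_on UNIV a'"
    and \<phi>: "continuous_on UNIV \<phi>" "continuous_on UNIV \<phi>x"
      "\<And>x y. ((\<lambda>t. \<phi> (t, y)) has_vector_derivative \<phi>x (x, y)) (at x)"
    and L: "0 \<le> L" "\<And>y. y \<in> {0..2*pi} \<Longrightarrow> \<phi> (-L, y) = 0 \<and> \<phi> (L, y) = 0"
  shows "integral (cbox (-L, 0) (L, 2*pi)) (\<lambda>p. a (fst p) * mode \<beta> j (snd p) * \<phi>x p)
     = - integral (cbox (-L, 0) (L, 2*pi)) (\<lambda>p. a' (fst p) * mode \<beta> j (snd p) * \<phi> p)"
proof -
  let ?B = "cbox (-L, 0) (L, 2*pi)"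
  have ac: "continuous_on UNIV a"
    using a(1) by (meson continuous_at_imp_continuous_on has_vector_derivative_continuous)
  have c1: "continuous_on UNIV (\<lambda>p. a (fst p) * mode \<beta> j (snd p) * \<phi>x p)"
    by (intro continuous_on_mult continuous_on_fst_compose ac continuous_mode_snd \<phi>)
  have c2: "continuous_on UNIV (\<lambda>p. a' (fst p) * mode \<beta> j (snd p) * \<phi> p)"
    by (intro continuous_on_mult continuous_on_fst_compose a continuous_mode_snd \<phi>)
  have i: "(\<lambda>p. a (fst p) * mode \<beta> j (snd p) * \<phi>x p) integrable_on ?B" "(\<lambda>p. a' (fst p) * mode \<beta> j (snd p) * \<phi> p) integrable_on ?B"
    by (intro integrable_continuous continuous_on_subset[OF c1] continuous_on_subset[OF c2] subset_UNIV)+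
  have "integral ?B (\<lambda>p. a (fst p) * mode \<beta> j (snd p) * \<phi>x p + a' (fst p) * mode \<beta> j (snd p) * \<phi> p) = 0"
  proof (rule integral_x_derivative[where P = "\<lambda>p::real \<times> real. a (fst p) * mode \<beta> j (snd p) * \<phi> p"])
    show "continuous_on ?B (\<lambda>p. a (fst p) * mode \<beta> j (snd p) * \<phi>x p + a' (fst p) * mode \<beta> j (snd p) * \<phi> p)"
      by (rule continuous_on_subset[OF continuous_on_add[OF c1 c2]]) simp
    show "((\<lambda>t. a (fst (t, y)) * mode \<beta> j (snd (t, y)) * \<phi> (t, y)) has_vector_derivative
        a (fst (x, y)) * mode \<beta> j (snd (x, y)) * \<phi>x (x, y) + a' (fst (x, y)) * mode \<beta> j (snd (x, y)) * \<phi> (x, y)) (at x)" for x y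
      unfolding fst_conv snd_conv by (intro has_vector_derivative_mult has_vector_derivative_mult_left a \<phi>)
  qed (use L in auto)
  then show ?thesis
    using Henstock_Kurzweil_Integration.integral_add[OF i] by (simp add: eq_neg_iff_add_eq_0)
qed

text \<open>The boundary condition concerns the product with the mode. It thus covers functions
  vanishing on both edges as well as conjugates of quasi-periodic ones, whose phase cancels that of
  the mode.\<close>

lemma mode_ibp_y:
  fixes \<phi> \<phi>y :: "real \<times> real \<Rightarrow> complex"
  assumes a: "continuous_on UNIV a"
    and \<phi>: "continuous_on UNIV \<phi>" "continuous_on UNIV \<phi>y"
      "\<And>x y. ((\<lambda>t. \<phi> (x, t)) has_vector_derivative \<phi>y (x, y)) (at y)"
    and per: "\<And>x. mode \<beta> j 0 * \<phi> (x, 0) = mode \<beta> j (2*pi) * \<phi> (x, 2*pi)"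
  shows "integral (cbox (-L, 0) (L, 2*pi)) (\<lambda>p. a (fst p) * mode \<beta> j (snd p) * \<phi>y p)
     = - integral (cbox (-L, 0) (L, 2*pi)) (\<lambda>p. (\<i> * of_real (\<beta> + of_int j) * a (fst p)) * mode \<beta> j (snd p) * \<phi> p)"
proof -
  let ?B = "cbox (-L, 0) (L, 2*pi)"
  have c1: "continuous_on UNIV (\<lambda>p. a (fst p) * mode \<beta> j (snd p) * \<phi>y p)"
    by (intro continuous_on_mult continuous_on_fst_compose a continuous_mode_snd \<phi>)
  have c2: "continuous_on UNIV (\<lambda>p. (\<i> * of_real (\<beta> + of_int j) * a (fst p)) * mode \<beta> j (snd p) * \<phi> p)"
    by (intro continuous_on_mult continuous_on_fst_compose a continuous_mode_snd \<phi> continuous_on_const)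
  have i: "(\<lambda>p. a (fst p) * mode \<beta> j (snd p) * \<phi>y p) integrable_on ?B"
     "(\<lambda>p. (\<i> * of_real (\<beta> + of_int j) * a (fst p)) * mode \<beta> j (snd p) * \<phi> p) integrable_on ?B"
    by (intro integrable_continuous continuous_on_subset[OF c1] continuous_on_subset[OF c2] subset_UNIV)+
  have "integral ?B (\<lambda>p. a (fst p) * mode \<beta> j (snd p) * \<phi>y p + (\<i> * of_real (\<beta> + of_int j) * a (fst p)) * mode \<beta> j (snd p) * \<phi> p) = 0"
  proof (rule integral_y_derivative[where P = "\<lambda>p::real \<times> real. a (fst p) * (mode \<beta> j (snd p) * \<phi> p)"])
    show "continuous_on ?B (\<lambda>p. a (fst p) * mode \<beta> j (snd p) * \<phi>y p + (\<i> * of_real (\<beta> + of_int j) * a (fst p)) * mode \<beta> j (snd p) * \<phi> p)"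
      by (rule continuous_on_subset[OF continuous_on_add[OF c1 c2]]) simp
    fix x y
    have "((\<lambda>t. a x * (mode \<beta> j t * \<phi> (x, t))) has_vector_derivative
        a x * (mode \<beta> j y * \<phi>y (x, y) + (\<i> * of_real (\<beta> + of_int j) * mode \<beta> j y) * \<phi> (x, y))) (at y)"
      by (intro has_vector_derivative_mult_right has_vector_derivative_mult mode_deriv \<phi>)
    then show "((\<lambda>t. a (fst (x, t)) * (mode \<beta> j (snd (x, t)) * \<phi> (x, t))) has_vector_derivative
        a (fst (x, y)) * mode \<beta> j (snd (x, y)) * \<phi>y (x, y) + (\<i> * of_real (\<beta> + of_int j) * a (fst (x, y))) * mode \<beta> j (snd (x, y)) * \<phi> (x, y)) (at y)"
      by (simp only: fst_conv snd_conv distrib_left mult.assoc mult.left_commute)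
  qed (use per in simp_all)
  then show ?thesis
    using Henstock_Kurzweil_Integration.integral_add[OF i] by (simp add: eq_neg_iff_add_eq_0)
qed

lemma strip_has_sum:
  assumes a: "\<And>j. continuous_on UNIV (a j)" "\<And>j x. norm (a j x) \<le> m j" "m summable_on UNIV"
    and \<psi>: "continuous_on UNIV \<psi>" "\<And>x y. \<bar>x\<bar> > L \<Longrightarrow> 0 < y \<Longrightarrow> y < 2*pi \<Longrightarrow> \<psi> (x, y) = 0"
  shows "((\<lambda>j. integral (cbox (-L, 0) (L, 2*pi)) (\<lambda>p. a j (fst p) * mode \<beta> j (snd p) * \<psi> p)) has_sum
     integral strip (\<lambda>p. Sser \<beta> a p * \<psi> p)) UNIV"
proof -
  let ?B = "cbox (-L, 0) (L, 2*pi)"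
  obtain b where b: "\<And>p. p \<in> ?B \<Longrightarrow> norm (\<psi> p) \<le> b"
    using compact_imp_bounded[OF compact_continuous_image[OF continuous_on_subset[OF \<psi>(1) subset_UNIV] compact_cbox]]
    unfolding bounded_iff by blast
  have m: "0 \<le> m j" for j using a(2)[of j 0] norm_ge_zero order_trans by blast
  have "((\<lambda>j. integral ?B (\<lambda>p. a j (fst p) * mode \<beta> j (snd p) * \<psi> p)) has_sum integral ?B (\<lambda>p. Sser \<beta> a p * \<psi> p)) UNIV"
  proof (rule has_sum_integral[where M = "\<lambda>j. m j * b"])
    have c: "continuous_on UNIV (\<lambda>p. a j (fst p) * mode \<beta> j (snd p) * \<psi> p)" for j
      by (intro continuous_on_mult continuous_on_fst_compose a continuous_mode_snd \<psi>)
    show "continuous_on ?B (\<lambda>p. a j (fst p) * mode \<beta> j (snd p) * \<psi> p)" for j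
      by (rule continuous_on_subset[OF c]) simp
    show "norm (a j (fst p) * mode \<beta> j (snd p) * \<psi> p) \<le> m j * b" if "p \<in> ?B" for j p
      using mult_mono[OF a(2) b[OF that] m norm_ge_zero] by (simp add: norm_mult)
    show "(\<lambda>j. m j * b) summable_on UNIV" by (rule summable_on_cmult_left[OF a(3)])
    show "((\<lambda>j. a j (fst p) * mode \<beta> j (snd p) * \<psi> p) has_sum Sser \<beta> a p * \<psi> p) UNIV" for p
      by (intro has_sum_cmult_left Sser_has_sum[where M = m] a)
  qed
  moreover have "integral strip (\<lambda>p. Sser \<beta> a p * \<psi> p) = integral ?B (\<lambda>p. Sser \<beta> a p * \<psi> p)"
    by (rule strip_integral_cbox) (use \<psi>(2) in simp)
  ultimately show ?thesis by simp
qed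

lemma vector_derivative_zero_near:
  assumes d: "(h has_vector_derivative d) (at (x::real))" and S: "open S" "x \<in> S" "\<And>t. t \<in> S \<Longrightarrow> h t = 0"
  shows "d = 0"
proof -
  have "((\<lambda>_. 0) has_vector_derivative d) (at x)"
    by (rule has_vector_derivative_transform_within_open[OF d S])
  then show ?thesis using has_vector_derivative_const vector_derivative_unique_at by blast
qed

lemma continuous_loc_int_strip:
  assumes "continuous_on UNIV u" shows "loc_int_strip u"
  unfolding loc_int_strip_def
proof
  fix L :: real
  have "u absolutely_integrable_on cbox (-L, 0) (L, 2*pi)"
    by (rule absolutely_integrable_continuous[OF continuous_on_subset[OF assms subset_UNIV]])
  moreover have "{-L..L} \<times> {0<..<2*pi} \<in> sets lebesgue"
  proof -
    have "{-L..L} \<times> {0<..<2*pi} \<in> sets (borel \<Otimes>\<^sub>M borel)" by (intro pair_measureI) auto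
    then show ?thesis unfolding borel_prod by auto
  qed
  ultimately show "u absolutely_integrable_on {-L..L} \<times> {0<..<2*pi}"
    by (rule set_integrable_subset) auto
qed

context
  fixes \<beta> \<omega>2 :: real and u u' A :: "int \<Rightarrow> real \<Rightarrow> complex" and M :: "int \<Rightarrow> real"
  assumes u: "\<And>j x. (u j has_vector_derivative u' j x) (at x)"
    and u': "\<And>j x. (u' j has_vector_derivative of_real ((\<beta> + of_int j)\<^sup>2 - \<omega>2) * u j x - A j x) (at x)"
    and Ac: "\<And>j. continuous_on UNIV (A j)"
    and bd: "\<And>j x. norm (u j x) \<le> M j" "\<And>j x. norm (u' j x) \<le> M j" "\<And>j x. norm (A j x) \<le> M j"
    and sM: "(\<lambda>j. (1 + \<bar>of_int j\<bar>) * M j) summable_on UNIV"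
begin

text \<open>One summable majorant for the modes, both their first derivatives and the source
  \<open>\<omega>2 * u + A\<close>.\<close>

private definition bw :: "int \<Rightarrow> real" where
  "bw j = (1 + \<bar>\<beta>\<bar> + \<bar>\<omega>2\<bar>) * ((1 + \<bar>of_int j\<bar>) * M j)"

private lemma bw_summable: "bw summable_on UNIV"
  unfolding bw_def by (rule summable_on_cmult_right[OF sM])

private lemma bw_bounds:
  "norm (u j x) \<le> bw j" "norm (u' j x) \<le> bw j" "norm (\<i> * of_real (\<beta> + of_int j) * u j x) \<le> bw j"
  "norm (of_real \<omega>2 * u j x + A j x) \<le> bw j"
proof -
  have M: "0 \<le> M j" using bd(1)[of j 0] norm_ge_zero order_trans by blast
  define J where "J = \<bar>real_of_int j\<bar>"
  have J: "0 \<le> J" by (simp add: J_def)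
  have exp: "bw j = M j + \<bar>\<beta>\<bar> * M j + J * M j + (\<bar>\<beta>\<bar> * J * M j + \<bar>\<omega>2\<bar> * M j + \<bar>\<omega>2\<bar> * J * M j)"
    unfolding bw_def J_def[symmetric] by (simp add: algebra_simps)
  have nn: "0 \<le> \<bar>\<beta>\<bar> * M j" "0 \<le> J * M j" "0 \<le> \<bar>\<beta>\<bar> * J * M j" "0 \<le> \<bar>\<omega>2\<bar> * M j" "0 \<le> \<bar>\<omega>2\<bar> * J * M j"
    using M J by auto
  show "norm (u j x) \<le> bw j" "norm (u' j x) \<le> bw j"
    using bd[of j x] nn unfolding exp by linarith+
  have "norm (\<i> * of_real (\<beta> + of_int j) * u j x) = \<bar>\<beta> + of_int j\<bar> * norm (u j x)"
    by (simp add: norm_mult del: of_real_add)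
  also have "\<dots> \<le> (\<bar>\<beta>\<bar> + J) * M j"
    unfolding J_def by (intro mult_mono bd abs_triangle_ineq) auto
  finally show "norm (\<i> * of_real (\<beta> + of_int j) * u j x) \<le> bw j"
    using nn M unfolding exp distrib_right by linarith
  have "norm (of_real \<omega>2 * u j x + A j x) \<le> \<bar>\<omega>2\<bar> * norm (u j x) + norm (A j x)"
    using norm_triangle_ineq[of "of_real \<omega>2 * u j x" "A j x"] by (simp add: norm_mult)
  also have "\<dots> \<le> \<bar>\<omega>2\<bar> * M j + M j" by (intro add_mono mult_left_mono bd) auto
  finally show "norm (of_real \<omega>2 * u j x + A j x) \<le> bw j"
    using nn unfolding exp by linarith
qed

private lemma conts:
  "continuous_on UNIV (u j)" "continuous_on UNIV (u' j)"
  "continuous_on UNIV (\<lambda>x. \<i> * of_real (\<beta> + of_int j) * u j x)"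
  "continuous_on UNIV (\<lambda>x. of_real ((\<beta> + of_int j)\<^sup>2 - \<omega>2) * u j x - A j x)"
  "continuous_on UNIV (\<lambda>x. of_real \<omega>2 * u j x + A j x)"
proof -
  show u0: "continuous_on UNIV (u j)" "continuous_on UNIV (u' j)"
    using u u' by (meson continuous_at_imp_continuous_on has_vector_derivative_continuous)+
  show "continuous_on UNIV (\<lambda>x. \<i> * of_real (\<beta> + of_int j) * u j x)"
    "continuous_on UNIV (\<lambda>x. of_real ((\<beta> + of_int j)\<^sup>2 - \<omega>2) * u j x - A j x)"
    "continuous_on UNIV (\<lambda>x. of_real \<omega>2 * u j x + A j x)"
    by (intro continuous_on_mult continuous_on_diff continuous_on_add continuous_on_const u0 Ac)+
qed

private abbreviation "uy \<equiv> (\<lambda>j x. \<i> * of_real (\<beta> + of_int j) * u j x)"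

lemma Sser_conts:
  "continuous_on UNIV (Sser \<beta> u)" "continuous_on UNIV (Sser \<beta> u')" "continuous_on UNIV (Sser \<beta> uy)"
  by (rule Sser_continuous[OF bw_bounds(1) bw_summable conts(1)] Sser_continuous[OF bw_bounds(2) bw_summable conts(2)]
      Sser_continuous[OF bw_bounds(3) bw_summable conts(3)])+

text \<open>Integration by parts in each mode makes both sides sums of the same series. The test
  functions have compact support in the open strip, so all boundary terms vanish.\<close>

lemma Sser_weak_grad: "weak_grad (Sser \<beta> u) (Sser \<beta> u') (Sser \<beta> uy)"
  unfolding weak_grad_def
proof (intro conjI allI impI)
  fix \<phi> :: "real \<times> real \<Rightarrow> complex"
  assume \<phi>: "smooth2 \<phi> \<and> compact (closure {p. \<phi> p \<noteq> 0}) \<and> closure {p. \<phi> p \<noteq> 0} \<subseteq> strip"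
  note p = smooth2_partials[OF conjunct1[OF \<phi>]]
  obtain K where K: "\<And>p. \<phi> p \<noteq> 0 \<Longrightarrow> norm p \<le> K"
  proof -
    have "bounded (closure {p. \<phi> p \<noteq> 0})" using \<phi> by (blast intro: compact_imp_bounded)
    then obtain K where "\<forall>p\<in>closure {p. \<phi> p \<noteq> 0}. norm p \<le> K" unfolding bounded_iff by blast
    then show thesis using that closure_subset[of "{p. \<phi> p \<noteq> 0}"] by blast
  qed
  have st: "\<phi> p \<noteq> 0 \<Longrightarrow> p \<in> strip" for p using \<phi> closure_subset[of "{p. \<phi> p \<noteq> 0}"] by blast
  define L where "L = max K 0 + 1"
  have L: "0 \<le> L" "K < L" by (auto simp: L_def)
  have zx: "\<phi> (x, y) = 0" if "K < \<bar>x\<bar>" for x y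
    using K[of "(x, y)"] norm_fst_le[of x y] that by fastforce
  have zy: "\<phi> (x, 0) = 0" "\<phi> (x, 2*pi) = 0" for x using st[of "(x, 0)"] st[of "(x, 2*pi)"] by (auto simp: strip_def)
  have dz: "px \<phi> (x, y) = 0" "py \<phi> (x, y) = 0" if "K < \<bar>x\<bar>" for x y
  proof -
    have "open {t. K < \<bar>t\<bar>}" by (intro open_Collect_less continuous_intros)
    from vector_derivative_zero_near[OF p(4) this] show "px \<phi> (x, y) = 0" using zx that by simp
    from vector_derivative_zero_near[OF p(5) open_UNIV] show "py \<phi> (x, y) = 0" using zx that by simp
  qed
  let ?B = "cbox (-L, 0) (L, 2*pi)"
  have x: "integral ?B (\<lambda>p. u j (fst p) * mode \<beta> j (snd p) * px \<phi> p) = - integral ?B (\<lambda>p. u' j (fst p) * mode \<beta> j (snd p) * \<phi> p)" for j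
    by (rule mode_ibp_x[OF u conts(2) p(1,2,4) L(1)]) (use L zx in auto)
  have "((\<lambda>j. - integral ?B (\<lambda>p. u' j (fst p) * mode \<beta> j (snd p) * \<phi> p)) has_sum integral strip (\<lambda>p. Sser \<beta> u p * px \<phi> p)) UNIV"
    unfolding x[symmetric] by (rule strip_has_sum[OF conts(1) bw_bounds(1) bw_summable p(2)]) (use L dz in auto)
  moreover have "((\<lambda>j. - integral ?B (\<lambda>p. u' j (fst p) * mode \<beta> j (snd p) * \<phi> p)) has_sum - integral strip (\<lambda>p. Sser \<beta> u' p * \<phi> p)) UNIV"
    unfolding has_sum_uminus minus_minus by (rule strip_has_sum[OF conts(2) bw_bounds(2) bw_summable p(1)]) (use L zx in auto)
  ultimately show "integral strip (\<lambda>p. Sser \<beta> u p * px \<phi> p) = - integral strip (\<lambda>p. Sser \<beta> u' p * \<phi> p)"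
    by (rule has_sum_unique)
  have y: "integral ?B (\<lambda>p. u j (fst p) * mode \<beta> j (snd p) * py \<phi> p) = - integral ?B (\<lambda>p. uy j (fst p) * mode \<beta> j (snd p) * \<phi> p)" for j
    by (rule mode_ibp_y[OF conts(1) p(1,3,5)]) (simp add: zy)
  have "((\<lambda>j. - integral ?B (\<lambda>p. uy j (fst p) * mode \<beta> j (snd p) * \<phi> p)) has_sum integral strip (\<lambda>p. Sser \<beta> u p * py \<phi> p)) UNIV"
    unfolding y[symmetric] by (rule strip_has_sum[OF conts(1) bw_bounds(1) bw_summable p(3)]) (use L dz in auto)
  moreover have "((\<lambda>j. - integral ?B (\<lambda>p. uy j (fst p) * mode \<beta> j (snd p) * \<phi> p)) has_sum - integral strip (\<lambda>p. Sser \<beta> uy p * \<phi> p)) UNIV"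
    unfolding has_sum_uminus minus_minus by (rule strip_has_sum[OF conts(3) bw_bounds(3) bw_summable p(1)]) (use L zx in auto)
  ultimately show "integral strip (\<lambda>p. Sser \<beta> u p * py \<phi> p) = - integral strip (\<lambda>p. Sser \<beta> uy p * \<phi> p)"
    by (rule has_sum_unique)
qed (intro continuous_loc_int_strip Sser_conts)+

text \<open>Within one mode the integrations by parts in \<open>x\<close> and in \<open>y\<close>
  contribute \<open>(\<beta> + j)\<^sup>2\<close> with opposite signs. These growing parts cancel
  before the sum is taken, and what is left, \<open>\<omega>2 * u + A\<close>, is summable.\<close>

lemma Sser_green:
  assumes \<Phi>: "test_beta \<beta> \<Phi>"
  shows "integral strip (\<lambda>p. Sser \<beta> u' p * cnj (px \<Phi> p) + Sser \<beta> uy p * cnj (py \<Phi> p))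
     = integral strip (\<lambda>p. Sser \<beta> (\<lambda>j x. of_real \<omega>2 * u j x + A j x) p * cnj (\<Phi> p))"
proof -
  have sm: "smooth2 \<Phi>" using \<Phi> by (simp add: test_beta_def)
  note p = smooth2_partials[OF sm]
  have cn: "continuous_on UNIV (\<lambda>p. cnj (\<Phi> p))" "continuous_on UNIV (\<lambda>p. cnj (px \<Phi> p))" "continuous_on UNIV (\<lambda>p. cnj (py \<Phi> p))"
    by (intro continuous_intros p(1) p(2) p(3))+
  have cd: "((\<lambda>t. cnj (\<Phi> (t, y))) has_vector_derivative cnj (px \<Phi> (x, y))) (at x)"
    "((\<lambda>t. cnj (\<Phi> (x, t))) has_vector_derivative cnj (py \<Phi> (x, y))) (at y)" for x y
    by (rule has_vector_derivative_cnj p(4) p(5))+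
  obtain K where K: "\<And>x y. \<bar>x\<bar> > K \<Longrightarrow> 0 \<le> y \<Longrightarrow> y \<le> 2*pi \<Longrightarrow> \<Phi> (x, y) = 0"
    using \<Phi> unfolding test_beta_def by blast
  define L where "L = max K 0 + 1"
  have L: "0 \<le> L" "K < L" by (auto simp: L_def)
  have dz: "px \<Phi> (x, y) = 0" "py \<Phi> (x, y) = 0" if "K < \<bar>x\<bar>" "0 < y" "y < 2*pi" for x y
  proof -
    have "open {t. K < \<bar>t\<bar>}" by (intro open_Collect_less continuous_intros)
    from vector_derivative_zero_near[OF p(4) this] show "px \<Phi> (x, y) = 0" using K that by simp
    from vector_derivative_zero_near[OF p(5), where S = "{0<..<2*pi}"] show "py \<Phi> (x, y) = 0" using K that by simp
  qed
  let ?B = "cbox (-L, 0) (L, 2*pi)"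
  let ?K = "\<lambda>j::int. complex_of_real ((\<beta> + of_int j)\<^sup>2 - \<omega>2)"
  have x: "integral ?B (\<lambda>p. u' j (fst p) * mode \<beta> j (snd p) * cnj (px \<Phi> p)) = - integral ?B (\<lambda>p. (?K j * u j (fst p) - A j (fst p)) * mode \<beta> j (snd p) * cnj (\<Phi> p))" for j
    by (rule mode_ibp_x[OF u' conts(4) cn(1,2) cd(1) L(1)]) (use L K in auto)
  have y: "integral ?B (\<lambda>p. uy j (fst p) * mode \<beta> j (snd p) * cnj (py \<Phi> p))
     = - integral ?B (\<lambda>p. (\<i> * of_real (\<beta> + of_int j) * uy j (fst p)) * mode \<beta> j (snd p) * cnj (\<Phi> p))" for j
  proof (rule mode_ibp_y[OF conts(3) cn(1,3) cd(2)])
    fix x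
    let ?c = "cis (2*pi*\<beta>)"
    have eq: "\<Phi> (x, 2*pi) = ?c * \<Phi> (x, 0)" using \<Phi> by (simp add: test_beta_def)
    have c1: "?c * cnj ?c = 1" by (simp add: cis_cnj cis_mult)
    have "mode \<beta> j (2*pi) * cnj (\<Phi> (x, 2*pi)) = (?c * cnj ?c) * (mode \<beta> j 0 * cnj (\<Phi> (x, 0)))"
      unfolding eq mode_quasiperiodic complex_cnj_mult by (simp only: mult_ac)
    then show "mode \<beta> j 0 * cnj (\<Phi> (x, 0)) = mode \<beta> j (2*pi) * cnj (\<Phi> (x, 2*pi))"
      unfolding c1 by simp
  qed
  let ?T = "\<lambda>j. integral ?B (\<lambda>p. (of_real \<omega>2 * u j (fst p) + A j (fst p)) * mode \<beta> j (snd p) * cnj (\<Phi> p))"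
  have ci: "(\<lambda>p. v (fst p) * mode \<beta> j (snd p) * cnj (\<Phi> p)) integrable_on ?B" if "continuous_on UNIV v" for v :: "real \<Rightarrow> complex" and j
  proof -
    have "continuous_on UNIV (\<lambda>p. v (fst p) * mode \<beta> j (snd p) * cnj (\<Phi> p))"
      by (intro continuous_on_mult continuous_on_fst_compose that continuous_mode_snd cn)
    then show ?thesis by (intro integrable_continuous) (rule continuous_on_subset, auto)
  qed
  have xy: "integral ?B (\<lambda>p. u' j (fst p) * mode \<beta> j (snd p) * cnj (px \<Phi> p)) + integral ?B (\<lambda>p. uy j (fst p) * mode \<beta> j (snd p) * cnj (py \<Phi> p)) = ?T j" for j
  proof -
    have c1: "continuous_on UNIV (\<lambda>x. \<i> * of_real (\<beta> + of_int j) * uy j x)"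
      by (intro continuous_on_mult continuous_on_const conts)
    have "?T j = integral ?B (\<lambda>p. - ((?K j * u j (fst p) - A j (fst p)) * mode \<beta> j (snd p) * cnj (\<Phi> p)) + - ((\<i> * of_real (\<beta> + of_int j) * uy j (fst p)) * mode \<beta> j (snd p) * cnj (\<Phi> p)))"
    proof (rule integral_cong)
      fix p :: "real \<times> real"
      have "of_real \<omega>2 * u j (fst p) + A j (fst p) = - (?K j * u j (fst p) - A j (fst p)) + - (\<i> * of_real (\<beta> + of_int j) * uy j (fst p))"
      proof -
        have "\<i> * of_real (\<beta> + of_int j) * uy j (fst p) = - of_real ((\<beta> + of_int j)\<^sup>2) * u j (fst p)"
          by (simp add: power2_eq_square mult_ac del: of_real_add)
        then show ?thesis by (simp add: left_diff_distrib del: of_real_add of_real_power)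
      qed
      then show "(of_real \<omega>2 * u j (fst p) + A j (fst p)) * mode \<beta> j (snd p) * cnj (\<Phi> p) =
        - ((?K j * u j (fst p) - A j (fst p)) * mode \<beta> j (snd p) * cnj (\<Phi> p)) + - ((\<i> * of_real (\<beta> + of_int j) * uy j (fst p)) * mode \<beta> j (snd p) * cnj (\<Phi> p))"
        by (simp only: distrib_right mult_minus_left)
    qed
    also have "\<dots> = - integral ?B (\<lambda>p. (?K j * u j (fst p) - A j (fst p)) * mode \<beta> j (snd p) * cnj (\<Phi> p))
        + - integral ?B (\<lambda>p. (\<i> * of_real (\<beta> + of_int j) * uy j (fst p)) * mode \<beta> j (snd p) * cnj (\<Phi> p))"
      unfolding integral_neg[symmetric]
      by (rule Henstock_Kurzweil_Integration.integral_add) (intro integrable_neg ci conts c1)+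
    finally show ?thesis unfolding x y by simp
  qed
  have "((\<lambda>j. ?T j) has_sum integral strip (\<lambda>p. Sser \<beta> (\<lambda>j x. of_real \<omega>2 * u j x + A j x) p * cnj (\<Phi> p))) UNIV"
    by (rule strip_has_sum[OF conts(5) bw_bounds(4) bw_summable cn(1)]) (use L K in auto)
  moreover have "((\<lambda>j. ?T j) has_sum integral strip (\<lambda>p. Sser \<beta> u' p * cnj (px \<Phi> p)) + integral strip (\<lambda>p. Sser \<beta> uy p * cnj (py \<Phi> p))) UNIV"
    unfolding xy[symmetric]
    by (intro has_sum_add strip_has_sum[OF conts(2) bw_bounds(2) bw_summable cn(2)] strip_has_sum[OF conts(3) bw_bounds(3) bw_summable cn(3)])
       (use L dz in auto)
  ultimately have "integral strip (\<lambda>p. Sser \<beta> u' p * cnj (px \<Phi> p)) + integral strip (\<lambda>p. Sser \<beta> uy p * cnj (py \<Phi> p))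
    = integral strip (\<lambda>p. Sser \<beta> (\<lambda>j x. of_real \<omega>2 * u j x + A j x) p * cnj (\<Phi> p))"
    using has_sum_unique by blast
  moreover have "integral strip (\<lambda>p. Sser \<beta> u' p * cnj (px \<Phi> p) + Sser \<beta> uy p * cnj (py \<Phi> p))
     = integral strip (\<lambda>p. Sser \<beta> u' p * cnj (px \<Phi> p)) + integral strip (\<lambda>p. Sser \<beta> uy p * cnj (py \<Phi> p))"
  proof -
    have s1: "integral strip (\<lambda>p. Sser \<beta> u' p * cnj (px \<Phi> p)) = integral ?B (\<lambda>p. Sser \<beta> u' p * cnj (px \<Phi> p))"
      by (rule strip_integral_cbox) (use L dz in auto)
    have s2: "integral strip (\<lambda>p. Sser \<beta> uy p * cnj (py \<Phi> p)) = integral ?B (\<lambda>p. Sser \<beta> uy p * cnj (py \<Phi> p))"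
      by (rule strip_integral_cbox) (use L dz in auto)
    have s3: "integral strip (\<lambda>p. Sser \<beta> u' p * cnj (px \<Phi> p) + Sser \<beta> uy p * cnj (py \<Phi> p)) = integral ?B (\<lambda>p. Sser \<beta> u' p * cnj (px \<Phi> p) + Sser \<beta> uy p * cnj (py \<Phi> p))"
      by (rule strip_integral_cbox) (use L dz in auto)
    show ?thesis unfolding s1 s2 s3
      by (intro Henstock_Kurzweil_Integration.integral_add integrable_continuous continuous_on_mult
          continuous_on_subset[OF cn(2)] continuous_on_subset[OF cn(3)] continuous_on_subset[OF Sser_conts(2)] continuous_on_subset[OF Sser_conts(3)] subset_UNIV)
  qed
  ultimately show ?thesis by simp
qed

end

subsection \<open>The scattering solution\<close>

text \<open>A double series summed in two orders. For fixed \<open>n\<close> the sum over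
  \<open>m\<close> is translation invariant, which gives absolute summability and the value
  \<open>Sa * Sb\<close>; for fixed \<open>m\<close> the inner sum is \<open>c m\<close>.\<close>

lemma has_sum_cauchy_product:
  fixes a b c :: "int \<Rightarrow> complex"
  assumes a: "(\<lambda>n. norm (a n)) summable_on UNIV" "(a has_sum Sa) UNIV"
    and b: "(\<lambda>n. norm (b n)) summable_on UNIV" "(b has_sum Sb) UNIV"
    and c: "\<And>m. ((\<lambda>n. a n * b (m - n)) has_sum c m) UNIV"
  shows "(c has_sum Sa * Sb) UNIV"
proof -
  have bij: "bij_betw (\<lambda>m. m - n) UNIV UNIV" for n :: int
    by (rule bij_betwI[where g = "\<lambda>m. m + n"]) auto
  let ?F = "\<lambda>(n, m). a n * b (m - n)"
  have "((\<lambda>m. norm (b (m - n))) has_sum infsum (\<lambda>n. norm (b n)) UNIV) UNIV" for n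
    by (subst has_sum_reindex_bij_betw[OF bij, where f = "\<lambda>n. norm (b n)"]) (rule has_sum_infsum[OF b(1)])
  then have inner: "((\<lambda>m. norm (a n) * norm (b (m - n))) has_sum norm (a n) * infsum (\<lambda>n. norm (b n)) UNIV) UNIV" for n
    by (rule has_sum_cmult_right)
  have "(\<lambda>p. norm (?F p)) summable_on UNIV \<times> UNIV"
    by (rule summable_on_SigmaI[where g = "\<lambda>n. norm (a n) * infsum (\<lambda>n. norm (b n)) UNIV"])
       (use inner summable_on_cmult_left[OF a(1)] in \<open>auto simp: norm_mult\<close>)
  then have sF: "?F summable_on UNIV \<times> UNIV" by (rule abs_summable_summable)
  have "((\<lambda>m. b (m - n)) has_sum Sb) UNIV" for n
    by (subst has_sum_reindex_bij_betw[OF bij, where f = b]) (rule b(2))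
  then have "(?F has_sum Sa * Sb) (UNIV \<times> UNIV)"
    by (intro has_sum_SigmaI[where g = "\<lambda>n. a n * Sb"] sF) (auto intro!: has_sum_cmult_right has_sum_cmult_left a(2))
  moreover have "bij_betw prod.swap (UNIV \<times> UNIV) (UNIV \<times> UNIV :: (int \<times> int) set)"
    by (rule bij_betwI[where g = prod.swap]) auto
  ultimately have "((\<lambda>p. ?F (prod.swap p)) has_sum Sa * Sb) (UNIV \<times> UNIV)"
    using has_sum_reindex_bij_betw by blast
  then show ?thesis
    by (rule has_sum_SigmaD) (use c in simp)
qed

lemma continuous_supported_bounded:
  fixes h :: "real \<Rightarrow> complex"
  assumes "continuous_on UNIV h" "\<And>x. \<bar>x\<bar> > L \<Longrightarrow> h x = 0"
  obtains B where "0 \<le> B" "\<And>x. norm (h x) \<le> B"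
proof -
  obtain B where B: "\<And>x. x \<in> {-L..L} \<Longrightarrow> norm (h x) \<le> B"
    using compact_imp_bounded[OF compact_continuous_image[OF continuous_on_subset[OF assms(1) subset_UNIV] compact_Icc]]
    unfolding bounded_iff by blast
  have "norm (h x) \<le> max B 0" for x
  proof (cases "\<bar>x\<bar> > L")
    case False
    then have "norm (h x) \<le> B" by (intro B) auto
    then show ?thesis by simp
  qed (simp add: assms(2))
  then show thesis by (rule that[rotated]) simp
qed

lemma continuous_supported_integrable:
  fixes h :: "real \<Rightarrow> complex"
  assumes "continuous_on UNIV h" "\<And>x. x \<notin> {-R..R} \<Longrightarrow> h x = 0"
  shows "h integrable_on UNIV"
proof -
  have "h integrable_on {-R..R}" by (intro integrable_continuous_real continuous_on_subset[OF assms(1)]) simp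
  moreover have "(\<lambda>x. if x \<in> {-R..R} then h x else 0) = h" using assms(2) by auto
  ultimately show ?thesis by (metis integrable_restrict_UNIV)
qed

context scattering_data
begin

lemma nice_cmult:
  assumes "nice A" shows "nice (\<lambda>n x. c * A n x)"
proof -
  have "nice (\<lambda>_ _. 0)" unfolding nice_def using wt_pos by (auto intro!: exI[of _ 0])
  from nice_lincomb[OF this assms, of c] show ?thesis by simp
qed

lemma niceD: "nice A \<Longrightarrow> continuous_on UNIV (A n)" "nice A \<Longrightarrow> x \<notin> {-R..R} \<Longrightarrow> A n x = 0"
  unfolding nice_def by auto

text \<open>The two kernels differ by the constant \<open>1 / (2 * \<mu>)\<close>, and convolving
  with a constant only sees the mean.\<close>

lemma Gr_Hr_shift:
  assumes "adm \<mu>" and A: "nice A"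
  shows "conv (Gr \<beta> \<mu> (-1)) (A (-1)) x = conv (Hr \<beta> \<mu> (-1)) (A (-1)) x + mean (A (-1)) / (2 * of_real \<mu>)"
proof -
  have "\<mu> \<noteq> 0" using assms(1) by (simp add: adm_def)
  then have G: "Gr \<beta> \<mu> (-1) y = Hr \<beta> \<mu> (-1) y + 1 / (2 * of_real \<mu>)" for y
    by (simp add: Gr_def Hr_def diff_divide_distrib)
  have supp: "\<And>x. x \<notin> {-R..R} \<Longrightarrow> A (-1) x = 0" by (rule niceD(2)[OF A])
  have c: "continuous_on {-R..R} (A (-1))" by (rule continuous_on_subset[OF niceD(1)[OF A]]) simp
  have "conv (Gr \<beta> \<mu> (-1)) (A (-1)) x = integral {-R..R} (\<lambda>\<xi>. Hr \<beta> \<mu> (-1) (x - \<xi>) * A (-1) \<xi> + 1 / (2 * of_real \<mu>) * A (-1) \<xi>)"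
    by (subst conv_supported[OF supp]) (auto simp: G distrib_right)
  also have "\<dots> = integral {-R..R} (\<lambda>\<xi>. Hr \<beta> \<mu> (-1) (x - \<xi>) * A (-1) \<xi>) + integral {-R..R} (\<lambda>\<xi>. 1 / (2 * of_real \<mu>) * A (-1) \<xi>)"
    by (rule Henstock_Kurzweil_Integration.integral_add[OF conv_integrable[OF c Hr_continuous[OF assms(1)]]])
       (intro integrable_continuous_real continuous_on_mult continuous_on_const c)
  also have "integral {-R..R} (\<lambda>\<xi>. 1 / (2 * of_real \<mu>) * A (-1) \<xi>) = mean (A (-1)) / (2 * of_real \<mu>)"
    unfolding mean_def by (subst integral_eq_supported[of UNIV "{-R..R}" "A (-1)"]) (use supp in auto)
  also have "integral {-R..R} (\<lambda>\<xi>. Hr \<beta> \<mu> (-1) (x - \<xi>) * A (-1) \<xi>) = conv (Hr \<beta> \<mu> (-1)) (A (-1)) x"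
    by (rule conv_supported[OF supp, symmetric])
  finally show ?thesis .
qed

lemma fcoef_norm_summable: "(\<lambda>j. norm (fcoef f j x)) summable_on UNIV"
proof (rule norm_summable_comparison(1)[OF summable_on_cmult_right[OF sq_summable]])
  fix j
  have "1 * norm (fcoef f j x) \<le> wt j * norm (fcoef f j x)" by (rule mult_right_mono[OF wt_pos(2)]) simp
  then show "norm (fcoef f j x) \<le> Cf * sq j" using wt_fcoef[of j x] by simp
qed

lemma fcoef_inversion:
  assumes "y \<in> {0..2*pi}"
  shows "((\<lambda>j. fcoef f j x * cis (of_int j * y)) has_sum 2 * of_real pi * of_real (f (x, y))) UNIV"
  unfolding fcoef_fc
proof (rule fourier_inversion[OF _ _ order_refl _ assms])
  show "continuous_on UNIV (\<lambda>y. complex_of_real (f (x, y)))"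
    by (intro continuous_intros continuous_on_compose2[OF f_continuous]) auto
  show "(\<lambda>j. norm (fc (\<lambda>y. complex_of_real (f (x, y))) j)) summable_on UNIV"
    using fcoef_norm_summable by (simp add: fcoef_fc)
qed (simp add: f_per)

end

section \<open>The solution for fixed admissible parameters\<close>

locale scattering_solution = scattering_data +
  fixes \<epsilon> \<mu> :: real
  assumes \<mu>: "adm \<mu>" and \<epsilon>: "small \<epsilon>"
    and nz: "of_real \<mu> - of_real \<epsilon> * of_real (gam \<mu> \<beta>) * FF f R \<beta> \<epsilon> \<mu> \<noteq> 0"
begin

abbreviation "k \<equiv> k0 \<beta> \<mu>"
definition den :: complex where "den = of_real \<mu> - of_real \<epsilon> * of_real (gam \<mu> \<beta>) * FF f R \<beta> \<epsilon> \<mu>"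
definition eg :: complex where "eg = of_real \<epsilon> * of_real (gam \<mu> \<beta>)"
definition c :: complex where "c = eg * QQ f R \<beta> \<epsilon> \<mu> / den"
definition r1 where "r1 = resolv f R \<beta> \<epsilon> \<mu> (g1 f \<beta> \<mu>)"
definition r2 where "r2 = resolv f R \<beta> \<epsilon> \<mu> (g2 f)"
definition r where "r = (\<lambda>j x. r1 j x + c * r2 j x)"
definition A where "A = (\<lambda>j x. 2 * eg * r j x)"
definition \<Psi> where "\<Psi> j x = (if j = 0 then cis (k * x) else 0) + conv (Gr \<beta> \<mu> j) (A j) x"
definition \<Psi>' where "\<Psi>' j x = (if j = 0 then \<i> * of_real k * cis (k * x) else 0) + dgk_conv (kap \<mu> j) (A j) x"
text \<open>\<open>Rc\<close> and \<open>Tc\<close> have the form that results when the braces in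
  the claimed coefficients are divided by \<open>den\<close>; it is the one produced by the
  asymptotics.\<close>

definition Rc where "Rc = \<i> * eg / of_real k * (Pp f R \<beta> \<epsilon> \<mu> + c * Rp f R \<beta> \<epsilon> \<mu>)"
definition Tc where "Tc = 1 + \<i> * eg / of_real k * (Pm f R \<beta> \<epsilon> \<mu> + c * Rm f R \<beta> \<epsilon> \<mu>)"
definition \<omega>2 where "\<omega>2 = (1 - \<beta>)\<^sup>2 - \<mu>\<^sup>2"

lemma \<mu>_pos: "0 < \<mu>" using \<mu> by (simp add: adm_def)
lemma k_pos: "0 < k" by (rule k0_pos[OF \<mu>])

lemma nice_r: "nice r1" "nice r2" "nice r" "nice A"
proof -
  show 1: "nice r1" "nice r2" unfolding r1_def r2_def by (intro resolv_props(1)[OF \<mu> \<epsilon>] nice_g1 nice_g2)+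
  show 3: "nice r" unfolding r_def by (rule nice_lincomb[OF 1])
  show "nice A" unfolding A_def by (rule nice_cmult[OF 3])
qed

lemma r_resolv: "resolv f R \<beta> \<epsilon> \<mu> (\<lambda>j x. g1 f \<beta> \<mu> j x + c * g2 f j x) = r"
  unfolding r_def r1_def r2_def by (rule resolv_lincomb[OF \<mu> \<epsilon> nice_g1 nice_g2])

lemma r_fixpoint: "r m x = g1 f \<beta> \<mu> m x + c * g2 f m x + of_real \<epsilon> * Top f \<beta> \<mu> r m x"
  using resolv_props(2)[OF \<mu> \<epsilon> nice_lincomb[OF nice_g1 nice_g2, of \<mu> c]]
  unfolding fixpoint_def r_resolv by (rule fun_cong[THEN fun_cong])

text \<open>Used with \<open>w = 1\<close> for the scalar equation that fixes \<open>c\<close>, and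
  with plane waves for the scattering coefficients.\<close>

lemma mean_lincomb:
  assumes "continuous_on UNIV w"
  shows "mean (\<lambda>x. A n x * w x) = 2 * eg * (mean (\<lambda>x. r1 n x * w x) + c * mean (\<lambda>x. r2 n x * w x))"
proof -
  have i: "(\<lambda>x. r1 n x * w x) integrable_on UNIV" "(\<lambda>x. r2 n x * w x) integrable_on UNIV"
    by (rule continuous_supported_integrable[of _ R];
        use niceD[OF nice_r(1)] niceD[OF nice_r(2)] assms in \<open>auto intro!: continuous_on_mult\<close>)+
  have "mean (\<lambda>x. A n x * w x) = integral UNIV (\<lambda>x. 2 * eg * (r1 n x * w x + c * (r2 n x * w x)))"
    by (simp add: mean_def A_def r_def algebra_simps)
  also have "\<dots> = 2 * eg * (integral UNIV (\<lambda>x. r1 n x * w x) + integral UNIV (\<lambda>x. c * (r2 n x * w x)))"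
    unfolding integral_mult_right
    by (subst Henstock_Kurzweil_Integration.integral_add[OF i(1) integrable_on_mult_right[OF i(2)]]) simp
  finally show ?thesis by (simp add: mean_def)
qed

text \<open>The scalar equation that determines \<open>C\<close>; the constant \<open>c\<close> is \<open>C / (2\<mu>)\<close>.\<close>

lemma mean_A: "mean (A (-1)) / (2 * of_real \<mu>) = c"
proof -
  have "mean (A (-1)) = 2 * eg * (QQ f R \<beta> \<epsilon> \<mu> + c * FF f R \<beta> \<epsilon> \<mu>)"
    using mean_lincomb[of "\<lambda>_. 1" "-1"] by (simp add: QQ_def FF_def r1_def r2_def)
  moreover have "eg * (QQ f R \<beta> \<epsilon> \<mu> + c * FF f R \<beta> \<epsilon> \<mu>) = c * of_real \<mu>"
  proof -
    have d: "den \<noteq> 0" using nz by (simp add: den_def)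
    have "eg * QQ f R \<beta> \<epsilon> \<mu> = c * den" using d by (simp add: c_def)
    moreover have "den = of_real \<mu> - eg * FF f R \<beta> \<epsilon> \<mu>" by (simp add: den_def eg_def)
    ultimately show ?thesis by (simp add: algebra_simps)
  qed
  ultimately show ?thesis using \<mu>_pos by (simp add: mult.assoc)
qed

lemma A_bound: obtains a where "0 \<le> a" "\<And>n x. norm (A n x) \<le> a / wt n"
  by (rule niceE[OF nice_r(4)]) (rule that)

text \<open>Replacing \<open>Gr\<close> by \<open>Hr\<close> turns the mean of the component -1 into
  the additive constant \<open>c\<close>. Multiplied by \<open>fcoef f (m - n)\<close>, the incident
  wave and this constant become \<open>g1\<close> and \<open>c * g2\<close>.\<close>

lemma \<Psi>_Hr:
  "\<Psi> n x = conv (Hr \<beta> \<mu> n) (A n) x + (if n = 0 then cis (k * x) else 0) + (if n = -1 then c else 0)"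
proof (cases "n = -1")
  case True
  then show ?thesis using Gr_Hr_shift[OF \<mu> nice_r(4), of x] mean_A by (simp add: \<Psi>_def)
next
  case False
  then have "Hr \<beta> \<mu> n = Gr \<beta> \<mu> n" by (intro ext) (simp add: Hr_def)
  then show ?thesis using False by (simp add: \<Psi>_def)
qed

text \<open>The fixed-point equation read backwards: \<open>Top\<close> supplies the convolutions
  with \<open>Hr\<close>, and the two data supply the remaining terms of
  \<open>\<Psi>_Hr\<close>.\<close>

lemma A_has_sum: "((\<lambda>n. 2 * eg * (\<Psi> n x * fcoef f (m - n) x)) has_sum A m x) UNIV"
proof -
  obtain a where a: "0 \<le> a" "\<And>n x. norm (r n x) \<le> a / wt n" by (rule niceE[OF nice_r(3)]) (rule that)
  let ?t = "\<lambda>n. conv (Hr \<beta> \<mu> n) (r n) x * fcoef f (m - n) x"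
  have s: "(?t has_sum infsum ?t UNIV) UNIV"
    by (rule has_sum_infsum[OF Top_summable(2)[OF \<mu> nice_supp_seq[OF nice_r(3)] weight_wt a]])
  have d: "((\<lambda>n. if n = l then z n else 0) has_sum z l) UNIV" for l :: int and z :: "int \<Rightarrow> complex"
    using has_sum_finite_neutralI[of "{l}" UNIV "\<lambda>n. if n = l then z n else 0"] by simp
  have "((\<lambda>n. 2 * eg * (2 * eg * ?t n + ((if n = 0 then cis (k * x) * fcoef f (m - n) x else 0) + (if n = -1 then c * fcoef f (m - n) x else 0)))) has_sum
     2 * eg * (2 * eg * infsum ?t UNIV + (cis (k * x) * fcoef f (m - 0) x + c * fcoef f (m - (-1)) x))) UNIV"
    by (intro has_sum_cmult_right has_sum_add s d)
  moreover have "2 * eg * (2 * eg * infsum ?t UNIV + (cis (k * x) * fcoef f (m - 0) x + c * fcoef f (m - (-1)) x)) = A m x"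
    unfolding A_def r_fixpoint[of m x] by (simp add: Top_def g1_def g2_def eg_def algebra_simps)
  moreover have "2 * eg * (2 * eg * ?t n + ((if n = 0 then cis (k * x) * fcoef f (m - n) x else 0) + (if n = -1 then c * fcoef f (m - n) x else 0)))
     = 2 * eg * (\<Psi> n x * fcoef f (m - n) x)" for n
    unfolding \<Psi>_Hr A_def conv_cmult by (auto simp: algebra_simps)
  ultimately show ?thesis by simp
qed

lemma \<Psi>_deriv: "(\<Psi> j has_vector_derivative \<Psi>' j x) (at x)"
proof -
  have 0: "((\<lambda>x. if j = 0 then cis (k * x) else 0) has_vector_derivative (if j = 0 then \<i> * of_real k * cis (k * x) else 0)) (at x)"
    using mode_deriv[of k 0 x] by (cases "j = 0") (simp_all add: mode_def[abs_def])
  show ?thesis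
    unfolding \<Psi>_def[abs_def] \<Psi>'_def Gr_gk[OF \<mu>]
    by (rule has_vector_derivative_add[OF 0 conv_gk_deriv(1)[OF niceD(1)[OF nice_r(4)] niceD(2)[OF nice_r(4)] kap_nonzero[OF \<mu>]]])
qed

lemma \<Psi>'_deriv: "(\<Psi>' j has_vector_derivative of_real ((\<beta> + of_int j)\<^sup>2 - \<omega>2) * \<Psi> j x - A j x) (at x)"
proof -
  have "((\<lambda>x. \<i> * of_real k * cis (k * x)) has_vector_derivative \<i> * of_real k * (\<i> * of_real k * cis (k * x))) (at x)"
    using has_vector_derivative_mult_right[OF mode_deriv[of k 0 x], of "\<i> * of_real k"] by (simp add: mode_def[abs_def])
  then have 0: "((\<lambda>x. if j = 0 then \<i> * of_real k * cis (k * x) else 0) has_vector_derivative (if j = 0 then \<i> * of_real k * (\<i> * of_real k * cis (k * x)) else 0)) (at x)"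
    by (cases "j = 0") simp_all
  have D: "(\<Psi>' j has_vector_derivative (if j = 0 then \<i> * of_real k * (\<i> * of_real k * cis (k * x)) else 0) + ((kap \<mu> j)\<^sup>2 * conv (gk (kap \<mu> j)) (A j) x - A j x)) (at x)"
    unfolding \<Psi>'_def[abs_def]
    by (rule has_vector_derivative_add[OF 0 conv_gk_deriv(2)[OF niceD(1)[OF nice_r(4)] niceD(2)[OF nice_r(4)] kap_nonzero[OF \<mu>]]])
  have "(if j = 0 then \<i> * of_real k * (\<i> * of_real k * cis (k * x)) else 0) = (kap \<mu> j)\<^sup>2 * (if j = 0 then cis (k * x) else 0)"
    by (simp add: kap_def power2_eq_square)
  then have "(if j = 0 then \<i> * of_real k * (\<i> * of_real k * cis (k * x)) else 0) + ((kap \<mu> j)\<^sup>2 * conv (gk (kap \<mu> j)) (A j) x - A j x)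
     = of_real ((\<beta> + of_int j)\<^sup>2 - \<omega>2) * \<Psi> j x - A j x"
    unfolding \<Psi>_def Gr_gk[OF \<mu>] \<omega>2_def kap_square[OF \<mu>, symmetric] by (simp only: distrib_left add_diff_eq)
  then show ?thesis by (rule has_vector_derivative_eq_rhs[OF D])
qed

text \<open>The mode -1 has the smallest exponent among the evanescent ones, namely
  \<open>\<mu>\<close>, so one rate serves all \<open>j \<noteq> 0\<close>. The mode 0 propagates
  and is merely bounded.\<close>

lemma decay_bounds:
  obtains B where "0 \<le> B" "\<And>j x. norm (\<Psi> j x) \<le> B / wt j" "\<And>j x. norm (\<Psi>' j x) \<le> B / wt j" "\<And>j x. norm (A j x) \<le> B / wt j"
    "\<And>j x. j \<noteq> 0 \<Longrightarrow> norm (\<Psi> j x) \<le> B / wt j * exp (- \<mu> * \<bar>x\<bar>)" "\<And>j x. j \<noteq> 0 \<Longrightarrow> norm (\<Psi>' j x) \<le> B / wt j * exp (- \<mu> * \<bar>x\<bar>)"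
proof -
  obtain a where a: "0 \<le> a" "\<And>n x. norm (A n x) \<le> a / wt n" by (rule A_bound) (rule that)
  note nA = niceD[OF nice_r(4)]
  have R0: "0 \<le> R" using R_pos by simp
  define K where "K = 2 * R * exp (\<mu> * R)"
  have K: "0 \<le> K" "2 * R \<le> K" using R0 \<mu>_pos mult_left_mono[of 1 "exp (\<mu> * R)" "2 * R"] by (auto simp: K_def)
  \<comment> \<open>The terms \<open>1 / \<mu>\<close> and \<open>1 / k\<close> come from the Green
    functions, the third from the differentiated potentials, \<open>1\<close> and \<open>k\<close>
    from the incident wave and its derivative, \<open>a\<close> from the source.\<close>
  define B where "B = K * a * (1 / \<mu> + 1 / k + 1) + 1 + k + a"
  have t: "0 \<le> K * a / \<mu>" "0 \<le> K * a / k" "0 \<le> K * a" using K a(1) \<mu>_pos k_pos by auto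
  have Bexp: "B = K * a / \<mu> + K * a / k + K * a + 1 + k + a" by (simp add: B_def algebra_simps)
  have Ble: "K * a / \<mu> \<le> B" "K * a \<le> B" "a \<le> B" "1 + K * a / k \<le> B" "k + K * a \<le> B"
    using t a(1) k_pos unfolding Bexp by linarith+
  have B0: "0 \<le> B" using Ble(3) a(1) by linarith
  have e1: "\<Psi> j x = conv (gk (kap \<mu> j)) (A j) x" "\<Psi>' j x = dgk_conv (kap \<mu> j) (A j) x" if "j \<noteq> 0" for j x
    using that by (simp_all add: \<Psi>_def \<Psi>'_def Gr_gk[OF \<mu>])
  have dec: "norm (\<Psi> j x) \<le> B / wt j * exp (- \<mu> * \<bar>x\<bar>) \<and> norm (\<Psi>' j x) \<le> B / wt j * exp (- \<mu> * \<bar>x\<bar>)" if j: "j \<noteq> 0" for j x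
  proof -
    have re: "\<mu> \<le> Re (kap \<mu> j)" using km_lower[OF \<mu> j] j by (simp add: kap_def)
    have nk: "\<mu> \<le> norm (kap \<mu> j)" using re complex_Re_le_cmod order_trans by blast
    have g: "norm (conv (gk (kap \<mu> j)) (A j) x) \<le> 2 * R * exp (\<mu> * R) / norm (kap \<mu> j) * (a / wt j) * exp (- \<mu> * \<bar>x\<bar>)"
      "norm (dgk_conv (kap \<mu> j) (A j) x) \<le> 2 * R * exp (\<mu> * R) * (a / wt j) * exp (- \<mu> * \<bar>x\<bar>)"
      by (rule gk_bounds[OF nA R0 a(2) _ re]; use \<mu>_pos in simp)+
    have "K / norm (kap \<mu> j) * (a / wt j) \<le> B / wt j"
    proof -
      have "K / norm (kap \<mu> j) \<le> K / \<mu>" using nk \<mu>_pos K by (intro divide_left_mono mult_pos_pos) auto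
      then have "K / norm (kap \<mu> j) * (a / wt j) \<le> K / \<mu> * (a / wt j)" using a(1) wt_pos[of j] by (intro mult_right_mono) auto
      also have "\<dots> = (K * a / \<mu>) / wt j" by simp
      also have "\<dots> \<le> B / wt j" using Ble(1) wt_pos[of j] by (intro divide_right_mono) auto
      finally show ?thesis .
    qed
    then have 1: "K / norm (kap \<mu> j) * (a / wt j) * exp (- \<mu> * \<bar>x\<bar>) \<le> B / wt j * exp (- \<mu> * \<bar>x\<bar>)" by (rule mult_right_mono) simp
    have "K * (a / wt j) \<le> B / wt j" using divide_right_mono[OF Ble(2), of "wt j"] wt_pos[of j] by simp
    then have 2: "K * (a / wt j) * exp (- \<mu> * \<bar>x\<bar>) \<le> B / wt j * exp (- \<mu> * \<bar>x\<bar>)" by (rule mult_right_mono) simp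
    show ?thesis unfolding e1[OF j] using g[folded K_def] 1 2 by linarith
  qed
  have w0: "wt 0 = 1" by (simp add: wt_def)
  have zero: "norm (\<Psi> 0 x) \<le> B / wt 0 \<and> norm (\<Psi>' 0 x) \<le> B / wt 0" for x
  proof -
    have n0: "norm (kap \<mu> 0) = k" using k_pos by (simp add: kap_def norm_mult)
    \<comment> \<open>The rate is 0 here because \<open>kap \<mu> 0\<close> is purely
      imaginary.\<close>
    have g: "norm (conv (gk (kap \<mu> 0)) (A 0) x) \<le> 2 * R * exp (0 * R) / norm (kap \<mu> 0) * (a / wt 0) * exp (- 0 * \<bar>x\<bar>)"
      "norm (dgk_conv (kap \<mu> 0) (A 0) x) \<le> 2 * R * exp (0 * R) * (a / wt 0) * exp (- 0 * \<bar>x\<bar>)"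
      by (rule gk_bounds[OF nA R0 a(2)]; simp add: kap_def)+
    have "2 * R / k * a \<le> K * a / k" using K a(1) k_pos by (simp add: divide_right_mono mult_right_mono)
    then have "norm (conv (gk (kap \<mu> 0)) (A 0) x) \<le> K * a / k" using g(1) n0 w0 by simp
    moreover have "norm (dgk_conv (kap \<mu> 0) (A 0) x) \<le> K * a"
      using g(2) w0 mult_right_mono[OF K(2) a(1)] by simp
    moreover have "norm (\<Psi> 0 x) \<le> 1 + norm (conv (gk (kap \<mu> 0)) (A 0) x)"
      using norm_triangle_ineq[of "cis (k * x)" "conv (gk (kap \<mu> 0)) (A 0) x"] by (simp add: \<Psi>_def Gr_gk[OF \<mu>])
    moreover have "norm (\<Psi>' 0 x) \<le> k + norm (dgk_conv (kap \<mu> 0) (A 0) x)"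
      using norm_triangle_ineq[of "\<i> * of_real k * cis (k * x)" "dgk_conv (kap \<mu> 0) (A 0) x"] k_pos by (simp add: \<Psi>'_def norm_mult)
    ultimately show ?thesis unfolding w0 using Ble(4,5) by simp
  qed
  have all: "norm (\<Psi> j x) \<le> B / wt j \<and> norm (\<Psi>' j x) \<le> B / wt j" for j x
  proof (cases "j = 0")
    case False
    have "B / wt j * exp (- \<mu> * \<bar>x\<bar>) \<le> B / wt j" using B0 wt_pos[of j] \<mu>_pos by (intro mult_left_le) auto
    then show ?thesis using dec[OF False, of x] by linarith
  qed (use zero in simp)
  have An: "norm (A j x) \<le> B / wt j" for j x
    using a(2)[of j x] divide_right_mono[OF Ble(3), of "wt j"] wt_pos[of j] by linarith
  show thesis by (rule that[OF B0]) (use all An dec in blast)+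
qed

lemma weight_summable: "(\<lambda>j. (1 + \<bar>of_int j\<bar>) * (B / wt j)) summable_on UNIV"
proof -
  have "(1 + \<bar>of_int j\<bar>) * (B / wt j) = B * sq j" for j :: int
  proof -
    have "t * (B / t^3) = B * (1 / t\<^sup>2)" if "0 < t" for t :: real
      using that by (simp add: power2_eq_square power3_eq_cube)
    from this[of "1 + \<bar>of_int j\<bar>"] show ?thesis by (simp add: wt_def sq_def)
  qed
  then show ?thesis using summable_on_cmult_right[OF sq_summable, of B] by simp
qed

lemma weight_summable': "(\<lambda>j. B / wt j) summable_on UNIV" if "0 \<le> B"
proof (rule summable_on_comparison_test[OF weight_summable[of B]])
  show "B / wt j \<le> (1 + \<bar>of_int j\<bar>) * (B / wt j)" for j
    using mult_right_mono[of 1 "1 + \<bar>real_of_int j\<bar>" "B / wt j"] that wt_pos[of j] by simp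
qed (use that wt_pos in \<open>auto intro!: divide_nonneg_nonneg simp: less_imp_le\<close>)

text \<open>By Fourier inversion the convolution defining \<open>A\<close> is multiplication by \<open>f\<close>.\<close>

lemma Sser_source:
  assumes y: "snd p \<in> {0..2*pi}"
  shows "Sser \<beta> (\<lambda>j x. of_real \<omega>2 * \<Psi> j x + A j x) p = of_real \<omega>2 * (of_real (1 + \<epsilon> * f p) * Sser \<beta> \<Psi> p)"
proof -
  obtain B where B: "0 \<le> B" "\<And>j x. norm (\<Psi> j x) \<le> B / wt j" "\<And>j x. norm (\<Psi>' j x) \<le> B / wt j" "\<And>j x. norm (A j x) \<le> B / wt j"
    "\<And>j x. j \<noteq> 0 \<Longrightarrow> norm (\<Psi> j x) \<le> B / wt j * exp (- \<mu> * \<bar>x\<bar>)" "\<And>j x. j \<noteq> 0 \<Longrightarrow> norm (\<Psi>' j x) \<le> B / wt j * exp (- \<mu> * \<bar>x\<bar>)"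
    by (rule decay_bounds) (rule that)
  note sB = weight_summable'[OF B(1)]
  define x where "x = fst p"
  define y where "y = snd p"
  have hP: "((\<lambda>j. \<Psi> j x * mode \<beta> j y) has_sum Sser \<beta> \<Psi> p) UNIV"
    unfolding x_def y_def by (rule Sser_has_sum[OF B(2) sB])
  have nP: "(\<lambda>j. norm (\<Psi> j x * mode \<beta> j y)) summable_on UNIV"
    by (rule norm_summable_comparison(1)[OF sB]) (use B(2) in \<open>simp add: norm_mult\<close>)
  have hf: "((\<lambda>j. fcoef f j x * cis (of_int j * y)) has_sum 2 * of_real pi * of_real (f p)) UNIV"
    using fcoef_inversion[OF assms, of x] by (simp add: x_def y_def)
  have nf: "(\<lambda>j. norm (fcoef f j x * cis (of_int j * y))) summable_on UNIV"
    using fcoef_norm_summable[of x] by (simp add: norm_mult)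
  have "((\<lambda>m. A m x * mode \<beta> m y) has_sum (2 * eg * Sser \<beta> \<Psi> p) * (2 * of_real pi * of_real (f p))) UNIV"
  proof (rule has_sum_cauchy_product[where a = "\<lambda>n. 2 * eg * (\<Psi> n x * mode \<beta> n y)"])
    show "(\<lambda>n. norm (2 * eg * (\<Psi> n x * mode \<beta> n y))) summable_on UNIV"
      using summable_on_cmult_right[OF nP, of "norm (2 * eg)"] by (simp only: norm_mult)
    show "((\<lambda>n. 2 * eg * (\<Psi> n x * mode \<beta> n y)) has_sum 2 * eg * Sser \<beta> \<Psi> p) UNIV"
      by (rule has_sum_cmult_right[OF hP])
    show "((\<lambda>n. 2 * eg * (\<Psi> n x * mode \<beta> n y) * (fcoef f (m - n) x * cis (of_int (m - n) * y))) has_sum A m x * mode \<beta> m y) UNIV" for m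
    proof -
      have "mode \<beta> n y * cis (of_int (m - n) * y) = mode \<beta> m y" for n
        by (simp add: mode_def cis_mult algebra_simps)
      then have *: "2 * eg * (\<Psi> n x * mode \<beta> n y) * (fcoef f (m - n) x * cis (of_int (m - n) * y)) = 2 * eg * (\<Psi> n x * fcoef f (m - n) x) * mode \<beta> m y" for n
        by (simp only: mult.assoc mult.left_commute[of "mode \<beta> n y"])
      show ?thesis unfolding * by (rule has_sum_cmult_left[OF A_has_sum])
    qed
  qed (rule nf hf)+
  then have S1: "((\<lambda>m. of_real \<omega>2 * (\<Psi> m x * mode \<beta> m y) + A m x * mode \<beta> m y) has_sum
      of_real \<omega>2 * Sser \<beta> \<Psi> p + (2 * eg * Sser \<beta> \<Psi> p) * (2 * of_real pi * of_real (f p))) UNIV"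
    by (intro has_sum_add has_sum_cmult_right hP)
  have E: "(2 * eg * Sser \<beta> \<Psi> p) * (2 * of_real pi * of_real (f p)) = of_real \<omega>2 * (of_real (\<epsilon> * f p) * Sser \<beta> \<Psi> p)"
  proof -
    \<comment> \<open>The 2 in \<open>2 * eg\<close> and the \<open>2 * pi\<close> of the
      unnormalised Fourier series combine to
      \<open>4 * pi * gam \<mu> \<beta> = \<omega>2\<close>.\<close>
    have "2 * gam \<mu> \<beta> * (2 * pi) = \<omega>2" by (simp add: gam_def \<omega>2_def)
    then have "complex_of_real \<omega>2 = 2 * of_real (gam \<mu> \<beta>) * (2 * of_real pi)" by (metis of_real_mult of_real_numeral)
    then show ?thesis by (simp add: eg_def)
  qed
  have val: "of_real \<omega>2 * Sser \<beta> \<Psi> p + (2 * eg * Sser \<beta> \<Psi> p) * (2 * of_real pi * of_real (f p)) = of_real \<omega>2 * (of_real (1 + \<epsilon> * f p) * Sser \<beta> \<Psi> p)"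
    unfolding E by (simp add: distrib_left distrib_right)
  have 1: "((\<lambda>m. (of_real \<omega>2 * \<Psi> m x + A m x) * mode \<beta> m y) has_sum of_real \<omega>2 * (of_real (1 + \<epsilon> * f p) * Sser \<beta> \<Psi> p)) UNIV"
    using S1 unfolding val by (simp only: distrib_right mult.assoc)
  have "((\<lambda>m. (of_real \<omega>2 * \<Psi> m (fst p) + A m (fst p)) * mode \<beta> m (snd p)) has_sum Sser \<beta> (\<lambda>j x. of_real \<omega>2 * \<Psi> j x + A j x) p) UNIV"
  proof (rule Sser_has_sum)
    show "norm (of_real \<omega>2 * \<Psi> j (fst p) + A j (fst p)) \<le> (\<bar>\<omega>2\<bar> * B + B) / wt j" for j
    proof -
      have "norm (of_real \<omega>2 * \<Psi> j (fst p) + A j (fst p)) \<le> \<bar>\<omega>2\<bar> * norm (\<Psi> j (fst p)) + norm (A j (fst p))"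
        using norm_triangle_ineq[of "of_real \<omega>2 * \<Psi> j (fst p)" "A j (fst p)"] by (simp add: norm_mult)
      also have "\<dots> \<le> \<bar>\<omega>2\<bar> * (B / wt j) + B / wt j" by (intro add_mono mult_left_mono B) auto
      finally show ?thesis by (simp add: add_divide_distrib)
    qed
    show "(\<lambda>j. (\<bar>\<omega>2\<bar> * B + B) / wt j) summable_on UNIV" by (rule weight_summable') (use B(1) in simp)
  qed
  then show ?thesis using 1 unfolding x_def y_def by (rule has_sum_unique)
qed

lemma weak_solution: "weak_sol_P \<omega>2 \<epsilon> f \<beta> (Sser \<beta> \<Psi>)"
proof -
  obtain B where B: "0 \<le> B" "\<And>j x. norm (\<Psi> j x) \<le> B / wt j" "\<And>j x. norm (\<Psi>' j x) \<le> B / wt j" "\<And>j x. norm (A j x) \<le> B / wt j"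
    "\<And>j x. j \<noteq> 0 \<Longrightarrow> norm (\<Psi> j x) \<le> B / wt j * exp (- \<mu> * \<bar>x\<bar>)" "\<And>j x. j \<noteq> 0 \<Longrightarrow> norm (\<Psi>' j x) \<le> B / wt j * exp (- \<mu> * \<bar>x\<bar>)"
    by (rule decay_bounds) (rule that)
  note * = \<Psi>_deriv \<Psi>'_deriv niceD(1)[OF nice_r(4)] B(2-4) weight_summable[of B]
  have "integral strip (\<lambda>p. Sser \<beta> \<Psi>' p * cnj (px \<Phi> p) + Sser \<beta> (\<lambda>j x. \<i> * of_real (\<beta> + of_int j) * \<Psi> j x) p * cnj (py \<Phi> p))
      = of_real \<omega>2 * integral strip (\<lambda>p. of_real (1 + \<epsilon> * f p) * Sser \<beta> \<Psi> p * cnj (\<Phi> p))" if "test_beta \<beta> \<Phi>" for \<Phi>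
  proof -
    have "integral strip (\<lambda>p. Sser \<beta> (\<lambda>j x. of_real \<omega>2 * \<Psi> j x + A j x) p * cnj (\<Phi> p))
      = integral strip (\<lambda>p. of_real \<omega>2 * (of_real (1 + \<epsilon> * f p) * Sser \<beta> \<Psi> p * cnj (\<Phi> p)))"
    proof (rule integral_cong)
      fix p assume "p \<in> strip"
      then have "snd p \<in> {0..2*pi}" by (auto simp: strip_def)
      then show "Sser \<beta> (\<lambda>j x. of_real \<omega>2 * \<Psi> j x + A j x) p * cnj (\<Phi> p) = of_real \<omega>2 * (of_real (1 + \<epsilon> * f p) * Sser \<beta> \<Psi> p * cnj (\<Phi> p))"
        by (simp only: Sser_source mult.assoc)
    qed
    then show ?thesis using Sser_green[OF * that] by simp
  qed
  then show ?thesis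
    unfolding weak_sol_P_def using Sser_weak_grad[OF *] by blast
qed

text \<open>To the right of all sources the modulus in the kernel opens with a fixed sign, so the
  kernel factors into a plane wave in \<open>x\<close> and one in \<open>\<xi>\<close>; the mean
  against the latter is the coefficient.\<close>

lemma \<Psi>0_right:
  assumes "x > R" shows "\<Psi> 0 x = Tc * cis (k * x)"
proof -
  have cs: "conv (Gr \<beta> \<mu> 0) (A 0) x = integral {-R..R} (\<lambda>\<xi>. Gr \<beta> \<mu> 0 (x - \<xi>) * A 0 \<xi>)"
    by (rule conv_supported[OF niceD(2)[OF nice_r(4)]])
  have "conv (Gr \<beta> \<mu> 0) (A 0) x = integral {-R..R} (\<lambda>\<xi>. \<i> / (2 * of_real k) * cis (k * x) * (A 0 \<xi> * cis (- k * \<xi>)))"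
    unfolding cs
  proof (rule integral_cong)
    fix \<xi> assume "\<xi> \<in> {-R..R}"
    then have "\<bar>x - \<xi>\<bar> = x - \<xi>" using assms by auto
    then have "cis (k * \<bar>x - \<xi>\<bar>) = cis (k * x) * cis (- k * \<xi>)" by (simp add: cis_mult algebra_simps)
    then show "Gr \<beta> \<mu> 0 (x - \<xi>) * A 0 \<xi> = \<i> / (2 * of_real k) * cis (k * x) * (A 0 \<xi> * cis (- k * \<xi>))"
      by (simp add: Gr_def)
  qed
  also have "\<dots> = \<i> / (2 * of_real k) * cis (k * x) * mean (\<lambda>\<xi>. A 0 \<xi> * cis (- k * \<xi>))"
    unfolding mean_def integral_mult_right
    by (subst integral_eq_supported[of UNIV "{-R..R}"]) (use niceD(2)[OF nice_r(4)] in auto)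
  also have "mean (\<lambda>\<xi>. A 0 \<xi> * cis (- k * \<xi>)) = 2 * eg * (Pm f R \<beta> \<epsilon> \<mu> + c * Rm f R \<beta> \<epsilon> \<mu>)"
    unfolding Pm_def Rm_def r1_def[symmetric] r2_def[symmetric] by (rule mean_lincomb) (intro continuous_intros)
  finally show ?thesis using k_pos by (simp add: \<Psi>_def Tc_def algebra_simps)
qed

lemma \<Psi>0_left:
  assumes "x < - R" shows "\<Psi> 0 x = cis (k * x) + Rc * cis (- k * x)"
proof -
  have cs: "conv (Gr \<beta> \<mu> 0) (A 0) x = integral {-R..R} (\<lambda>\<xi>. Gr \<beta> \<mu> 0 (x - \<xi>) * A 0 \<xi>)"
    by (rule conv_supported[OF niceD(2)[OF nice_r(4)]])
  have "conv (Gr \<beta> \<mu> 0) (A 0) x = integral {-R..R} (\<lambda>\<xi>. \<i> / (2 * of_real k) * cis (- k * x) * (A 0 \<xi> * cis (k * \<xi>)))"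
    unfolding cs
  proof (rule integral_cong)
    fix \<xi> assume "\<xi> \<in> {-R..R}"
    then have "\<bar>x - \<xi>\<bar> = \<xi> - x" using assms by auto
    then have "cis (k * \<bar>x - \<xi>\<bar>) = cis (- k * x) * cis (k * \<xi>)" by (simp add: cis_mult algebra_simps)
    then show "Gr \<beta> \<mu> 0 (x - \<xi>) * A 0 \<xi> = \<i> / (2 * of_real k) * cis (- k * x) * (A 0 \<xi> * cis (k * \<xi>))"
      by (simp add: Gr_def)
  qed
  also have "\<dots> = \<i> / (2 * of_real k) * cis (- k * x) * mean (\<lambda>\<xi>. A 0 \<xi> * cis (k * \<xi>))"
    unfolding mean_def integral_mult_right
    by (subst integral_eq_supported[of UNIV "{-R..R}"]) (use niceD(2)[OF nice_r(4)] in auto)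
  also have "mean (\<lambda>\<xi>. A 0 \<xi> * cis (k * \<xi>)) = 2 * eg * (Pp f R \<beta> \<epsilon> \<mu> + c * Rp f R \<beta> \<epsilon> \<mu>)"
    unfolding Pp_def Rp_def r1_def[symmetric] r2_def[symmetric] by (rule mean_lincomb) (intro continuous_intros)
  finally show ?thesis using k_pos by (simp add: \<Psi>_def Rc_def algebra_simps)
qed

text \<open>Beyond the potential and the transition of \<open>chi\<close> the mode 0 equals the
  subtracted waves exactly, so its remainder has compact support and satisfies any exponential
  bound; the other modes decay already.\<close>

lemma radiation:
  assumes chi: "cutoff chi"
  shows "H1beta \<beta> (\<lambda>(x, y). Sser \<beta> \<Psi> (x, y) - of_real (chi x) * Tc * cis (\<beta> * y + k * x)
      - of_real (chi (- x)) * (cis (\<beta> * y + k * x) + Rc * cis (\<beta> * y - k * x)))"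
proof -
  obtain B where B: "0 \<le> B" "\<And>j x. norm (\<Psi> j x) \<le> B / wt j" "\<And>j x. norm (\<Psi>' j x) \<le> B / wt j" "\<And>j x. norm (A j x) \<le> B / wt j"
    "\<And>j x. j \<noteq> 0 \<Longrightarrow> norm (\<Psi> j x) \<le> B / wt j * exp (- \<mu> * \<bar>x\<bar>)" "\<And>j x. j \<noteq> 0 \<Longrightarrow> norm (\<Psi>' j x) \<le> B / wt j * exp (- \<mu> * \<bar>x\<bar>)"
    by (rule decay_bounds) (rule that)
  obtain cb chi' where "1 \<le> cb" and chi': "\<And>x. (chi has_real_derivative chi' x) (at x)" "continuous_on UNIV chi'"
    and "\<And>x. \<bar>chi x\<bar> \<le> cb" "\<And>x. \<bar>chi' x\<bar> \<le> cb" "\<And>x. x > 1 \<or> x < 0 \<Longrightarrow> chi' x = 0"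
    by (rule cutoff_derivative[OF chi]) (rule that)
  \<comment> \<open>The subtracted waves without their factor in \<open>y\<close>: they belong to
    the mode 0 alone, so all other modes stay unchanged.\<close>
  define s where "s x = of_real (chi x) * (Tc * cis (k * x)) + of_real (chi (- x)) * (cis (k * x) + Rc * cis (- k * x))" for x
  define s' where "s' x = of_real (chi x) * (Tc * (\<i> * of_real k * cis (k * x))) + of_real (chi' x) * (Tc * cis (k * x))
      + (of_real (chi (- x)) * (\<i> * of_real k * cis (k * x) + Rc * (\<i> * of_real (- k) * cis (- k * x)))
        + of_real (- chi' (- x)) * (cis (k * x) + Rc * cis (- k * x)))" for x
  have cd: "((\<lambda>x. cis (q * x)) has_vector_derivative \<i> * of_real q * cis (q * x)) (at x)" for q x
    using mode_deriv[of q 0 x] by (simp add: mode_def[abs_def])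
  have chd: "((\<lambda>x. of_real (chi x) :: complex) has_vector_derivative of_real (chi' x)) (at x)"
    "((\<lambda>x. of_real (chi (- x)) :: complex) has_vector_derivative of_real (- chi' (- x))) (at x)" for x
    using cutoff_affine_deriv[OF chi'(1), of 0 1 x] cutoff_affine_deriv[OF chi'(1), of 0 "-1" x] by simp_all
  have sd: "(s has_vector_derivative s' x) (at x)" for x
    unfolding s_def[abs_def] s'_def
    by (intro has_vector_derivative_add has_vector_derivative_mult has_vector_derivative_mult_right chd cd)
  have chc: "continuous_on UNIV chi" using chi'(1) by (meson DERIV_isCont continuous_at_imp_continuous_on)
  have s'c: "continuous_on UNIV s'"
    unfolding s'_def[abs_def]
    by (intro continuous_intros chc chi'(2) continuous_on_compose2[OF chc] continuous_on_compose2[OF chi'(2)]) auto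
  define u where "u j x = \<Psi> j x - (if j = 0 then s x else 0)" for j x
  define u' where "u' j x = \<Psi>' j x - (if j = 0 then s' x else 0)" for j x
  have ud: "(u j has_vector_derivative u' j x) (at x)" for j x
    unfolding u_def[abs_def] u'_def using has_vector_derivative_diff[OF \<Psi>_deriv sd] \<Psi>_deriv by (cases "j = 0") simp_all
  have \<Psi>'c: "continuous_on UNIV (\<Psi>' j)" for j
    using \<Psi>'_deriv by (meson continuous_at_imp_continuous_on has_vector_derivative_continuous)
  have u'c: "continuous_on UNIV (u' j)" for j
    unfolding u'_def[abs_def] using continuous_on_diff[OF \<Psi>'c s'c] \<Psi>'c by (cases "j = 0") simp_all
  \<comment> \<open>\<open>R\<close> bounds the support of the potential, and 1 the transition
    region of the cut-off.\<close>
  define L where "L = max R 1"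
  have u0: "u 0 x = 0" if "\<bar>x\<bar> > L" for x
  proof (cases "x > 0")
    case True
    then have "x > R" "x > 1" using that by (auto simp: L_def)
    then have "chi x = 1" "chi (- x) = 0" using chi unfolding cutoff_def by auto
    then show ?thesis using \<Psi>0_right[OF \<open>x > R\<close>] by (simp add: u_def s_def)
  next
    case False
    then have "x < - R" "x < - 1" using that by (auto simp: L_def)
    then have "chi x = 0" "chi (- x) = 1" using chi unfolding cutoff_def by auto
    then show ?thesis using \<Psi>0_left[OF \<open>x < - R\<close>] by (simp add: u_def s_def)
  qed
  have u'0: "u' 0 x = 0" if "\<bar>x\<bar> > L" for x
  proof -
    have "open {t. L < \<bar>t\<bar>}" by (intro open_Collect_less continuous_intros)
    from vector_derivative_zero_near[OF ud this, of x 0] show ?thesis using u0 that by simp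
  qed
  have uc: "continuous_on UNIV (u 0)"
    using ud by (meson continuous_at_imp_continuous_on has_vector_derivative_continuous)
  obtain B1 where B1: "0 \<le> B1" "\<And>x. norm (u 0 x) \<le> B1" by (rule continuous_supported_bounded[OF uc u0]) (assumption, rule that)
  obtain B2 where B2: "0 \<le> B2" "\<And>x. norm (u' 0 x) \<le> B2" by (rule continuous_supported_bounded[OF u'c u'0]) (assumption, rule that)
  \<comment> \<open>The factor \<open>exp (\<mu> * L)\<close> compensates the smallest value of the
    exponential weight on the support of the remaining mode 0.\<close>
  define M where "M = B + (B1 + B2) * exp (\<mu> * L)"
  have M: "0 \<le> M" "B \<le> M" using B(1) B1(1) B2(1) by (auto simp: M_def)
  have w0: "wt 0 = 1" by (simp add: wt_def)
  have z: "norm (u 0 x) \<le> M / wt 0 * exp (- \<mu> * \<bar>x\<bar>) \<and> norm (u' 0 x) \<le> M / wt 0 * exp (- \<mu> * \<bar>x\<bar>)" for x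
  proof (cases "\<bar>x\<bar> > L")
    case True
    then show ?thesis using u0 u'0 M w0 by simp
  next
    case False
    then have "1 \<le> exp (\<mu> * L) * exp (- \<mu> * \<bar>x\<bar>)" using \<mu>_pos by (simp flip: exp_add)
    then have "(B1 + B2) * 1 \<le> (B1 + B2) * (exp (\<mu> * L) * exp (- \<mu> * \<bar>x\<bar>))" using B1(1) B2(1) by (intro mult_left_mono) auto
    also have "\<dots> \<le> M * exp (- \<mu> * \<bar>x\<bar>)" unfolding M_def mult.assoc[symmetric] using B(1) by (intro mult_right_mono) auto
    finally have le: "B1 + B2 \<le> M * exp (- \<mu> * \<bar>x\<bar>)" by simp
    have "norm (u 0 x) \<le> M * exp (- \<mu> * \<bar>x\<bar>)" using B1(2)[of x] B2(1) le by linarith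
    moreover have "norm (u' 0 x) \<le> M * exp (- \<mu> * \<bar>x\<bar>)" using B2(2)[of x] B1(1) le by linarith
    ultimately show ?thesis by (simp add: w0)
  qed
  have bd: "norm (u j x) \<le> M / wt j * exp (- \<mu> * \<bar>x\<bar>)" "norm (u' j x) \<le> M / wt j * exp (- \<mu> * \<bar>x\<bar>)" for j x
  proof -
    have "norm (u j x) \<le> M / wt j * exp (- \<mu> * \<bar>x\<bar>) \<and> norm (u' j x) \<le> M / wt j * exp (- \<mu> * \<bar>x\<bar>)"
    proof (cases "j = 0")
      case False
      have "B / wt j * exp (- \<mu> * \<bar>x\<bar>) \<le> M / wt j * exp (- \<mu> * \<bar>x\<bar>)"
        using M(2) wt_pos[of j] by (intro mult_right_mono divide_right_mono) auto
      then show ?thesis using B(5,6)[OF False, of x] False by (simp add: u_def u'_def)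
    qed (use z in simp)
    then show "norm (u j x) \<le> M / wt j * exp (- \<mu> * \<bar>x\<bar>)" "norm (u' j x) \<le> M / wt j * exp (- \<mu> * \<bar>x\<bar>)" by auto
  qed
  have H: "H1beta \<beta> (Sser \<beta> u)"
    by (rule H1beta_Sser[OF chi \<mu>_pos ud u'c bd weight_summable])
  have "Sser \<beta> u (x, y) = Sser \<beta> \<Psi> (x, y) - of_real (chi x) * Tc * cis (\<beta> * y + k * x)
      - of_real (chi (- x)) * (cis (\<beta> * y + k * x) + Rc * cis (\<beta> * y - k * x))" for x y
  proof -
    have sB: "(\<lambda>j. B / wt j) summable_on UNIV" by (rule weight_summable'[OF B(1)])
    have hP: "((\<lambda>j. \<Psi> j (fst (x, y)) * mode \<beta> j (snd (x, y))) has_sum Sser \<beta> \<Psi> (x, y)) UNIV"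
      by (rule Sser_has_sum[OF B(2) sB])
    have d: "((\<lambda>n. if n = l then z n else 0) has_sum z l) UNIV" for l :: int and z :: "int \<Rightarrow> complex"
      using has_sum_finite_neutralI[of "{l}" UNIV "\<lambda>n. if n = l then z n else 0"] by simp
    have 1: "((\<lambda>j. \<Psi> j (fst (x, y)) * mode \<beta> j (snd (x, y)) + (if j = 0 then - (s x * mode \<beta> j y) else 0)) has_sum Sser \<beta> \<Psi> (x, y) + - (s x * mode \<beta> 0 y)) UNIV"
      by (rule has_sum_add[OF hP d])
    have 2: "((\<lambda>j. u j (fst (x, y)) * mode \<beta> j (snd (x, y))) has_sum Sser \<beta> u (x, y)) UNIV"
    proof (rule Sser_has_sum)
      show "norm (u j (fst (x, y))) \<le> M / wt j" for j
      proof -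
        have "M / wt j * exp (- \<mu> * \<bar>fst (x, y)\<bar>) \<le> M / wt j" using M(1) wt_pos[of j] \<mu>_pos by (intro mult_left_le) auto
        then show ?thesis using bd(1)[of j "fst (x, y)"] by linarith
      qed
    qed (rule weight_summable'[OF M(1)])
    have 3: "u j (fst (x, y)) * mode \<beta> j (snd (x, y)) = \<Psi> j (fst (x, y)) * mode \<beta> j (snd (x, y)) + (if j = 0 then - (s x * mode \<beta> j y) else 0)" for j
      by (simp add: u_def left_diff_distrib)
    have "Sser \<beta> u (x, y) = Sser \<beta> \<Psi> (x, y) - s x * mode \<beta> 0 y"
      using has_sum_unique[OF 2[unfolded 3] 1] by simp
    moreover have "cis (k * x) * mode \<beta> 0 y = cis (\<beta> * y + k * x)" "cis (- k * x) * mode \<beta> 0 y = cis (\<beta> * y - k * x)"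
      by (simp_all add: mode_def cis_mult algebra_simps)
    ultimately show ?thesis
      unfolding s_def distrib_right mult.assoc by (simp add: diff_diff_eq)
  qed
  then have "Sser \<beta> u = (\<lambda>(x, y). Sser \<beta> \<Psi> (x, y) - of_real (chi x) * Tc * cis (\<beta> * y + k * x)
      - of_real (chi (- x)) * (cis (\<beta> * y + k * x) + Rc * cis (\<beta> * y - k * x)))" by auto
  then show ?thesis using H by simp
qed

end

text \<open>The threshold for \<open>\<epsilon>\<close> is built from \<open>Tnorm\<close> and the
  one for \<open>\<mu>\<close> from \<open>\<beta>\<close>, so the range of
  \<open>\<epsilon>\<close> does not shrink as \<open>\<mu>\<close> tends to 0.\<close>

theorem theorem4p4:
  fixes f :: "real \<times> real \<Rightarrow> real" and R \<beta> :: real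
  assumes f_smooth: "smooth2 f"
    and f_per: "\<forall>x y. f (x, y + 2*pi) = f (x, y)"
    and R_pos: "R > 0"
    and f_supp: "\<forall>x y. \<bar>x\<bar> > R \<longrightarrow> f (x, y) = 0"
    and \<beta>: "0 < \<beta>" "\<beta> < 1/2"
  shows "\<exists>\<epsilon>0>0. \<exists>\<mu>0>0. \<forall>\<epsilon> \<mu>. 0 < \<epsilon> \<longrightarrow> \<epsilon> < \<epsilon>0 \<longrightarrow> 0 < \<mu> \<longrightarrow> \<mu> < \<mu>0 \<longrightarrow>
     (let \<gamma> = of_real (gam \<mu> \<beta>) :: complex;
          F = FF f R \<beta> \<epsilon> \<mu>; Q = QQ f R \<beta> \<epsilon> \<mu>;
          e = of_real \<epsilon> :: complex; m = of_real \<mu> :: complex;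
          k = k0 \<beta> \<mu>;
          C = 2 * e * m * \<gamma> * Q / (m - e * \<gamma> * F);
          g = (\<lambda>j x. g1 f \<beta> \<mu> j x + C / (2 * m) * g2 f j x);
          A = (\<lambda>j x. 2 * e * \<gamma> * resolv f R \<beta> \<epsilon> \<mu> g j x);
          \<Psi>n = (\<lambda>j x. (if j = 0 then cis (k * x) else 0) + conv (Gr \<beta> \<mu> j) (A j) x);
          \<Psi> = (\<lambda>(x, y). cis (\<beta> * y) * infsum (\<lambda>j. \<Psi>n j x * cis (of_int j * y)) UNIV);
          Rc = \<i> * e * \<gamma> / of_real k * (1 / (m - e * \<gamma> * F)) *
                 ((m - e * \<gamma> * F) * Pp f R \<beta> \<epsilon> \<mu> + e * \<gamma> * Q * Rp f R \<beta> \<epsilon> \<mu>);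
          Tc = 1 + \<i> * e * \<gamma> / of_real k * (1 / (m - e * \<gamma> * F)) *
                 ((m - e * \<gamma> * F) * Pm f R \<beta> \<epsilon> \<mu> + e * \<gamma> * Q * Rm f R \<beta> \<epsilon> \<mu>)
      in m - e * \<gamma> * F \<noteq> 0 \<longrightarrow>
         weak_sol_P ((1 - \<beta>)\<^sup>2 - \<mu>\<^sup>2) \<epsilon> f \<beta> \<Psi> \<and>
         (\<forall>chi. cutoff chi \<longrightarrow>
            H1beta \<beta> (\<lambda>(x, y). \<Psi> (x, y)
                 - of_real (chi x) * Tc * cis (\<beta> * y + k * x)
                 - of_real (chi (- x)) * (cis (\<beta> * y + k * x) + Rc * cis (\<beta> * y - k * x)))))"
proof -
  interpret scattering_data f R \<beta>
    by unfold_locales (use assms in auto)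
  \<comment> \<open>Ensures \<open>\<epsilon> * Tnorm \<le> 1/2\<close>, the contraction condition;
    the \<open>+ 1\<close> covers \<open>Tnorm = 0\<close>.\<close>
  define \<epsilon>0 where "\<epsilon>0 = 1 / (2 * Tnorm + 1)"
  define \<mu>0 where "\<mu>0 = min (1/2) ((1 - 2*\<beta>) / 2)"
  have pos: "0 < \<epsilon>0" "0 < \<mu>0" using Tnorm_nonneg \<beta> by (auto simp: \<epsilon>0_def \<mu>0_def)
  have sm: "small \<epsilon>" if "0 < \<epsilon>" "\<epsilon> < \<epsilon>0" for \<epsilon>
  proof -
    have "\<epsilon> * (2 * Tnorm + 1) < 1" using that Tnorm_nonneg by (simp add: \<epsilon>0_def pos_less_divide_eq)
    then show ?thesis using that by (simp add: small_def algebra_simps)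
  qed
  have ad: "adm \<mu>" if "0 < \<mu>" "\<mu> < \<mu>0" for \<mu> using that by (simp add: adm_def \<mu>0_def)
  show ?thesis
  proof (rule exI[of _ \<epsilon>0], rule conjI, rule pos(1), rule exI[of _ \<mu>0], rule conjI, rule pos(2),
      intro allI impI, unfold Let_def, rule impI, goal_cases)
    case (1 \<epsilon> \<mu>)
    interpret S: scattering_solution f R \<beta> \<epsilon> \<mu>
      by unfold_locales (use sm[OF 1(1,2)] ad[OF 1(3,4)] 1(5) in auto)
    let ?e = "of_real \<epsilon> :: complex" and ?m = "of_real \<mu> :: complex" and ?\<gamma> = "of_real (gam \<mu> \<beta>) :: complex"
    have d: "?m - ?e * ?\<gamma> * FF f R \<beta> \<epsilon> \<mu> = S.den" "S.den \<noteq> 0" using 1(5) by (simp_all add: S.den_def)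
    have C: "2 * ?e * ?m * ?\<gamma> * QQ f R \<beta> \<epsilon> \<mu> / S.den / (2 * ?m) = S.c"
      using S.\<mu>_pos by (simp add: S.c_def S.eg_def)
    have A: "(\<lambda>x. 2 * ?e * ?\<gamma> * S.r j x) = S.A j" for j by (simp add: S.A_def S.eg_def mult.assoc)
    have P: "cis (\<beta> * y) * infsum (\<lambda>j. S.\<Psi> j x * cis (of_int j * y)) UNIV = Sser \<beta> S.\<Psi> (x, y)" for x y
      by (simp add: Sser_def)
    \<comment> \<open>Dividing the braces by \<open>den\<close> turns the stated coefficients into
      \<open>Rc\<close> and \<open>Tc\<close>, with \<open>z\<close> and \<open>w\<close> standing
      for either pair of means.\<close>
    have R: "\<i> * ?e * ?\<gamma> / of_real S.k * (1 / S.den) * (S.den * z + ?e * ?\<gamma> * QQ f R \<beta> \<epsilon> \<mu> * w)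
        = \<i> * S.eg / of_real S.k * (z + S.c * w)" for z w
      using d(2) S.k_pos by (simp add: S.c_def S.eg_def field_simps)
    show ?case
      unfolding d(1) C S.r_resolv A S.\<Psi>_def[symmetric] P R S.Rc_def[symmetric] S.Tc_def[symmetric]
        S.\<omega>2_def[symmetric] prod.case case_prod_eta
      using S.weak_solution S.radiation by blast
  qed
qed

end
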